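(* Let $k\ge4$ be a fixed integer and let $j,\ell$ be integers with $1\le j\le\ell$ and $\gcd(j,\ell)=1$. Then, as $x\to\infty$, $$\sum_{\substack{2\le n\le x\\ p_1(n)\equiv j\ (\mathrm{mod}\ \ell)}}\mu(n)\omega(n)^{k-1}\ll\frac{x(\log\log x)^{k+2}}{\log x},$$ and also $$\sum_{\substack{2\le n\le x\\ p_1(n)\equiv j\ (\mathrm{mod}\ \ell)}}\mu(n)\binom{\omega(n)-1}{k-1}\ll\frac{x(\log\log x)^{k+2}}{\log x}.$$
   Context: $\mu$ is the Möbius function, $\omega(n)$ the number of distinct prime factors of $n$, and $p_1(n)$ the smallest prime factor of $n\ge2$. Implied constants may depend on $k$ and $\ell$. *)

theory Defs
  imports Complex_Main "HOL-Number_Theory.Number_Theory"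
    "HOL-Computational_Algebra.Squarefree"
begin

definition omega :: "nat \<Rightarrow> nat" where
  "omega n = card (prime_factors n)"

definition moebius_mu :: "nat \<Rightarrow> int" where
  "moebius_mu n = (if squarefree n then (- 1) ^ omega n else 0)"

(* Only meaningful for n >= 2: Min is unspecified on the empty set prime_factors 1. *)
definition least_prime_factor :: "nat \<Rightarrow> nat" where
  "least_prime_factor n = Min (prime_factors n)"

definition lpf_class :: "nat \<Rightarrow> nat \<Rightarrow> real \<Rightarrow> nat set" where
  "lpf_class j l x = {n. 2 \<le> n \<and> real n \<le> x \<and> [least_prime_factor n = j] (mod l)}"

end

theory Submission
  imports Defs "HOL-Complex_Analysis.Complex_Analysis" "HOL-Real_Asymp.Real_Asymp"
begin

text \<open>
  Write \<open>n = p * d * e\<close> with \<open>p\<close> the least prime factor of \<open>n\<close> and \<open>omega d = i\<close>; the weight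
  \<open>omega (n div p) choose i\<close> counts these factorisations of a squarefree \<open>n\<close>, and the powers of
  \<open>omega n\<close> are linear combinations of such weights. For \<open>p\<close> above \<open>x powr (1 / (400 * ln (ln x)))\<close>
  the numbers \<open>n\<close> are so rough that a trivial count suffices. For smaller \<open>p\<close> the inner sum of the
  Moebius function over \<open>e\<close>, restricted to \<open>e\<close> coprime to \<open>d\<close> and to all primes up to \<open>p\<close>, is expanded
  over smooth numbers \<open>h\<close> into values of the Mertens function at \<open>u div h\<close>. It saves a factor
  \<open>(ln u) ^ 2\<close> once the range \<open>u\<close> of \<open>e\<close> exceeds \<open>p powr (100 * ln (ln x))\<close>; the remaining short ranges
  of \<open>e\<close> are absorbed by the density of the integers \<open>d\<close> having \<open>i\<close> prime factors. The congruence
  condition on \<open>p\<close> plays no role, as every \<open>p\<close> is estimated separately.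

  The saving in the Mertens function is obtained without leaving the half plane of absolute convergence:
  the derivatives of the reciprocal of the zeta function are bounded there by small powers of the
  imaginary part, up to the line of real part one, so that the Riesz means of \<open>moebius_mu n * (ln n) ^ A\<close>
  are bounded with no power of \<open>ln x\<close>, whereas trivially they could have size \<open>(ln x) ^ A\<close>.
\<close>

section \<open>Moebius function and Dirichlet series\<close>

text \<open>For \<open>i = k - 1\<close> the exponent \<open>k + 2\<close> is \<open>i\<close> for
  the density of the integers \<open>d\<close>, plus two for sieving the short ranges of
  \<open>e\<close>, plus one for the sum of 1 / p. The two arises as the square of the ratio 100 *
  ln (ln x) between the logarithms of the two ends of a sieved range: the prime sums are bounded
  with a factor 2 too much, because they rest on Chebyshev bounds only. The same loss fixes the
  constant 100: the Euler product over smooth \<open>h\<close> costs exp (12 * ln (ln x)) up to a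
  constant, and Rankin's weight must beat this and still leave a power of ln x. The constant 400
  keeps p powr (100 * ln (ln x)) below x powr (1/4), so that short ranges of \<open>e\<close> never
  reach sqrt x. Two logarithms have to be saved because the sum of 1 / (e * (ln e)^2) converges,
  while a single logarithm would leave a divergent sum. On the analytic side the obstacle is the
  pole of zeta at 1. Bounds that hold up to the line of real part one must survive it, so zeta is
  always handled as (s - 1) * zeta(s), and the bound for its reciprocal carries the factor s - 1,
  which later cancels.\<close>

lemma moebius_mu_1 [simp]: "moebius_mu 1 = 1" "moebius_mu (Suc 0) = 1"
  by (auto simp: moebius_mu_def omega_def)

lemma omega_mult_coprime:
  assumes "coprime a b" "a > 0" "b > 0"
  shows "omega (a * b) = omega a + omega b"
proof -
  have "prime_factors a \<inter> prime_factors b = {}"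
    using assms(1) by (auto dest: coprime_common_divisor_nat in_prime_factors_imp_dvd
        in_prime_factors_imp_prime) (metis coprime_common_divisor in_prime_factors_iff not_prime_unit)
  then show ?thesis
    using assms by (simp add: omega_def prime_factors_product card_Un_disjoint)
qed

lemma moebius_mu_mult_coprime:
  assumes "coprime a b"
  shows "moebius_mu (a * b) = moebius_mu a * moebius_mu b"
proof (cases "a = 0 \<or> b = 0")
  case True
  then show ?thesis by (auto simp: moebius_mu_def)
next
  case False
  then show ?thesis
    using assms omega_mult_coprime[of a b]
    by (auto simp: moebius_mu_def power_add squarefree_mult_coprime dest: squarefree_multD)
qed

lemma omega_prime [simp]: "prime p \<Longrightarrow> omega p = 1"
  by (simp add: omega_def prime_factorization_prime)

lemma moebius_mu_prime: "prime p \<Longrightarrow> moebius_mu p = -1"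
  by (simp add: moebius_mu_def squarefree_prime)

lemma moebius_mu_prime_mult:
  assumes "prime p" "\<not> p dvd m"
  shows "moebius_mu (p * m) = - moebius_mu m"
  using assms moebius_mu_mult_coprime[of p m] by (simp add: moebius_mu_prime prime_imp_coprime)

lemma abs_moebius_mu_le: "\<bar>moebius_mu n\<bar> \<le> 1"
  by (simp add: moebius_mu_def)

lemma moebius_mu_prime_mult_dvd:
  assumes "prime p" "p dvd m"
  shows "moebius_mu (p * m) = 0"
proof -
  have "\<not> squarefree (p * m)"
  proof
    assume "squarefree (p * m)"
    moreover have "p ^ 2 dvd p * m" using assms(2) by (simp add: power2_eq_square)
    ultimately have "p dvd 1" by (rule squarefreeD)
    then show False using assms(1) by simp
  qed
  then show ?thesis by (simp add: moebius_mu_def)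
qed

text \<open>For a fixed prime \<open>q\<close> dividing \<open>n\<close>, multiplication by
  \<open>q\<close> pairs the divisors prime to \<open>q\<close> with divisors of opposite sign. The
  divisors left over are divisible by q^2 and contribute 0.\<close>

lemma sum_moebius_mu_divisors:
  assumes "n > 0"
  shows "(\<Sum>d | d dvd n. moebius_mu d) = (if n = 1 then 1 else 0)"
proof (cases "n = 1")
  case False
  then obtain q where q: "prime q" "q dvd n"
    using prime_factor_nat by blast
  have q0: "q > 0" using q prime_gt_0_nat by blast
  let ?A = "{d. d dvd n \<and> \<not> q dvd d}" and ?B = "{d. d dvd n \<and> q dvd d}"
  have fin: "finite {d. d dvd n}" using assms by simp
  have "(\<Sum>d | d dvd n. moebius_mu d) = (\<Sum>d\<in>?A. moebius_mu d) + (\<Sum>d\<in>?B. moebius_mu d)"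
    by (subst sum.union_disjoint[symmetric]) (use fin in \<open>auto intro!: sum.cong\<close>)
  also have "(\<Sum>d\<in>?B. moebius_mu d) = (\<Sum>d\<in>((*) q ` ?A). moebius_mu d)"
  proof (rule sum.mono_neutral_right)
    show "finite ?B" using fin by simp
    show "(*) q ` ?A \<subseteq> ?B"
      using q by (auto intro: divides_mult simp: prime_imp_coprime)
    show "\<forall>i\<in>?B - (*) q ` ?A. moebius_mu i = 0"
    proof
      fix i assume i: "i \<in> ?B - (*) q ` ?A"
      then obtain m where m: "i = q * m" by auto
      have "q dvd m" using i m q by (auto dest: dvd_mult_right)
      then show "moebius_mu i = 0" using m q moebius_mu_prime_mult_dvd by simp
    qed
  qed
  also have "\<dots> = (\<Sum>d\<in>?A. moebius_mu (q * d))"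
    using q0 by (subst sum.reindex) (auto simp: inj_on_def)
  also have "\<dots> = (\<Sum>d\<in>?A. - moebius_mu d)"
    using q by (intro sum.cong) (auto simp: moebius_mu_prime_mult)
  finally show ?thesis using False by (simp add: sum_negf)
qed (use assms in auto)

section \<open>Dirichlet series whose coefficients grow like a power of the logarithm\<close>

lemma one_plus_ln_power_le:
  fixes e :: real
  assumes "e > 0"
  shows "\<exists>C>0. \<forall>x\<ge>1. (1 + ln x) ^ j \<le> C * x powr e"
proof -
  \<comment> \<open>Dividing by \<open>j + 1\<close> instead of \<open>j\<close> covers the case
    \<open>j = 0\<close> without a case distinction.\<close>
  define d where "d = e / (j + 1)"
  have d: "d > 0" "d * j \<le> e" using assms by (auto simp: d_def field_simps)
  have "(1 + ln x) ^ j \<le> (1 + 1 / d) ^ j * x powr e" if x: "x \<ge> 1" for x :: real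
  proof -
    have "ln (x powr d) \<le> x powr d - 1" using x by (intro ln_le_minus_one) auto
    then have "d * ln x \<le> x powr d" using x by (simp add: ln_powr)
    then have "ln x \<le> x powr d / d" using d by (simp add: field_simps)
    moreover have "1 \<le> x powr d" using x d by (simp add: ge_one_powr_ge_zero)
    ultimately have "1 + ln x \<le> (1 + 1 / d) * x powr d" by (simp add: algebra_simps)
    then have "(1 + ln x) ^ j \<le> ((1 + 1 / d) * x powr d) ^ j"
      using x by (intro power_mono) auto
    also have "\<dots> = (1 + 1 / d) ^ j * x powr (d * j)"
      using x by (simp add: power_mult_distrib powr_power mult.commute)
    also have "\<dots> \<le> (1 + 1 / d) ^ j * x powr e"
      using x d by (intro mult_left_mono powr_mono) auto
    finally show ?thesis .
  qed
  moreover have "(1 + 1 / d) ^ j > 0" using d by (simp add: add_pos_pos)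
  ultimately show ?thesis by blast
qed

text \<open>The term at \<open>n = 0\<close> vanishes, as \<open>0 powr z = 0\<close>.\<close>

definition dser :: "(nat \<Rightarrow> complex) \<Rightarrow> complex \<Rightarrow> complex" where
  "dser a s = (\<Sum>\<^sub>\<infinity>n. a n * of_nat n powr (-s))"

text \<open>This growth condition is stable under pointwise products and strong enough for absolute
  convergence in Re s > 1; it covers the Moebius function, the powers of the logarithm and their
  products.\<close>

definition ln_bdd :: "(nat \<Rightarrow> complex) \<Rightarrow> bool" where
  "ln_bdd a \<longleftrightarrow> (\<exists>C j. \<forall>n\<ge>1. norm (a n) \<le> C * (1 + ln (real n)) ^ j)"

lemma norm_of_nat_powr: "norm (of_nat n powr (-s) :: complex) = real n powr (- Re s)"
  by (cases "n = 0") (simp_all add: norm_powr_real_powr)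

lemma summable_on_nat_powr:
  assumes "c > (1::real)"
  shows "(\<lambda>n::nat. real n powr (-c)) summable_on UNIV"
proof -
  have "summable (\<lambda>n::nat. real n powr (-c))"
    using assms by (subst summable_real_powr_iff) auto
  then show ?thesis by (subst summable_on_UNIV_nonneg_real_iff) auto
qed

lemma dser_abs_summable:
  assumes "ln_bdd a" "Re s > 1"
  shows "(\<lambda>n. norm (a n * of_nat n powr (-s))) summable_on UNIV"
proof -
  obtain C j where C: "\<And>n. n \<ge> 1 \<Longrightarrow> norm (a n) \<le> C * (1 + ln (real n)) ^ j"
    using assms(1) by (auto simp: ln_bdd_def)
  \<comment> \<open>One half of the excess of \<open>Re s\<close> over 1 absorbs the logarithms, the
    other half keeps the majorant summable.\<close>
  define e where "e = (Re s - 1) / 2"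
  have e: "e > 0" using assms by (simp add: e_def)
  obtain C' where C': "C' > 0" "\<And>x::real. x \<ge> 1 \<Longrightarrow> (1 + ln x) ^ j \<le> C' * x powr e"
    using one_plus_ln_power_le[OF e] by blast
  have "(\<lambda>n::nat. (\<bar>C\<bar> * C') * real n powr (-(1 + e))) summable_on UNIV"
    using e by (intro summable_on_cmult_right summable_on_nat_powr) auto
  then show ?thesis
  proof (rule summable_on_comparison_test)
    fix n :: nat
    show "norm (a n * of_nat n powr (-s)) \<le> (\<bar>C\<bar> * C') * real n powr (-(1 + e))"
    proof (cases "n = 0")
      case False
      then have n: "n \<ge> 1" by simp
      have "norm (a n) \<le> \<bar>C\<bar> * (1 + ln (real n)) ^ j"
        by (rule order_trans[OF C[OF n]]) (use n in \<open>auto intro!: mult_right_mono\<close>)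
      also have "\<dots> \<le> \<bar>C\<bar> * (C' * real n powr e)"
        using n C'(2)[of n] by (intro mult_left_mono) auto
      finally have "norm (a n) * real n powr (- Re s) \<le> \<bar>C\<bar> * (C' * real n powr e) * real n powr (- Re s)"
        by (intro mult_right_mono) auto
      also have "\<dots> = (\<bar>C\<bar> * C') * real n powr (e - Re s)"
        by (simp add: powr_add[symmetric] mult.assoc)
      also have "e - Re s = -(1 + e)" by (simp add: e_def field_simps)
      finally show ?thesis by (simp add: norm_mult norm_of_nat_powr)
    qed auto
  qed auto
qed

lemma dser_summable:
  assumes "ln_bdd a" "Re s > 1"
  shows "(\<lambda>n. a n * of_nat n powr (-s)) summable_on UNIV"
  using dser_abs_summable[OF assms] by (rule abs_summable_summable)

lemma ln_bdd_mult:
  assumes "ln_bdd a" "ln_bdd b"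
  shows "ln_bdd (\<lambda>n. a n * b n)"
proof -
  obtain C j D i where
    C: "\<And>n. n \<ge> 1 \<Longrightarrow> norm (a n) \<le> C * (1 + ln (real n)) ^ j" and
    D: "\<And>n. n \<ge> 1 \<Longrightarrow> norm (b n) \<le> D * (1 + ln (real n)) ^ i"
    using assms by (auto simp: ln_bdd_def)
  have "norm (a n * b n) \<le> (C * D) * (1 + ln (real n)) ^ (j + i)" if n: "n \<ge> 1" for n
  proof -
    have "norm (a n) * norm (b n) \<le> (C * (1 + ln (real n)) ^ j) * (D * (1 + ln (real n)) ^ i)"
      using C[OF n] D[OF n] by (intro mult_mono) (auto intro: order_trans[OF norm_ge_zero])
    then show ?thesis by (simp add: norm_mult power_add mult_ac)
  qed
  then show ?thesis by (auto simp: ln_bdd_def)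
qed

lemma ln_bdd_bounded: "(\<And>n. norm (a n) \<le> C) \<Longrightarrow> ln_bdd a"
  unfolding ln_bdd_def by (rule exI[of _ C], rule exI[of _ 0]) auto

lemma ln_bdd_ln: "ln_bdd (\<lambda>n. of_real (ln (real n) ^ j))"
  unfolding ln_bdd_def
  by (rule exI[of _ 1], rule exI[of _ j]) (auto simp: norm_power intro!: power_mono)

text \<open>Absolute convergence permits regrouping the double series by the value of n = d * e. The
  index 0 is left out because it has infinitely many divisors.\<close>

lemma dser_mult:
  assumes "ln_bdd a" "ln_bdd b" "Re s > 1"
  shows "((\<lambda>n. (\<Sum>d | d dvd n. a d * b (n div d)) * of_nat n powr (-s))
            has_sum (dser a s * dser b s)) {1..}"
proof -
  define f where "f = (\<lambda>n. a n * of_nat n powr (-s))"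
  define g where "g = (\<lambda>n. b n * of_nat n powr (-s))"
  have f: "(\<lambda>n. norm (f n)) summable_on UNIV" and g: "(\<lambda>n. norm (g n)) summable_on UNIV"
    unfolding f_def g_def by (intro dser_abs_summable assms)+
  have f': "(f has_sum dser a s) {1..}" 
    using has_sum_infsum[OF abs_summable_summable[OF f]] unfolding dser_def f_def[symmetric]
    by (subst (asm) has_sum_cong_neutral[of _ UNIV _ f]) (auto simp: f_def)
  have g': "(g has_sum dser b s) {1..}" 
    using has_sum_infsum[OF abs_summable_summable[OF g]] unfolding dser_def g_def[symmetric]
    by (subst (asm) has_sum_cong_neutral[of _ UNIV _ g]) (auto simp: g_def)
  have S: "(\<lambda>(x,y). f x * g y) summable_on {1..} \<times> {1..}"
  proof -
    have "(\<lambda>z. norm (case z of (x,y) \<Rightarrow> f x * g y)) summable_on {1..} \<times> {1..}"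
      unfolding Infinite_Sum.abs_summable_on_Sigma_iff using f g
      by (auto simp: norm_mult abs_mult infsum_cmult_right' intro!: summable_on_cmult_left summable_on_cmult_right
            intro: summable_on_subset_banach)
    then show ?thesis by (rule abs_summable_summable)
  qed
  have "((\<lambda>(x,y). f x * g y) has_sum (dser a s * dser b s)) ({1..} \<times> {1..})"
  proof (rule has_sum_SigmaI[OF _ _ S])
    show "((\<lambda>y. case (x, y) of (x, y) \<Rightarrow> f x * g y) has_sum f x * dser b s) {1..}" if "x \<in> {1..}" for x
      using has_sum_cmult_right[OF g', of "f x"] by simp
    show "((\<lambda>x. f x * dser b s) has_sum dser a s * dser b s) {1..}"
      using has_sum_cmult_left[OF f', of "dser b s"] by simp
  qed
  then have "((\<lambda>(n,d). f d * g (n div d)) has_sum (dser a s * dser b s)) (Sigma {1..} (\<lambda>n. {d. d dvd n}))"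
    by (subst has_sum_reindex_bij_witness[where i = "\<lambda>(d,e). (d * e, d)" and j = "\<lambda>(n,d). (d, n div d)"
          and T = "{1..} \<times> {1..}" and h = "\<lambda>(x,y). f x * g y"])
       (auto simp: Suc_le_eq elim!: dvdE)
  then have "((\<lambda>n. \<Sum>d | d dvd n. f d * g (n div d)) has_sum (dser a s * dser b s)) {1..}"
    by (rule has_sum_SigmaD) (auto intro!: has_sum_finiteI)
  then show ?thesis
  proof (rule has_sum_cong[THEN iffD1, rotated])
    fix n :: nat assume n: "n \<in> {1..}"
    have "f d * g (n div d) = a d * b (n div d) * of_nat n powr (-s)" if dn: "d dvd n" for d
    proof -
      obtain e where e: "n = d * e" using dn by auto
      with n have "d > 0" "e > 0" by auto
      then show ?thesis unfolding f_def g_def e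
        by (simp add: powr_times_real)
    qed
    then show "(\<Sum>d | d dvd n. f d * g (n div d)) = (\<Sum>d | d dvd n. a d * b (n div d)) * of_nat n powr (-s)"
      by (simp add: sum_distrib_right)
  qed
qed

section \<open>Euler products and the 3-4-1 inequality\<close>

lemma has_sum_sum:
  fixes f :: "'i \<Rightarrow> 'b \<Rightarrow> complex"
  assumes "\<And>i. i \<in> I \<Longrightarrow> (f i has_sum g i) A"
  shows "((\<lambda>x. \<Sum>i\<in>I. f i x) has_sum (\<Sum>i\<in>I. g i)) A"
  using assms by (induction I rule: infinite_finite_induct) (auto intro!: has_sum_add has_sum_0)

text \<open>Up to the sign \<open>(-1) ^ j\<close>, these are the \<open>j\<close>-th derivatives of zeta and of its reciprocal.\<close>

definition zs :: "nat \<Rightarrow> complex \<Rightarrow> complex" where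
  "zs j = dser (\<lambda>n. of_real (ln (real n) ^ j))"

definition ds :: "nat \<Rightarrow> complex \<Rightarrow> complex" where
  "ds j = dser (\<lambda>n. of_int (moebius_mu n) * of_real (ln (real n) ^ j))"

lemma ln_bdd_moebius_ln: "ln_bdd (\<lambda>n. of_int (moebius_mu n) * of_real (ln (real n) ^ j))"
proof (rule ln_bdd_mult[OF ln_bdd_bounded ln_bdd_ln])
  fix n
  have "\<bar>real_of_int (moebius_mu n)\<bar> \<le> 1" using abs_moebius_mu_le[of n] by linarith
  then show "cmod (of_int (moebius_mu n)) \<le> 1" by simp
qed

text \<open>This is the Leibniz rule for the \<open>A\<close>-th derivative of zeta * (1 / zeta) =
  1, read off from coefficients so that nothing has to be differentiated. By the binomial theorem
  the weights ln (n / d) ^ j * ln d ^ (A - j) add up to ln n ^ A, which leaves the divisor sum of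
  the Moebius function, and only n = 1 survives.\<close>

lemma zs_ds_convolution:
  assumes "Re s > 1"
  shows "(\<Sum>j\<le>A. of_nat (A choose j) * (zs j s * ds (A - j) s)) = (if A = 0 then 1 else 0)"
proof -
  let ?f = "\<lambda>j n. (\<Sum>d | d dvd n. (of_int (moebius_mu d) * of_real (ln (real d) ^ (A - j))) *
                    of_real (ln (real (n div d)) ^ j)) * of_nat n powr (-s) :: complex"
  have "((\<lambda>n. \<Sum>j\<le>A. of_nat (A choose j) * ?f j n) has_sum
          (\<Sum>j\<le>A. of_nat (A choose j) * (ds (A - j) s * zs j s))) {1..}"
    unfolding zs_def ds_def
    by (intro has_sum_sum has_sum_cmult_right dser_mult assms ln_bdd_moebius_ln ln_bdd_ln)
  also have "?this \<longleftrightarrow> ((\<lambda>n. if n = 1 then (if A = 0 then 1 else 0) else 0) has_sum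
          (\<Sum>j\<le>A. of_nat (A choose j) * (ds (A - j) s * zs j s))) {1::nat..}"
  proof (rule has_sum_cong)
    fix n :: nat assume "n \<in> {1..}"
    then have n: "n > 0" by simp
    have "(\<Sum>j\<le>A. of_nat (A choose j) * ?f j n) =
          (\<Sum>d | d dvd n. of_int (moebius_mu d) * (\<Sum>j\<le>A. of_nat (A choose j) *
             of_real (ln (real (n div d)) ^ j) * of_real (ln (real d) ^ (A - j)))) * of_nat n powr (-s)"
      unfolding sum_distrib_right sum_distrib_left
      by (subst sum.swap) (simp add: mult_ac)
    also have "\<dots> = (\<Sum>d | d dvd n. of_int (moebius_mu d) * of_real (ln (real n) ^ A)) * of_nat n powr (-s)"
    proof (intro arg_cong2[where f = "(*)"] sum.cong refl)
      fix d assume "d \<in> {d. d dvd n}"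
      then obtain e where e: "n = d * e" by auto
      with n have de: "d > 0" "e > 0" by auto
      have "(\<Sum>j\<le>A. of_nat (A choose j) * of_real (ln (real (n div d)) ^ j) * of_real (ln (real d) ^ (A - j)))
             = (of_real ((ln (real (n div d)) + ln (real d)) ^ A) :: complex)"
        by (simp add: binomial_ring)
      also have "ln (real (n div d)) + ln (real d) = ln (real n)"
        using de by (simp add: e ln_mult)
      finally show "(\<Sum>j\<le>A. of_nat (A choose j) * of_real (ln (real (n div d)) ^ j) * of_real (ln (real d) ^ (A - j)))
             = (of_real (ln (real n) ^ A) :: complex)" .
    qed
    also have "(\<Sum>d | d dvd n. of_int (moebius_mu d) * of_real (ln (real n) ^ A)) =
               (of_int (\<Sum>d | d dvd n. moebius_mu d) * of_real (ln (real n) ^ A) :: complex)"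
      by (simp add: sum_distrib_right)
    also have "\<dots> * of_nat n powr (-s) = (if n = 1 then (if A = 0 then 1 else 0) else 0)"
      using n by (subst sum_moebius_mu_divisors) (auto simp: power_0_left)
    finally show "(\<Sum>j\<le>A. of_nat (A choose j) * ?f j n) = \<dots>" .
  qed
  finally have *: "((\<lambda>n. if n = 1 then (if A = 0 then 1 else 0) else 0) has_sum
          (\<Sum>j\<le>A. of_nat (A choose j) * (ds (A - j) s * zs j s))) {1::nat..}" .
  have "((\<lambda>n. if n = 1 then (if A = 0 then 1 else 0) else 0) has_sum
          (if A = 0 then 1 else 0 :: complex)) {1::nat..}"
    by (rule has_sum_finite_neutralI[of "{1}"]) auto
  from has_sum_unique[OF * this] show ?thesis by (simp add: mult_ac)
qed

text \<open>Adjoining a prime \<open>q\<close> to \<open>P\<close> adds to the squarefree numbers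
  over \<open>P\<close> exactly their products with \<open>q\<close>, so the sum is multiplied by
  one Euler factor.\<close>

lemma sum_moebius_smooth_euler:
  assumes "finite P" "\<And>q. q \<in> P \<Longrightarrow> prime q"
  shows "finite {n. squarefree n \<and> prime_factors n \<subseteq> P}"
    and "(\<Sum>n | squarefree n \<and> prime_factors n \<subseteq> P. of_int (moebius_mu n) * of_nat n powr (-s)) =
         (\<Prod>q\<in>P. 1 - of_nat q powr (-s) :: complex)"
proof -
  have "finite {n. squarefree n \<and> prime_factors n \<subseteq> P} \<and>
        (\<Sum>n | squarefree n \<and> prime_factors n \<subseteq> P. of_int (moebius_mu n) * of_nat n powr (-s)) =
         (\<Prod>q\<in>P. 1 - of_nat q powr (-s) :: complex)"
    using assms
  proof (induction P rule: finite_induct)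
    case empty
    have "{n::nat. squarefree n \<and> prime_factors n \<subseteq> {}} = {1}"
      by (auto simp: prime_factorization_empty_iff)
    then show ?case by simp
  next
    case (insert q P)
    let ?S = "\<lambda>P. {n::nat. squarefree n \<and> prime_factors n \<subseteq> P}"
    have q: "prime q" and qP: "q \<notin> P" using insert by auto
    have q0: "q > 0" using q prime_gt_0_nat by blast
    have nd: "\<not> q dvd n" if n: "n \<in> ?S P" for n
    proof
      assume "q dvd n"
      moreover have "n > 0" using n by (auto intro: Nat.gr0I)
      ultimately have "q \<in> prime_factors n" using q by (simp add: in_prime_factors_iff)
      then show False using n qP by auto
    qed
    have eq: "?S (insert q P) = ?S P \<union> (*) q ` ?S P"
    proof (intro equalityI subsetI)
      fix n assume n: "n \<in> ?S (insert q P)"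
      show "n \<in> ?S P \<union> (*) q ` ?S P"
      proof (cases "q dvd n")
        case True
        then obtain m where m: "n = q * m" by auto
        have "squarefree m" using n m by (auto dest: squarefree_multD)
        moreover have "m > 0" using calculation by (auto intro: Nat.gr0I)
        moreover have "\<not> q dvd m"
        proof
          assume "q dvd m"
          then have "moebius_mu n = 0" using m q moebius_mu_prime_mult_dvd by simp
          then show False using n by (simp add: moebius_mu_def)
        qed
        moreover have "prime_factors m \<subseteq> P"
        proof
          fix t assume t: "t \<in> prime_factors m"
          then have "t \<in> prime_factors n" using n m q0 calculation(2)
            by (auto simp: in_prime_factors_iff)
          moreover have "t \<noteq> q" using t \<open>\<not> q dvd m\<close> by (auto dest: in_prime_factors_imp_dvd)
          ultimately show "t \<in> P" using n by auto
        qed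
        ultimately have "m \<in> ?S P" by auto
        then show ?thesis using m by auto
      next
        case False
        then show ?thesis using n by (auto dest: in_prime_factors_imp_dvd)
      qed
    next
      fix n assume "n \<in> ?S P \<union> (*) q ` ?S P"
      then consider "n \<in> ?S P" | m where "n = q * m" "m \<in> ?S P" by auto
      then show "n \<in> ?S (insert q P)"
      proof cases
        case 2
        then have "m > 0" by (auto intro: Nat.gr0I)
        moreover have "coprime q m" using nd[OF 2(2)] q by (simp add: prime_imp_coprime)
        ultimately show ?thesis using 2 q q0
          by (auto simp: prime_factors_product prime_factorization_prime squarefree_mult_coprime squarefree_prime)
      qed auto
    qed
    have fin: "finite (?S P)" using insert by auto
    have "q * x \<notin> ?S P" for x using nd[of "q * x"] by auto
    then have disj: "?S P \<inter> (*) q ` ?S P = {}" by blast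
    have "(\<Sum>n\<in>?S (insert q P). of_int (moebius_mu n) * of_nat n powr (-s)) =
          (\<Sum>n\<in>?S P. of_int (moebius_mu n) * of_nat n powr (-s)) +
          (\<Sum>n\<in>(*) q ` ?S P. of_int (moebius_mu n) * of_nat n powr (-s) :: complex)"
      unfolding eq using fin disj by (intro sum.union_disjoint) auto
    also have "(\<Sum>n\<in>(*) q ` ?S P. of_int (moebius_mu n) * of_nat n powr (-s) :: complex) =
       (\<Sum>n\<in>?S P. (- (of_nat q powr (-s))) * (of_int (moebius_mu n) * of_nat n powr (-s)))"
      using q0 nd q by (subst sum.reindex)
        (auto simp: inj_on_def moebius_mu_prime_mult powr_times_real intro!: sum.cong)
    also have "\<dots> = - (of_nat q powr (-s)) * (\<Prod>q\<in>P. 1 - of_nat q powr (-s))"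
      unfolding sum_distrib_left[symmetric] using insert by simp
    also have "(\<Sum>n\<in>?S P. of_int (moebius_mu n) * of_nat n powr (-s)) = (\<Prod>q\<in>P. 1 - of_nat q powr (-s))"
      using insert by simp
    finally have "(\<Sum>n\<in>?S (insert q P). of_int (moebius_mu n) * of_nat n powr (-s)) =
        (\<Prod>q\<in>insert q P. 1 - of_nat q powr (-s))"
      using insert by (simp add: algebra_simps)
    moreover have "finite (?S (insert q P))" unfolding eq using fin by simp
    ultimately show ?case by blast
  qed
  then show "finite {n. squarefree n \<and> prime_factors n \<subseteq> P}"
    "(\<Sum>n | squarefree n \<and> prime_factors n \<subseteq> P. of_int (moebius_mu n) * of_nat n powr (-s)) =
         (\<Prod>q\<in>P. 1 - of_nat q powr (-s) :: complex)" by auto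
qed

lemma ds_0_euler_limit:
  assumes "Re s > 1"
  shows "(\<lambda>N. \<Prod>q | prime q \<and> q \<le> N. 1 - of_nat q powr (-s)) \<longlonglongrightarrow> ds 0 s"
proof -
  define f where "f = (\<lambda>n. of_int (moebius_mu n) * of_nat n powr (-s) :: complex)"
  have f: "(f has_sum ds 0 s) UNIV"
    using has_sum_infsum[OF dser_summable[OF ln_bdd_moebius_ln[of 0] assms]]
    by (simp add: ds_def dser_def f_def)
  define P where "P = (\<lambda>N::nat. {q. prime q \<and> q \<le> N})"
  define S where "S = (\<lambda>N. {n::nat. squarefree n \<and> prime_factors n \<subseteq> P N})"
  have P: "finite (P N)" "\<And>q. q \<in> P N \<Longrightarrow> prime q" for N by (auto simp: P_def)
  have fin: "finite (S N)" for N unfolding S_def by (rule sum_moebius_smooth_euler(1)[OF P]) auto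
  \<comment> \<open>The sets \<open>S N\<close> alone contain only squarefree numbers and do not
    exhaust the naturals, so {..N} is adjoined. The numbers added have all their prime factors up to
    \<open>N\<close> and hence are not squarefree, or are 0; they contribute nothing.\<close>
  have "filterlim (\<lambda>N. S N \<union> {..N}) (finite_subsets_at_top UNIV) sequentially"
    unfolding filterlim_finite_subsets_at_top
  proof (intro allI impI)
    fix X :: "nat set" assume X: "finite X \<and> X \<subseteq> UNIV"
    then have "\<forall>\<^sub>F N in sequentially. \<forall>n\<in>X. n \<le> N"
      by (auto simp: eventually_ball_finite_distrib intro: eventually_ge_at_top)
    then show "\<forall>\<^sub>F N in sequentially. finite (S N \<union> {..N}) \<and> X \<subseteq> S N \<union> {..N} \<and> S N \<union> {..N} \<subseteq> UNIV"
      by eventually_elim (use fin in auto)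
  qed
  then have "(\<lambda>N. sum f (S N \<union> {..N})) \<longlonglongrightarrow> ds 0 s"
    using f unfolding has_sum_def by (rule filterlim_compose[rotated])
  moreover have "sum f (S N \<union> {..N}) = (\<Prod>q | prime q \<and> q \<le> N. 1 - of_nat q powr (-s))" for N
  proof -
    have "sum f (S N \<union> {..N}) = sum f (S N)"
    proof (intro sum.mono_neutral_right ballI)
      fix n assume n: "n \<in> (S N \<union> {..N}) - S N"
      have "prime_factors n \<subseteq> P N"
        using n by (cases "n = 0") (auto simp: P_def in_prime_factors_iff dest!: dvd_imp_le)
      then have "\<not> squarefree n" using n by (auto simp: S_def)
      then show "f n = 0" by (simp add: f_def moebius_mu_def)
    qed (use fin in auto)
    then show ?thesis using sum_moebius_smooth_euler(2)[OF P(1)[of N] P(2)[of _ N], of s]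
      by (simp add: f_def S_def P_def)
  qed
  ultimately show ?thesis by simp
qed

lemma trig_341:
  fixes w :: complex
  assumes "norm w = 1"
  shows "3 + 4 * Re w + Re (w ^ 2) \<ge> 0"
proof -
  have "(Re w)\<^sup>2 + (Im w)\<^sup>2 = 1" using assms by (simp add: cmod_power2[symmetric])
  then have "3 + 4 * Re w + Re (w ^ 2) = 2 * (1 + Re w)\<^sup>2"
    by (simp add: power2_eq_square algebra_simps)
  then show ?thesis by simp
qed

text \<open>The logarithm of the left-hand side is the power series with terms - (r ^ n / n) * (3 +
  4 * Re (w ^ n) + Re (w ^ (2 * n))), none of which is positive by \<open>trig_341\<close>. The term
  n = 0 is 0 by the convention on division by zero.\<close>

lemma euler_factor_341:
  fixes r :: real and w :: complex
  assumes "0 \<le> r" "r < 1" "norm w = 1"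
  shows "norm (1 - of_real r :: complex) ^ 3 * norm (1 - of_real r * w) ^ 4 * norm (1 - of_real r * w ^ 2) \<le> 1"
proof -
  have ln_sums: "(\<lambda>n. - (r ^ n * Re (v ^ n)) / real n) sums ln (norm (1 - of_real r * v))"
    and ne: "norm (1 - of_real r * v) > 0" if "norm v = 1" for v :: complex
  proof -
    let ?z = "- (of_real r * v)"
    have z: "norm ?z < 1" using assms that by (simp add: norm_mult)
    have "?z \<noteq> -1" using z by auto
    then have ne: "1 + ?z \<noteq> 0" by (simp add: eq_neg_iff_add_eq_0 add.commute)
    then show "norm (1 - of_real r * v) > 0" by simp
    have "(\<lambda>n. Re (- ((- ?z) ^ n) / of_nat n)) sums Re (ln (1 + ?z))"
      using Ln_series'[OF z] by (rule sums_Re)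
    moreover have eq: "Re (- ((- ?z) ^ n) / of_nat n) = - (r ^ n * Re (v ^ n)) / real n" for n
    proof -
      have "- ((- ?z) ^ n) / of_nat n = of_real (- (r ^ n) / real n) * v ^ n"
        by (simp add: power_mult_distrib)
      moreover have "Re (of_real (- (r ^ n) / real n) * v ^ n) = - (r ^ n) / real n * Re (v ^ n)" by simp
      ultimately show ?thesis by (metis mult_minus_left times_divide_eq_left)
    qed
    ultimately have "(\<lambda>n. - (r ^ n * Re (v ^ n)) / real n) sums Re (ln (1 + ?z))" 
      unfolding eq by blast
    then show "(\<lambda>n. - (r ^ n * Re (v ^ n)) / real n) sums ln (norm (1 - of_real r * v))"
      using ne by simp
  qed
  have w2: "norm (w ^ 2) = 1" using assms by (simp add: norm_power)
  have sums: "(\<lambda>n. 3 * (- (r ^ n * Re (1 ^ n)) / real n) + 4 * (- (r ^ n * Re (w ^ n)) / real n)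
              + - (r ^ n * Re ((w ^ 2) ^ n)) / real n)
        sums (3 * ln (norm (1 - of_real r * (1::complex))) + 4 * ln (norm (1 - of_real r * w))
              + ln (norm (1 - of_real r * w ^ 2)))"
    by (intro sums_add sums_mult ln_sums assms w2) auto
  have le: "3 * (- (r ^ n * Re (1 ^ n)) / real n) + 4 * (- (r ^ n * Re (w ^ n)) / real n)
              + - (r ^ n * Re ((w ^ 2) ^ n)) / real n \<le> 0" for n
  proof -
    have "3 + 4 * Re (w ^ n) + Re ((w ^ n) ^ 2) \<ge> 0"
      by (rule trig_341) (use assms in \<open>simp add: norm_power\<close>)
    then have "(r ^ n / real n) * (3 + 4 * Re (w ^ n) + Re ((w ^ 2) ^ n)) \<ge> 0"
      using assms by (intro mult_nonneg_nonneg) (auto simp: power_mult[symmetric] mult.commute)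
    then show ?thesis by (simp add: algebra_simps add_divide_distrib)
  qed
  have "3 * ln (norm (1 - of_real r * (1::complex))) + 4 * ln (norm (1 - of_real r * w))
              + ln (norm (1 - of_real r * w ^ 2)) \<le> 0"
    by (rule sums_le[OF le sums sums_zero])
  moreover have "3 * ln a + 4 * ln b + ln c = ln (a ^ 3 * b ^ 4 * c)" if "a > 0" "b > 0" "c > 0" for a b c :: real
    using that by (simp add: ln_mult ln_realpow)
  moreover have "norm (1 - of_real r * (1::complex)) > 0" by (rule ne) simp
  ultimately have "ln (norm (1 - of_real r * (1::complex)) ^ 3 * norm (1 - of_real r * w) ^ 4 * norm (1 - of_real r * w ^ 2)) \<le> 0"
    using ne[OF assms(3)] ne[OF w2] by metis
  then show ?thesis
    using \<open>norm (1 - of_real r * (1::complex)) > 0\<close> ne[OF assms(3)] ne[OF w2]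
    by (subst (asm) ln_le_zero_iff) (auto intro!: mult_pos_pos zero_less_power)
qed

text \<open>The inequality holds factor by factor for finite Euler products and passes to the limit.
  In terms of zeta it is the classical lower bound 1 for zeta(\<sigma>)^3 * |zeta(\<sigma> + it)|^4
  * |zeta(\<sigma> + 2it)|.\<close>

lemma ds_341:
  assumes "\<sigma> > 1"
  shows "norm (ds 0 (of_real \<sigma>)) ^ 3 * norm (ds 0 (Complex \<sigma> t)) ^ 4 * norm (ds 0 (Complex \<sigma> (2 * t))) \<le> 1"
proof -
  define E where "E = (\<lambda>N s. \<Prod>q | prime q \<and> q \<le> N. 1 - of_nat q powr (-s) :: complex)"
  have lim: "(\<lambda>N. E N s) \<longlonglongrightarrow> ds 0 s" if "Re s > 1" for s
    unfolding E_def using ds_0_euler_limit[OF that] .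
  have "(\<lambda>N. norm (E N (of_real \<sigma>)) ^ 3 * norm (E N (Complex \<sigma> t)) ^ 4 * norm (E N (Complex \<sigma> (2 * t))))
      \<longlonglongrightarrow> norm (ds 0 (of_real \<sigma>)) ^ 3 * norm (ds 0 (Complex \<sigma> t)) ^ 4 * norm (ds 0 (Complex \<sigma> (2 * t)))"
    using assms by (intro tendsto_intros lim) auto
  then show ?thesis
  proof (rule LIMSEQ_le_const2, intro exI allI impI)
    fix N :: nat
    have "norm (1 - of_nat q powr (- of_real \<sigma>) :: complex) ^ 3 * norm (1 - of_nat q powr (- Complex \<sigma> t)) ^ 4 *
          norm (1 - of_nat q powr (- Complex \<sigma> (2 * t))) \<le> 1" if q: "prime q" for q :: nat
    proof -
      have q1: "real q > 1" using prime_gt_1_nat[OF q] by simp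
      define r where "r = real q powr (-\<sigma>)"
      define w where "w = (of_nat q :: complex) powr (- Complex 0 t)"
      have r: "0 \<le> r" "r < 1" using q1 assms powr_less_mono[of "-\<sigma>" 0 q] by (auto simp: r_def)
      have w: "norm w = 1" using q1 by (simp add: w_def norm_of_nat_powr)
      have R: "of_real r = (of_nat q :: complex) powr (- of_real \<sigma>)"
        unfolding r_def using q1 by (simp flip: powr_of_real)
      have 1: "of_real r * w = of_nat q powr (- Complex \<sigma> t)"
        unfolding R w_def by (subst powr_add[symmetric]) (simp add: complex_eq_iff Complex_eq)
      have 2: "of_real r * w ^ 2 = of_nat q powr (- Complex \<sigma> (2 * t))"
        unfolding R w_def power2_eq_square powr_add[symmetric] by (simp add: Complex_eq algebra_simps)
      show ?thesis using euler_factor_341[OF r w] unfolding 1 2 unfolding R .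
    qed
    then show "norm (E N (of_real \<sigma>)) ^ 3 * norm (E N (Complex \<sigma> t)) ^ 4 * norm (E N (Complex \<sigma> (2 * t))) \<le> 1"
      unfolding E_def prod_norm[symmetric] prod_power_distrib prod.distrib[symmetric]
      by (intro prod_le_1) auto
  qed
qed

section \<open>Bounds near the line of real part one\<close>

text \<open>A function of a complex variable \<open>z\<close>, so that the mean value inequality
  along the segment from n to n + 1 applies; at z = n it is the general term of
  \<open>zs j s\<close>.\<close>

definition ln_term :: "nat \<Rightarrow> complex \<Rightarrow> complex \<Rightarrow> complex" where
  "ln_term j s z = z powr (-s) * Ln z ^ j"

text \<open>An exact derivative in \<open>z\<close>, up to sign that of \<open>ys_main\<close>; this
  is what makes the sum of these terms comparable with a telescoping sum.\<close>

definition ys_term :: "nat \<Rightarrow> complex \<Rightarrow> complex \<Rightarrow> complex" where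
  "ys_term j s z = (s - 1) * ln_term j s z - of_nat j * ln_term (j - 1) s z"

text \<open>Up to sign, the \<open>j\<close>-th derivative of \<open>(s - 1) * zs 0 s\<close>, which has no pole at \<open>1\<close>.\<close>

definition ys :: "nat \<Rightarrow> complex \<Rightarrow> complex" where
  "ys j s = (s - 1) * zs j s - of_nat j * zs (j - 1) s"

section \<open>Truncation of the series for (s - 1) * zeta(s) and its derivatives\<close>

lemma closed_segment_real:
  assumes "z \<in> closed_segment (of_real a) (of_real b :: complex)" "a \<le> b"
  obtains v where "z = of_real v" "a \<le> v" "v \<le> b"
  using assms by (auto simp: closed_segment_of_real closed_segment_eq_real_ivl)

lemma norm_ln_term:
  assumes "v \<ge> 1"
  shows "norm (ln_term j s (of_real v)) = v powr (- Re s) * ln v ^ j"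
  using assms by (simp add: ln_term_def norm_mult norm_power norm_powr_real_powr Ln_of_real)

lemma ln_term_has_field_derivative:
  assumes "v > 0"
  shows "(ln_term j s has_field_derivative
     (of_nat j * ln_term (j - 1) s (of_real v) - s * ln_term j s (of_real v)) / of_real v) (at (of_real v))"
proof -
  have v: "of_real v \<notin> (\<real>\<^sub>\<le>\<^sub>0 :: complex set)" "of_real v \<noteq> (0 :: complex)"
    using assms by auto
  have *: "of_real v powr (- s - 1) = of_real v powr (- s) / (of_real v :: complex)"
    using v by (simp add: powr_diff)
  show ?thesis unfolding ln_term_def
    by (rule derivative_eq_intros refl v | use v in \<open>simp add: * field_simps\<close>)+
qed

text \<open>The derivative in \<open>z\<close> gains a factor 1 / z, so it is at most of size 1 /
  n^2 up to logarithms, uniformly in Re s > 1. Half a power is given away for the logarithms, and n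
  powr (-3/2) is still summable. The factor 2 ^ j in the constant accounts for replacing ln v by ln
  n.\<close>

lemma ln_term_diff_bound:
  "\<exists>C\<ge>0. \<forall>s n v. Re s > 1 \<longrightarrow> n \<ge> 1 \<longrightarrow> real n \<le> v \<longrightarrow> v \<le> real n + 1 \<longrightarrow>
     norm (ln_term j s (of_real v) - ln_term j s (of_nat n)) \<le> C * (norm s + j) * real n powr (-3/2)"
proof -
  obtain C where C: "C > 0" "\<And>x::real. x \<ge> 1 \<Longrightarrow> (1 + ln x) ^ j \<le> C * x powr (1/2)"
    using one_plus_ln_power_le[of "1/2" j] by auto
  have "norm (ln_term j s (of_real v) - ln_term j s (of_nat n)) \<le> (2 ^ j * C) * (norm s + j) * real n powr (-3/2)"
    if s: "Re s > 1" and n: "n \<ge> 1" and v: "real n \<le> v" "v \<le> real n + 1" for s n v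
  proof -
    let ?S = "closed_segment (of_real (real n)) (of_real (real n + 1)) :: complex set"
    let ?B = "(2 ^ j * C) * (norm s + j) * real n powr (-3/2)"
    have "norm (ln_term j s (of_real v) - ln_term j s (of_real (real n))) \<le> ?B * norm (of_real v - of_real (real n) :: complex)"
    proof (rule field_differentiable_bound[of ?S "ln_term j s"])
      show "convex ?S" by simp
      fix z assume "z \<in> ?S"
      then obtain w where w: "z = of_real w" "real n \<le> w" "w \<le> real n + 1"
        by (rule closed_segment_real) auto
      have w1: "w \<ge> 1" using w n by linarith
      show "(ln_term j s has_field_derivative
         (of_nat j * ln_term (j - 1) s z - s * ln_term j s z) / z) (at z within ?S)"
        unfolding w(1) by (rule has_field_derivative_at_within[OF ln_term_has_field_derivative]) (use w1 in auto)
      have lw: "ln w ^ i \<le> (1 + ln w) ^ j" if "i \<le> j" for i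
      proof -
        have "ln w ^ i \<le> (1 + ln w) ^ i" using w1 by (intro power_mono) auto
        also have "\<dots> \<le> (1 + ln w) ^ j" using w1 that by (intro power_increasing) auto
        finally show ?thesis .
      qed
      have P: "w powr (- Re s) / w \<le> real n powr (-2)"
      proof -
        have "w powr (- Re s) / w = w powr (- Re s - 1)" using w1 by (simp add: powr_diff)
        also have "\<dots> \<le> w powr (-2)" using w1 s by (intro powr_mono) auto
        also have "\<dots> \<le> real n powr (-2)" using w n by (intro powr_mono2') auto
        finally show ?thesis .
      qed
      have L: "(1 + ln w) ^ j \<le> 2 ^ j * C * real n powr (1/2)"
      proof -
        have "ln w \<le> ln (2 * real n)" using w w1 n by (subst ln_le_cancel_iff) auto
        also have "\<dots> = ln 2 + ln (real n)" using n by (simp add: ln_mult)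
        also have "ln 2 \<le> (1::real)" using ln_2_less_1 by simp
        finally have "1 + ln w \<le> 2 * (1 + ln (real n))" using n by (auto intro: order_trans)
        then have "(1 + ln w) ^ j \<le> (2 * (1 + ln (real n))) ^ j" using w1 by (intro power_mono) auto
        also have "\<dots> \<le> 2 ^ j * (C * real n powr (1/2))"
          unfolding power_mult_distrib using C(2)[of n] n by (intro mult_left_mono) auto
        finally show ?thesis by simp
      qed
      have "norm ((of_nat j * ln_term (j - 1) s z - s * ln_term j s z) / z)
         \<le> (j * (w powr (- Re s) * ln w ^ (j - 1)) + norm s * (w powr (- Re s) * ln w ^ j)) / w"
        unfolding w(1) norm_divide using w1
        by (intro divide_mono order_trans[OF norm_triangle_ineq4]) (auto simp: norm_mult norm_ln_term)
      also have "\<dots> \<le> (j * (w powr (- Re s) * (1 + ln w) ^ j) + norm s * (w powr (- Re s) * (1 + ln w) ^ j)) / w"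
        using w1 by (intro divide_right_mono add_mono mult_left_mono lw) auto
      also have "\<dots> = (norm s + j) * (w powr (- Re s) / w) * (1 + ln w) ^ j"
        by (simp add: field_simps)
      also have "\<dots> \<le> (norm s + j) * real n powr (-2) * (2 ^ j * C * real n powr (1/2))"
        using w1 C by (intro mult_mono P L order_refl mult_nonneg_nonneg) auto
      also have "\<dots> = ?B" 
        by (simp add: powr_add[symmetric])
      finally show "norm ((of_nat j * ln_term (j - 1) s z - s * ln_term j s z) / z) \<le> ?B" .
    next
      show "of_real v \<in> ?S"
        unfolding closed_segment_of_real using v by (auto simp: closed_segment_eq_real_ivl simp del: of_real_add)
      show "of_real (real n) \<in> ?S" by (rule ends_in_segment)
    qed
    also have "norm (of_real v - of_real (real n) :: complex) = \<bar>v - real n\<bar>"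
      by (metis norm_of_real of_real_diff)
    also have "?B * \<bar>v - real n\<bar> \<le> ?B * 1" using v C by (intro mult_left_mono) auto
    finally show ?thesis by simp
  qed
  then show ?thesis using C(1) by (intro exI[of _ "2 ^ j * C"]) auto
qed

text \<open>A telescoping form of the integral test: since (b - a) * (b + a) = 1, the difference 1 /
  a - 1 / b equals 1 / (a * b * (a + b)), and b is at most 3/2 * a.\<close>

lemma powr_minus_3_2_le:
  assumes "n \<ge> 1"
  shows "real n powr (-3/2) \<le> 4 * (real n powr (-1/2) - real (Suc n) powr (-1/2))"
proof -
  define a where "a = sqrt (real n)"
  define b where "b = sqrt (real n + 1)"
  have a: "a > 0" "a ^ 2 = real n" using assms by (auto simp: a_def)
  have b: "b > 0" "b ^ 2 = real n + 1" using assms by (auto simp: b_def)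
  have "b ^ 2 \<le> (3/2 * a) ^ 2"
    unfolding power_mult_distrib a(2) b(2) using assms by (simp add: power_divide)
  then have ab: "b \<le> 3/2 * a" by (rule power2_le_imp_le) (use a in simp)
  have "a \<le> b" by (simp add: a_def b_def)
  have e1: "real n powr (-3/2) = 1 / a ^ 3"
  proof -
    have "real n powr (-3/2) = real n powr (-1/2 + (-1/2) + (-1/2))" by simp
    also have "\<dots> = (real n powr (-1/2)) ^ 3" unfolding powr_add by (simp add: power3_eq_cube)
    also have "(real n powr (-1/2)) = 1 / a" using assms by (simp add: a_def powr_minus_divide powr_half_sqrt)
    finally show ?thesis by (simp add: power_divide)
  qed
  have e2: "real n powr (-1/2) = 1 / a" "real (Suc n) powr (-1/2) = 1 / b"
    using assms by (simp_all add: a_def b_def powr_minus_divide powr_half_sqrt add.commute)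
  have "1 = (b - a) * (b + a)" using a b by (simp add: algebra_simps power2_eq_square)
  moreover have "1 / a - 1 / b = ((b - a) * (b + a)) / ((b + a) * a * b)"
    using a(1) b(1) by (simp add: divide_simps)
  ultimately have eq: "1 / a - 1 / b = 1 / ((b + a) * a * b)" by simp
  have "(b + a) * a * b \<le> (3/2 * a + a) * a * (3/2 * a)"
    using a b ab by (intro mult_mono add_mono) auto
  moreover have "(3/2 * a + a) * a * (3/2 * a) = 15/4 * a ^ 3" by (simp add: power3_eq_cube field_simps)
  moreover have "a ^ 3 > 0" using a by simp
  ultimately have "(b + a) * a * b \<le> 4 * a ^ 3" by linarith
  then have "1 / (4 * a ^ 3) \<le> 1 / ((b + a) * a * b)"
    using a b by (intro divide_left_mono mult_pos_pos) auto
  then have "1 / (4 * a ^ 3) \<le> 1 / a - 1 / b" unfolding eq .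
  then show ?thesis unfolding e1 e2 by (simp add: field_simps)
qed

lemma sum_powr_minus_3_2_le:
  assumes "N \<ge> 1" "N \<le> M"
  shows "(\<Sum>n=N..<M. real n powr (-3/2)) \<le> 4 * real N powr (-1/2)"
proof -
  have "(\<Sum>n=N..<M. real n powr (-3/2)) \<le> (\<Sum>n=N..<M. 4 * (real n powr (-1/2) - real (Suc n) powr (-1/2)))"
    using assms by (intro sum_mono powr_minus_3_2_le) auto
  also have "\<dots> = 4 * (real N powr (-1/2) - real M powr (-1/2))"
    using assms(2) by (induction M rule: dec_induct) (auto simp: algebra_simps)
  finally show ?thesis by (smt (verit) powr_ge_zero)
qed

lemma ln_term_of_nat:
  "n \<ge> 1 \<Longrightarrow> ln_term j s (of_nat n) = of_real (ln (real n) ^ j) * of_nat n powr (-s)"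
  by (simp add: ln_term_def Ln_of_nat)

lemma ys_sums:
  assumes "Re s > 1"
  shows "(\<lambda>n. if n = 0 then 0 else ys_term j s (of_nat n)) sums ys j s"
proof -
  have z: "((\<lambda>n. of_real (ln (real n) ^ i) * of_nat n powr (-s)) has_sum zs i s) UNIV" for i
    unfolding zs_def dser_def by (intro has_sum_infsum dser_summable ln_bdd_ln assms)
  have "((\<lambda>n. (s - 1) * (of_real (ln (real n) ^ j) * of_nat n powr (-s)) + (- of_nat j) *
       (of_real (ln (real n) ^ (j - 1)) * of_nat n powr (-s))) has_sum
       ((s - 1) * zs j s + (- of_nat j) * zs (j - 1) s)) UNIV"
    by (intro has_sum_add has_sum_cmult_right z)
  from has_sum_imp_sums[OF this] show ?thesis
    by (rule back_subst[of "\<lambda>x. x"])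
       (auto simp: ys_term_def ln_term_of_nat ys_def fun_eq_iff intro!: arg_cong2[where f = "(sums)"])
qed

text \<open>The boundary term of the comparison: it approximates the tail of the series from z on,
  and it tends to 0 at infinity as long as Re s > 1.\<close>

definition ys_main :: "nat \<Rightarrow> complex \<Rightarrow> complex \<Rightarrow> complex" where
  "ys_main j s z = z powr (1 - s) * Ln z ^ j"

lemma ys_main_has_field_derivative:
  assumes "v > 0"
  shows "(ys_main j s has_field_derivative - ys_term j s (of_real v)) (at (of_real v))"
proof -
  have v: "of_real v \<notin> (\<real>\<^sub>\<le>\<^sub>0 :: complex set)" "of_real v \<noteq> (0 :: complex)"
    using assms by auto
  have *: "of_real v powr (1 - s) = of_real v * (of_real v powr (- s) :: complex)"
    using v powr_add[of "of_real v :: complex" 1 "-s"] by simp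
  show ?thesis unfolding ys_main_def ys_term_def ln_term_def
    by (rule derivative_eq_intros refl v | use v in \<open>simp add: * field_simps\<close>)+
qed

text \<open>The mean value inequality is applied to
  \<open>ys_main j s z + ys_term j s (of_nat n) * z\<close>, whose derivative is a difference of two
  values of \<open>ys_term\<close> at points of distance at most 1.\<close>

lemma ys_term_step_bound:
  "\<exists>C\<ge>0. \<forall>s n. Re s > 1 \<longrightarrow> n \<ge> 1 \<longrightarrow>
     norm (ys_term j s (of_nat n) - (ys_main j s (of_nat n) - ys_main j s (of_nat (Suc n))))
       \<le> C * (norm (s - 1) + j) * (norm s + j) * real n powr (-3/2)"
proof -
  obtain C1 where C1: "C1 \<ge> 0" "\<And>s n v. Re s > 1 \<Longrightarrow> n \<ge> 1 \<Longrightarrow> real n \<le> v \<Longrightarrow> v \<le> real n + 1 \<Longrightarrow>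
     norm (ln_term j s (of_real v) - ln_term j s (of_nat n)) \<le> C1 * (norm s + j) * real n powr (-3/2)"
    using ln_term_diff_bound[of j] by blast
  obtain C2 where C2: "C2 \<ge> 0" "\<And>s n v. Re s > 1 \<Longrightarrow> n \<ge> 1 \<Longrightarrow> real n \<le> v \<Longrightarrow> v \<le> real n + 1 \<Longrightarrow>
     norm (ln_term (j - 1) s (of_real v) - ln_term (j - 1) s (of_nat n)) \<le> C2 * (norm s + (j - 1)) * real n powr (-3/2)"
    using ln_term_diff_bound[of "j - 1"] by blast
  define C where "C = max C1 C2"
  have C: "C \<ge> 0" "C1 \<le> C" "C2 \<le> C" using C1(1) by (auto simp: C_def)
  have "norm (ys_term j s (of_nat n) - (ys_main j s (of_nat n) - ys_main j s (of_nat (Suc n))))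
       \<le> C * (norm (s - 1) + j) * (norm s + j) * real n powr (-3/2)"
    if s: "Re s > 1" and n: "n \<ge> 1" for s n
  proof -
    let ?S = "closed_segment (of_real (real n)) (of_real (real n + 1)) :: complex set"
    let ?B = "C * (norm (s - 1) + j) * (norm s + j) * real n powr (-3/2)"
    let ?f = "\<lambda>z. ys_main j s z + ys_term j s (of_nat n) * z"
    have "norm (?f (of_real (real n + 1)) - ?f (of_real (real n))) \<le> ?B * norm (of_real (real n + 1) - of_real (real n) :: complex)"
    proof (rule field_differentiable_bound[of ?S])
      fix z assume "z \<in> ?S"
      then obtain w where w: "z = of_real w" "real n \<le> w" "w \<le> real n + 1"
        by (rule closed_segment_real) auto
      have w1: "w \<ge> 1" using w n by linarith
      show "(?f has_field_derivative (- ys_term j s z + ys_term j s (of_nat n))) (at z within ?S)"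
        unfolding w(1)
        by (rule has_field_derivative_at_within[OF DERIV_add[OF ys_main_has_field_derivative]])
           (use w1 in \<open>auto intro!: derivative_eq_intros\<close>)
      have "- ys_term j s z + ys_term j s (of_nat n) =
         - ((s - 1) * (ln_term j s z - ln_term j s (of_nat n))) + of_nat j * (ln_term (j - 1) s z - ln_term (j - 1) s (of_nat n))"
        by (simp add: ys_term_def algebra_simps)
      also have "norm \<dots> \<le> norm (s - 1) * norm (ln_term j s z - ln_term j s (of_nat n)) + j * norm (ln_term (j - 1) s z - ln_term (j - 1) s (of_nat n))"
        by (intro order_trans[OF norm_triangle_ineq]) (auto simp: norm_mult)
      also have "\<dots> \<le> norm (s - 1) * (C * (norm s + j) * real n powr (-3/2)) + j * (C * (norm s + j) * real n powr (-3/2))"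
        unfolding w(1)
        by (intro add_mono mult_left_mono order_trans[OF C1(2)[OF s n w(2,3)]] order_trans[OF C2(2)[OF s n w(2,3)]]
             mult_right_mono mult_mono C) (use C1 C2 C in auto)
      also have "\<dots> = ?B" by (simp add: algebra_simps)
      finally show "norm (- ys_term j s z + ys_term j s (of_nat n)) \<le> ?B" .
    qed (rule convex_closed_segment ends_in_segment)+
    then show ?thesis by (simp add: algebra_simps norm_minus_commute)
  qed
  then show ?thesis using C(1) by blast
qed

lemma ys_truncate:
  "\<exists>C\<ge>0. \<forall>s N. Re s > 1 \<longrightarrow> N \<ge> 1 \<longrightarrow>
     norm (ys j s - (\<Sum>n=1..<N. ys_term j s (of_nat n)) - ys_main j s (of_nat N))
       \<le> C * (norm (s - 1) + j) * (norm s + j) * real N powr (-1/2)"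
proof -
  obtain C where C: "C \<ge> 0" "\<And>s n. Re s > 1 \<Longrightarrow> n \<ge> 1 \<Longrightarrow>
     norm (ys_term j s (of_nat n) - (ys_main j s (of_nat n) - ys_main j s (of_nat (Suc n))))
       \<le> C * (norm (s - 1) + j) * (norm s + j) * real n powr (-3/2)"
    using ys_term_step_bound[of j] by blast
  have "norm (ys j s - (\<Sum>n=1..<N. ys_term j s (of_nat n)) - ys_main j s (of_nat N))
       \<le> (C * 4) * (norm (s - 1) + j) * (norm s + j) * real N powr (-1/2)"
    if s: "Re s > 1" and N: "N \<ge> 1" for s N
  proof -
    define b where "b = (\<lambda>n. ys_term j s (of_nat n))"
    define a where "a = (\<lambda>n. ys_main j s (of_nat n))"
    define K where "K = C * (norm (s - 1) + j) * (norm s + j)"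
    have "(\<lambda>M. \<Sum>n<M. if n = 0 then 0 else b n) \<longlonglongrightarrow> ys j s"
      using ys_sums[OF s, of j] unfolding sums_def b_def .
    also have "(\<lambda>M. \<Sum>n<M. if n = 0 then 0 else b n) = (\<lambda>M. \<Sum>n=1..<M. b n)"
      by (intro ext sum.mono_neutral_cong_right) auto
    finally have lim: "(\<lambda>M. \<Sum>n=1..<M. b n) \<longlonglongrightarrow> ys j s" .
    \<comment> \<open>The rate of decay depends on how far \<open>Re s\<close> is from 1, but only
      the limit is used, so the final error bound remains uniform.\<close>
    have a0: "a \<longlonglongrightarrow> 0"
    proof -
      define e where "e = (Re s - 1) / 2"
      have e: "e > 0" using s by (simp add: e_def)
      obtain D where D: "D > 0" "\<And>x::real. x \<ge> 1 \<Longrightarrow> (1 + ln x) ^ j \<le> D * x powr e"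
        using one_plus_ln_power_le[OF e] by blast
      have "(\<lambda>M. D * real M powr (-e)) \<longlonglongrightarrow> D * 0"
        using e by (intro tendsto_intros tendsto_neg_powr filterlim_real_sequentially) auto
      then have "(\<lambda>M. D * real M powr (-e)) \<longlonglongrightarrow> 0" by simp
      then show ?thesis
      proof (rule Lim_null_comparison[rotated])
        show "\<forall>\<^sub>F M in sequentially. norm (a M) \<le> D * real M powr (-e)"
          using eventually_ge_at_top[of 1]
        proof eventually_elim
          case (elim M)
          have "norm (a M) = real M powr (1 - Re s) * ln (real M) ^ j"
            using elim norm_of_nat_powr[of M "s - 1"] by (simp add: a_def ys_main_def norm_mult norm_power Ln_of_nat)
          also have "ln (real M) ^ j \<le> (1 + ln (real M)) ^ j" using elim by (intro power_mono) auto
          also have "\<dots> \<le> D * real M powr e" using D(2)[of M] elim by simp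
          also have "real M powr (1 - Re s) * (D * real M powr e) = D * real M powr (-e)"
            unfolding mult.left_commute[of _ D] powr_add[symmetric]
            by (intro arg_cong2[where f = "(*)"] arg_cong2[where f = "(powr)"] refl) (simp add: e_def field_simps)
          finally show ?case by (simp add: mult_left_mono)
        qed
      qed
    qed
    have "(\<lambda>M. norm ((\<Sum>n=1..<M. b n) - (\<Sum>n=1..<N. b n) - (a N - a M))) \<longlonglongrightarrow>
            norm (ys j s - (\<Sum>n=1..<N. b n) - (a N - 0))"
      by (intro tendsto_intros lim a0)
    then have "norm (ys j s - (\<Sum>n=1..<N. b n) - (a N - 0)) \<le> K * (4 * real N powr (-1/2))"
    proof (rule LIMSEQ_le_const2, intro exI[of _ N] allI impI)
      fix M assume M: "N \<le> M"
      have "(\<Sum>n=1..<M. b n) - (\<Sum>n=1..<N. b n) = (\<Sum>n=N..<M. b n)"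
        using sum.atLeastLessThan_concat[OF N M, of b] by (simp add: algebra_simps)
      moreover have "a N - a M = (\<Sum>n=N..<M. a n - a (Suc n))"
        using M by (induction M rule: dec_induct) (auto simp: algebra_simps)
      ultimately have "norm ((\<Sum>n=1..<M. b n) - (\<Sum>n=1..<N. b n) - (a N - a M)) =
             norm (\<Sum>n=N..<M. b n - (a n - a (Suc n)))"
        by (simp add: sum_subtractf)
      also have "\<dots> \<le> (\<Sum>n=N..<M. K * real n powr (-3/2))"
        using C(2)[OF s] N unfolding a_def b_def K_def by (intro sum_norm_le) auto
      also have "\<dots> = K * (\<Sum>n=N..<M. real n powr (-3/2))" by (simp add: sum_distrib_left)
      also have "\<dots> \<le> K * (4 * real N powr (-1/2))"
        using C(1) by (intro mult_left_mono sum_powr_minus_3_2_le N M) (auto simp: K_def)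
      finally show "norm ((\<Sum>n=1..<M. b n) - (\<Sum>n=1..<N. b n) - (a N - a M)) \<le> K * (4 * real N powr (-1/2))" .
    qed
    then show ?thesis unfolding K_def a_def b_def diff_0_right by (simp only: mult_ac)
  qed
  then show ?thesis using C(1) by (intro exI[of _ "C * 4"]) auto
qed

section \<open>Upper bounds in the strip 1 < Re s <= 2\<close>

lemma sum_inverse_le_ln:
  assumes "N \<ge> 1"
  shows "(\<Sum>n=1..N. 1 / real n) \<le> 1 + ln (real N)"
  using euler_mascheroni_sequence_decreasing[of 1 N] assms
  by (simp add: harm_def inverse_eq_divide)

definition strip :: "complex set" where
  "strip = {s. 1 < Re s \<and> Re s \<le> 2}"

definition tau :: "complex \<Rightarrow> real" where
  "tau s = 1 + \<bar>Im s\<bar>"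

lemma tau_ge_1: "tau s \<ge> 1" by (simp add: tau_def)

lemma norm_le_tau:
  assumes "s \<in> strip"
  shows "norm s \<le> 2 * tau s" "norm (s - 1) \<le> tau s"
proof -
  have "norm s \<le> \<bar>Re s\<bar> + \<bar>Im s\<bar>" by (rule cmod_le)
  then show "norm s \<le> 2 * tau s" using assms by (auto simp: strip_def tau_def)
  have "norm (s - 1) \<le> \<bar>Re (s - 1)\<bar> + \<bar>Im (s - 1)\<bar>" by (rule cmod_le)
  then show "norm (s - 1) \<le> tau s" using assms by (auto simp: strip_def tau_def)
qed

lemma norm_ys_term_le:
  assumes "s \<in> strip" "n \<ge> 1" "n \<le> N"
  shows "norm (ys_term j s (of_nat n)) \<le> (tau s + j) * (1 + ln (real N)) ^ j * (1 / real n)"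
proof -
  have l: "norm (ln_term i s (of_nat n)) \<le> (1 / real n) * (1 + ln (real N)) ^ j" if "i \<le> j" for i
  proof -
    have "norm (ln_term i s (of_nat n)) = real n powr (- Re s) * ln (real n) ^ i"
      using norm_ln_term[of "real n" i s] assms by simp
    also have "\<dots> \<le> real n powr (-1) * (1 + ln (real N)) ^ j"
    proof (intro mult_mono powr_mono)
      have "ln (real n) \<le> ln (real N)" using assms by simp
      then have "ln (real n) \<le> 1 + ln (real N)" by linarith
      then have "ln (real n) ^ i \<le> (1 + ln (real N)) ^ i" using assms by (intro power_mono) auto
      also have "\<dots> \<le> (1 + ln (real N)) ^ j" using assms that by (intro power_increasing) auto
      finally show "ln (real n) ^ i \<le> (1 + ln (real N)) ^ j" .
    qed (use assms in \<open>auto simp: strip_def\<close>)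
    finally show ?thesis using assms by (simp add: powr_minus_divide)
  qed
  have "norm (ys_term j s (of_nat n)) \<le> norm (s - 1) * norm (ln_term j s (of_nat n)) + j * norm (ln_term (j - 1) s (of_nat n))"
    unfolding ys_term_def by (rule order_trans[OF norm_triangle_ineq4]) (simp add: norm_mult)
  also have "\<dots> \<le> tau s * ((1 / real n) * (1 + ln (real N)) ^ j) + j * ((1 / real n) * (1 + ln (real N)) ^ j)"
    using tau_ge_1[of s] by (intro add_mono mult_mono l norm_le_tau assms) auto
  finally show ?thesis by (simp add: algebra_simps)
qed

lemma ys_upper:
  assumes "e > 0"
  shows "\<exists>C>0. \<forall>s\<in>strip. norm (ys j s) \<le> C * tau s powr (1 + e)"
proof -
  obtain C1 where C1: "C1 \<ge> 0" "\<And>s N. Re s > 1 \<Longrightarrow> N \<ge> 1 \<Longrightarrow>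
     norm (ys j s - (\<Sum>n=1..<N. ys_term j s (of_nat n)) - ys_main j s (of_nat N))
       \<le> C1 * (norm (s - 1) + j) * (norm s + j) * real N powr (-1/2)"
    using ys_truncate[of j] by blast
  have e2: "e / 2 > 0" using assms by simp
  obtain C2 where C2: "C2 > 0" "\<And>x::real. x \<ge> 1 \<Longrightarrow> (1 + ln x) ^ Suc j \<le> C2 * x powr (e / 2)"
    using one_plus_ln_power_le[OF e2] by blast
  define C3 where "C3 = (real j + 2) * (C2 * 2 powr (e / 2)) + C1 * (1 + j) * (2 + j)"
  have "norm (ys j s) \<le> C3 * tau s powr (1 + e)" if s: "s \<in> strip" for s
  proof -
    define t where "t = tau s"
    have t: "t \<ge> 1" by (simp add: t_def tau_ge_1)
    have s1: "Re s > 1" using s by (simp add: strip_def)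
    \<comment> \<open>With N of size t^2 the truncation error t * t * N powr (-1/2) is of size t,
      while the logarithms of N in the other two parts cost only t powr e.\<close>
    define N where "N = nat \<lceil>t ^ 2\<rceil>"
    have t2: "t ^ 2 \<ge> 1" using t by simp
    then have N: "real N \<ge> t ^ 2" "real N \<le> 2 * t ^ 2" "N \<ge> 1"
      unfolding N_def by linarith+
    let ?l = "1 + ln (real N)"
    have l: "?l \<ge> 1" using N(3) by simp
    have te: "t powr e * t = t powr (1 + e)" using t by (simp add: powr_add)
    have lt: "?l ^ Suc j \<le> C2 * 2 powr (e / 2) * t powr e"
    proof -
      have "?l ^ Suc j \<le> C2 * real N powr (e / 2)" using C2(2)[of N] N by simp
      also have "\<dots> \<le> C2 * (2 * t ^ 2) powr (e / 2)"
        using C2 N assms by (intro mult_left_mono powr_mono2) auto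
      also have "(2 * t ^ 2) powr (e / 2) = 2 powr (e / 2) * t powr e"
        using t by (simp add: powr_mult powr_powr flip: powr_numeral)
      finally show ?thesis by simp
    qed
    have "norm (\<Sum>n=1..<N. ys_term j s (of_nat n)) \<le> (\<Sum>n=1..<N. (t + j) * ?l ^ j * (1 / real n))"
      unfolding t_def by (intro sum_norm_le norm_ys_term_le s) auto
    also have "\<dots> = (t + j) * ?l ^ j * (\<Sum>n=1..<N. 1 / real n)" by (simp add: sum_distrib_left)
    also have "(\<Sum>n=1..<N. 1 / real n) \<le> (\<Sum>n=1..N. 1 / real n)" by (intro sum_mono2) auto
    also have "\<dots> \<le> ?l" by (rule sum_inverse_le_ln) fact
    finally have "norm (\<Sum>n=1..<N. ys_term j s (of_nat n)) \<le> (t + j) * ?l ^ Suc j"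
      using t l by (simp add: mult_left_mono mult_ac)
    also have "\<dots> \<le> ((1 + j) * t) * (C2 * 2 powr (e / 2) * t powr e)"
      using t l lt mult_left_mono[OF t, of "real j"] by (intro mult_mono) (auto simp: algebra_simps)
    also have "\<dots> = (1 + j) * (C2 * 2 powr (e / 2)) * t powr (1 + e)" by (simp add: te[symmetric] mult_ac)
    finally have A: "norm (\<Sum>n=1..<N. ys_term j s (of_nat n)) \<le> (1 + j) * (C2 * 2 powr (e / 2)) * t powr (1 + e)" .
    have "norm (ys_main j s (of_nat N)) = real N powr (1 - Re s) * ln (real N) ^ j"
      using N norm_of_nat_powr[of N "s - 1"] by (simp add: ys_main_def norm_mult norm_power Ln_of_nat)
    also have "\<dots> \<le> 1 * ?l ^ Suc j"
    proof (intro mult_mono)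
      have "real N powr (1 - Re s) \<le> real N powr 0" using N s1 by (intro powr_mono) auto
      then show "real N powr (1 - Re s) \<le> 1" using N by simp
      have "ln (real N) ^ j \<le> ?l ^ j" using N by (intro power_mono) auto
      also have "\<dots> \<le> ?l ^ Suc j" using l by (intro power_increasing) auto
      finally show "ln (real N) ^ j \<le> ?l ^ Suc j" .
    qed (use N in auto)
    also have "\<dots> \<le> C2 * 2 powr (e / 2) * t powr (1 + e)"
    proof -
      have "t powr e \<le> t powr (1 + e)" using t by (intro powr_mono) auto
      then have "C2 * 2 powr (e / 2) * t powr e \<le> C2 * 2 powr (e / 2) * t powr (1 + e)"
        using C2(1) by (intro mult_left_mono) auto
      with lt show ?thesis by linarith
    qed
    finally have B: "norm (ys_main j s (of_nat N)) \<le> C2 * 2 powr (e / 2) * t powr (1 + e)" .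
    have "real N powr (-1/2) \<le> (t ^ 2) powr (-1/2)" using N t by (intro powr_mono2') auto
    also have "\<dots> = 1 / t" using t by (simp add: powr_minus_divide powr_half_sqrt)
    finally have Nt: "real N powr (-1/2) \<le> 1 / t" .
    have "C1 * (norm (s - 1) + j) * (norm s + j) * real N powr (-1/2) \<le>
          C1 * ((1 + j) * t) * ((2 + j) * t) * (1 / t)"
      using norm_le_tau[OF s] t C1(1) mult_left_mono[OF t, of "real j"] unfolding t_def[symmetric]
      by (intro mult_mono Nt) (auto simp: algebra_simps)
    also have "\<dots> = C1 * (1 + j) * (2 + j) * t" using t by (simp add: field_simps)
    also have "t \<le> t powr (1 + e)" using powr_mono[of 1 "1 + e" t] t assms by simp
    finally have "C1 * (norm (s - 1) + j) * (norm s + j) * real N powr (-1/2) \<le> C1 * (1 + j) * (2 + j) * t powr (1 + e)"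
      using C1(1) by (simp add: mult_left_mono)
    with C1(2)[OF s1 N(3)] have D: "norm (ys j s - (\<Sum>n=1..<N. ys_term j s (of_nat n)) - ys_main j s (of_nat N))
      \<le> C1 * (1 + j) * (2 + j) * t powr (1 + e)" by linarith
    have "norm (ys j s) = norm ((ys j s - (\<Sum>n=1..<N. ys_term j s (of_nat n)) - ys_main j s (of_nat N)) +
       ((\<Sum>n=1..<N. ys_term j s (of_nat n)) + ys_main j s (of_nat N)))" by simp
    also have "\<dots> \<le> C1 * (1 + j) * (2 + j) * t powr (1 + e) + ((1 + j) * (C2 * 2 powr (e / 2)) * t powr (1 + e) +
       C2 * 2 powr (e / 2) * t powr (1 + e))"
      by (intro order_trans[OF norm_triangle_ineq] add_mono A B D)
    also have "\<dots> = C3 * t powr (1 + e)" by (simp add: C3_def algebra_simps)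
    finally show ?thesis by (simp add: t_def)
  qed
  moreover have "C3 > 0"
  proof -
    have "0 < (real j + 2) * (C2 * 2 powr (e / 2))" using C2(1) by (intro mult_pos_pos) auto
    moreover have "0 \<le> C1 * (1 + j) * (2 + j)" using C1(1) by simp
    ultimately show ?thesis unfolding C3_def by linarith
  qed
  ultimately show ?thesis by blast
qed

section \<open>Bounds for the reciprocal of zeta\<close>

lemma ys_0_lower_near_1:
  "\<exists>c>0. c \<le> 1 \<and> (\<forall>s\<in>strip. norm (s - 1) \<le> c \<longrightarrow> norm (ys 0 s) \<ge> 1/2)"
proof -
  obtain C where C: "C \<ge> 0" "\<And>s N. Re s > 1 \<Longrightarrow> N \<ge> 1 \<Longrightarrow>
     norm (ys 0 s - (\<Sum>n=1..<N. ys_term 0 s (of_nat n)) - ys_main 0 s (of_nat N))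
       \<le> C * (norm (s - 1) + real 0) * (norm s + real 0) * real N powr (-1/2)"
    using ys_truncate[of 0] by blast
  define c where "c = 1 / (4 * C + 1)"
  have c: "c > 0" "c \<le> 1" "C * c * 2 \<le> 1/2" using C(1) by (auto simp: c_def field_simps)
  have "norm (ys 0 s) \<ge> 1/2" if s: "s \<in> strip" "norm (s - 1) \<le> c" for s
  proof -
    have "norm s = norm ((s - 1) + 1)" by simp
    also have "\<dots> \<le> norm (s - 1) + 1" using norm_triangle_ineq[of "s - 1" 1] by simp
    finally have s2: "norm s \<le> 2" using s c by linarith
    \<comment> \<open>Truncation at N = 1: the sum is empty and the main term is 1.\<close>
    have "norm (ys 0 s - 1) \<le> C * norm (s - 1) * norm s"
      using C(2)[of s 1] s by (simp add: ys_main_def strip_def)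
    also have "\<dots> \<le> C * c * 2" using C s s2 c by (intro mult_mono) auto
    finally have "norm (1 - ys 0 s) \<le> 1/2" using c by (simp add: norm_minus_commute)
    moreover have "norm (1::complex) - norm (ys 0 s) \<le> norm (1 - ys 0 s)" by (rule norm_triangle_ineq2)
    ultimately show ?thesis by simp
  qed
  then show ?thesis using c by blast
qed

lemma zs_0_has_field_derivative:
  assumes "Re s > 1"
  shows "(zs 0 has_field_derivative - zs 1 s) (at s)"
proof -
  \<comment> \<open>Halfway between 1 and \<open>Re s\<close>: on the half plane Re z > c the
    differentiated series has a summable majorant independent of z.\<close>
  define c where "c = (1 + Re s) / 2"
  have c: "c > 1" "c < Re s" using assms by (auto simp: c_def)
  let ?S = "{z. Re z > c}"
  let ?f = "\<lambda>n z. of_nat n powr (-z) :: complex"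
  let ?f' = "\<lambda>n z. - (of_real (ln (real n)) * of_nat n powr (-z)) :: complex"
  have op: "open ?S" by (rule open_halfspace_Re_gt)
  have sm: "(\<lambda>n. of_real (ln (real n) ^ j) * of_nat n powr (-z)) sums zs j z" if "Re z > 1" for j z
    using has_sum_imp_sums[OF has_sum_infsum[OF dser_summable[OF ln_bdd_ln[of j] that]]]
    by (simp add: zs_def dser_def)
  have suminf: "zs 0 z = (\<Sum>n. ?f n z)" "zs 1 z = - (\<Sum>n. ?f' n z)" if "Re z > 1" for z
    using sums_unique[OF sm[OF that, of 0]] sums_unique[OF sm[OF that, of 1]]
      suminf_minus[OF sums_summable[OF sm[OF that, of 1]]] by simp_all
  have "((\<lambda>z. \<Sum>n. ?f n z) has_field_derivative (\<Sum>n. ?f' n s)) (at s)"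
  proof (rule has_field_derivative_series'(2)[of ?S])
    show "convex ?S" by (rule convex_halfspace_Re_gt)
    show "(?f n has_field_derivative ?f' n z) (at z within ?S)" for n z
    proof (cases "n = 0")
      case False
      then show ?thesis by (auto simp: powr_def Ln_of_nat intro!: derivative_eq_intros)
    qed auto
    show "s \<in> ?S" using c by simp
    show "s \<in> interior ?S" using c op by (simp add: interior_open)
    show "summable (\<lambda>n. ?f n s)" using sums_summable[OF sm[OF assms, of 0]] by simp
    show "uniformly_convergent_on ?S (\<lambda>n z. \<Sum>i<n. ?f' i z)"
    proof (rule Weierstrass_m_test')
      fix n z assume z: "z \<in> ?S"
      show "norm (?f' n z) \<le> norm (of_real (ln (real n) ^ 1) * of_nat n powr (- of_real c) :: complex)"
      proof (cases "n = 0")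
        case False
        then show ?thesis using z c
          by (auto simp: norm_mult norm_of_nat_powr intro!: mult_left_mono powr_mono)
      qed auto
    next
      have "(\<lambda>n. norm (of_real (ln (real n) ^ 1) * of_nat n powr (- of_real c) :: complex)) summable_on UNIV"
        using dser_abs_summable[OF ln_bdd_ln[of 1], of "of_real c"] c by simp
      then show "summable (\<lambda>n. norm (of_real (ln (real n) ^ 1) * of_nat n powr (- of_real c) :: complex))"
        by (subst (asm) summable_on_UNIV_nonneg_real_iff) auto
    qed
  qed
  then have "((\<lambda>z. \<Sum>n. ?f n z) has_field_derivative - zs 1 s) (at s)" using suminf(2)[OF assms] by simp
  then show ?thesis
    by (rule has_field_derivative_transform_within_open[OF _ op]) (use c suminf(1) in auto)
qed

lemma zs_0_ds_0: "Re s > 1 \<Longrightarrow> zs 0 s * ds 0 s = 1"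
  using zs_ds_convolution[of s 0] by simp

lemma ys_0: "ys 0 s = (s - 1) * zs 0 s"
  by (simp add: ys_def)

text \<open>Write T for \<open>tau s powr e\<close>. At distance at least \<rho>^4 to the right of
  the line, the 3-4-1 inequality bounds zeta(s) below by a multiple of \<rho>^3 / T. Closer to the
  line one moves right to distance \<rho>^4; the derivative bound makes this cost at most a multiple
  of T * \<rho>^4, which is harmless once \<rho> is a small multiple of 1 / T^2. The resulting lower
  bound \<rho>^3 / T has size T^(-7), whence the exponent 7 * e.\<close>

lemma norm_ds_0_le_away:
  assumes c: "c > 0" and e: "0 < e" "e \<le> 1"
  shows "\<exists>C>0. \<forall>s\<in>strip. \<bar>Im s\<bar> \<ge> c \<longrightarrow> norm (ds 0 s) \<le> C * tau s powr (7 * e)"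
proof -
  obtain C0 where C0: "C0 > 0" "\<And>s. s \<in> strip \<Longrightarrow> norm (ys 0 s) \<le> C0 * tau s powr (1 + e)"
    using ys_upper[OF e(1)] by blast
  obtain C1 where C1: "C1 > 0" "\<And>s. s \<in> strip \<Longrightarrow> norm (ys 1 s) \<le> C1 * tau s powr (1 + e)"
    using ys_upper[OF e(1)] by blast
  \<comment> \<open>This is the minimum of |Im s| / \<open>tau s\<close> over |Im s| >= c.\<close>
  define k where "k = c / (c + 1)"
  have k: "k > 0" using c by (simp add: k_def)
  define B where "B = 1 + C0 / k + C1 / k + C0 / k / k"
  have B: "B \<ge> 1" "B \<ge> C0 / k" "B \<ge> C1 / k + C0 / k / k" using C0 C1 k by (auto simp: B_def)
  have kC: "C0 \<le> C0 / k" using C0 k c by (auto simp: k_def field_simps)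
  have s1: "norm (s - 1) \<ge> k * tau s" if "\<bar>Im s\<bar> \<ge> c" for s
  proof -
    have "k * tau s \<le> \<bar>Im s\<bar>" using that c by (simp add: k_def tau_def field_simps)
    also have "\<dots> \<le> norm (s - 1)" using abs_Im_le_cmod[of "s - 1"] by simp
    finally show ?thesis .
  qed
  have tp: "tau s powr (1 + e) = tau s * tau s powr e" for s
    using tau_ge_1[of s] by (simp add: powr_add)
  have Z0': "norm (zs 0 s) \<le> C0 / k * tau s powr e" if s: "s \<in> strip" "\<bar>Im s\<bar> \<ge> c" for s
  proof -
    have "k * tau s * norm (zs 0 s) \<le> norm (s - 1) * norm (zs 0 s)"
      by (intro mult_right_mono s1 s) auto
    also have "\<dots> \<le> C0 * (tau s * tau s powr e)"
      using C0(2)[OF s(1)] by (simp add: ys_0 norm_mult tp)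
    finally show ?thesis using k tau_ge_1[of s] by (simp add: field_simps)
  qed
  have Z0: "norm (zs 0 s) \<le> B * tau s powr e" if s: "s \<in> strip" "\<bar>Im s\<bar> \<ge> c" for s
    by (rule order_trans[OF Z0'[OF s] mult_right_mono[OF B(2)]]) auto
  have Z1: "norm (zs 1 s) \<le> B * tau s powr e" if s: "s \<in> strip" "\<bar>Im s\<bar> \<ge> c" for s
  proof -
    have "(s - 1) * zs 1 s = ys 1 s + zs 0 s" by (simp add: ys_def)
    then have "norm (s - 1) * norm (zs 1 s) \<le> norm (ys 1 s) + norm (zs 0 s)"
      by (metis norm_mult norm_triangle_ineq)
    also have "\<dots> \<le> C1 * (tau s * tau s powr e) + C0 / k * (tau s * tau s powr e)"
    proof (intro add_mono)
      show "norm (ys 1 s) \<le> C1 * (tau s * tau s powr e)" using C1(2)[OF s(1)] by (simp add: tp)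
      have "tau s powr e \<le> tau s * tau s powr e" using tau_ge_1[of s] by simp
      then show "norm (zs 0 s) \<le> C0 / k * (tau s * tau s powr e)"
        using C0 k by (intro order_trans[OF Z0'[OF s]] mult_left_mono) auto
    qed
    finally have "norm (s - 1) * norm (zs 1 s) \<le> (C1 + C0 / k) * (tau s * tau s powr e)"
      by (simp add: algebra_simps)
    moreover have "k * tau s * norm (zs 1 s) \<le> norm (s - 1) * norm (zs 1 s)"
      by (intro mult_right_mono s1 s) auto
    ultimately have "k * tau s * norm (zs 1 s) \<le> (C1 + C0 / k) * (tau s * tau s powr e)" by linarith
    then have "tau s * (k * norm (zs 1 s)) \<le> tau s * ((C1 + C0 / k) * tau s powr e)"
      by (simp add: mult_ac)
    then have "k * norm (zs 1 s) \<le> (C1 + C0 / k) * tau s powr e"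
      using tau_ge_1[of s] by (subst (asm) mult_le_cancel_left_pos) auto
    then have "norm (zs 1 s) \<le> (C1 / k + C0 / k / k) * tau s powr e"
      using k by (simp add: field_simps)
    also have "\<dots> \<le> B * tau s powr e" using B by (intro mult_right_mono) auto
    finally show ?thesis .
  qed
  have Zr: "norm (zs 0 (of_real \<sigma>)) \<le> B / (\<sigma> - 1)" if "1 < \<sigma>" "\<sigma> \<le> 2" for \<sigma> :: real
  proof -
    have "norm (of_real \<sigma> - 1 :: complex) = \<sigma> - 1"
      using that by (metis abs_of_pos diff_gt_0_iff_gt norm_of_real of_real_1 of_real_diff)
    then have "(\<sigma> - 1) * norm (zs 0 (of_real \<sigma>)) \<le> C0"
      using C0(2)[of "of_real \<sigma>"] that by (simp add: ys_0 norm_mult strip_def tau_def)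
    also have "C0 \<le> B" using kC B by simp
    finally show ?thesis using that by (simp add: field_simps)
  qed
  have low4: "(Re s - 1) ^ 3 \<le> (2 * B * tau s powr e) ^ 4 * norm (zs 0 s) ^ 4" if s: "s \<in> strip" "\<bar>Im s\<bar> \<ge> c" for s
  proof -
    define \<sigma> t where "\<sigma> = Re s" and "t = Im s"
    have seq: "s = Complex \<sigma> t" by (simp add: \<sigma>_def t_def)
    have \<sigma>: "1 < \<sigma>" "\<sigma> \<le> 2" using s by (auto simp: strip_def \<sigma>_def)
    let ?s2 = "Complex \<sigma> (2 * t)"
    have s2: "?s2 \<in> strip" "\<bar>Im ?s2\<bar> \<ge> c" using s c by (auto simp: strip_def \<sigma>_def t_def)
    have inv: "norm (zs 0 z) * norm (ds 0 z) = 1" if "Re z > 1" for z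
      using zs_0_ds_0[OF that] by (metis norm_mult norm_one)
    have "1 = (norm (zs 0 (of_real \<sigma>)) * norm (ds 0 (of_real \<sigma>))) ^ 3 * (norm (zs 0 s) * norm (ds 0 s)) ^ 4 *
              (norm (zs 0 ?s2) * norm (ds 0 ?s2))"
      using \<sigma> by (simp add: inv seq)
    also have "\<dots> = (norm (zs 0 (of_real \<sigma>)) ^ 3 * norm (zs 0 s) ^ 4 * norm (zs 0 ?s2)) *
         (norm (ds 0 (of_real \<sigma>)) ^ 3 * norm (ds 0 s) ^ 4 * norm (ds 0 ?s2))"
      by (simp add: power_mult_distrib mult_ac)
    also have "\<dots> \<le> (norm (zs 0 (of_real \<sigma>)) ^ 3 * norm (zs 0 s) ^ 4 * norm (zs 0 ?s2)) * 1"
      using ds_341[of \<sigma> t] \<sigma> by (intro mult_left_mono) (auto simp: seq)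
    also have "\<dots> \<le> (B / (\<sigma> - 1)) ^ 3 * norm (zs 0 s) ^ 4 * (B * (2 * tau s) powr e)"
    proof -
      have "tau ?s2 powr e \<le> (2 * tau s) powr e"
        using e by (intro powr_mono2) (auto simp: tau_def t_def)
      then have "norm (zs 0 ?s2) \<le> B * (2 * tau s) powr e"
        using B by (intro order_trans[OF Z0[OF s2]] mult_left_mono) auto
      then show ?thesis unfolding mult_1_right
        by (intro mult_mono power_mono Zr \<sigma>) (use B \<sigma> in auto)
    qed
    finally have "(\<sigma> - 1) ^ 3 \<le> B ^ 3 * norm (zs 0 s) ^ 4 * (B * (2 * tau s) powr e)"
      using \<sigma> by (simp add: power_divide field_simps)
    \<comment> \<open>A deliberately crude bound that turns the right-hand side into a perfect
      fourth power.\<close>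
    also have "(2 * tau s) powr e \<le> 2 ^ 4 * (tau s powr e) ^ 4"
    proof -
      have "2 powr e \<le> 2 powr 4" using e by (intro powr_mono) auto
      moreover have "tau s powr e \<ge> 1" using tau_ge_1[of s] e by (simp add: ge_one_powr_ge_zero)
      then have "tau s powr e \<le> (tau s powr e) ^ 4"
        using power_increasing[of 1 4 "tau s powr e"] by simp
      ultimately show ?thesis using tau_ge_1[of s] by (simp add: powr_mult mult_mono)
    qed
    finally have "(\<sigma> - 1) ^ 3 \<le> B ^ 3 * norm (zs 0 s) ^ 4 * (B * (2 ^ 4 * (tau s powr e) ^ 4))"
      using B by (simp add: mult_left_mono)
    also have "\<dots> = (2 * B * tau s powr e) ^ 4 * norm (zs 0 s) ^ 4"
      by (simp add: power_mult_distrib power_numeral_reduce mult_ac)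
    finally show ?thesis by (simp add: \<sigma>_def)
  qed
  \<comment> \<open>With the distance from the line written as a fourth power, the fourth root can
    be taken without fractional exponents.\<close>
  have low: "\<rho> ^ 3 \<le> 2 * B * tau s powr e * norm (zs 0 s)"
    if s: "s \<in> strip" "\<bar>Im s\<bar> \<ge> c" and \<rho>: "\<rho> \<ge> 0" "Re s \<ge> 1 + \<rho> ^ 4" for s \<rho>
  proof -
    have "(\<rho> ^ 3) ^ 4 = (\<rho> ^ 4) ^ 3" by (simp add: power_mult[symmetric])
    also have "\<dots> \<le> (Re s - 1) ^ 3" using \<rho> by (intro power_mono) auto
    also have "\<dots> \<le> (2 * B * tau s powr e * norm (zs 0 s)) ^ 4"
      using low4[OF s] by (simp add: power_mult_distrib)
    finally show ?thesis using B by (subst (asm) power_mono_iff) (auto simp: \<rho>)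
  qed
  have "norm (ds 0 s) \<le> (256 * B ^ 7) * tau s powr (7 * e)" if s: "s \<in> strip" "\<bar>Im s\<bar> \<ge> c" for s
  proof -
    define T where "T = tau s powr e"
    have T: "T \<ge> 1" using tau_ge_1[of s] e by (simp add: T_def ge_one_powr_ge_zero)
    \<comment> \<open>Chosen so that B^2 * T^2 * \<rho> = 1/4; moving to the line then consumes only
      half of \<rho>^3.\<close>
    define \<rho> where "\<rho> = 1 / (4 * B ^ 2 * T ^ 2)"
    have BT: "B ^ 2 * T ^ 2 \<ge> 1" using B T by (metis mult_mono one_le_power mult_1 zero_le_one zero_le_power2)
    have \<rho>: "\<rho> > 0" "\<rho> \<le> 1" using BT B T by (auto simp: \<rho>_def field_simps)
    have "\<rho> ^ 3 \<le> 4 * B * T * norm (zs 0 s)"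
    proof (cases "Re s \<ge> 1 + \<rho> ^ 4")
      case True
      have "\<rho> ^ 3 \<le> 2 * B * T * norm (zs 0 s)" using low[OF s _ True] \<rho> by (simp add: T_def)
      also have "\<dots> \<le> 4 * B * T * norm (zs 0 s)" using B T by (intro mult_right_mono) auto
      finally show ?thesis .
    next
      case False
      define s' where "s' = Complex (1 + \<rho> ^ 4) (Im s)"
      have \<rho>4: "\<rho> ^ 4 \<le> 1" "\<rho> ^ 4 > 0" using \<rho> by (auto simp: power_le_one)
      have s': "s' \<in> strip" "\<bar>Im s'\<bar> \<ge> c" "tau s' = tau s" "Re s' = 1 + \<rho> ^ 4"
        using s \<rho>4 by (auto simp: s'_def strip_def tau_def)
      have seg: "z \<in> strip \<and> Im z = Im s" if z: "z \<in> closed_segment s s'" for z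
      proof -
        from z obtain u where u: "0 \<le> u" "u \<le> 1" "z = (1 - u) *\<^sub>R s + u *\<^sub>R s'" by (auto simp: in_segment)
        have "Im z = Im s" unfolding u by (simp add: s'_def algebra_simps)
        moreover have "Re z = Re s + u * (Re s' - Re s)" unfolding u by (simp add: algebra_simps)
        moreover have "0 \<le> u * (Re s' - Re s)" "u * (Re s' - Re s) \<le> 1 * (Re s' - Re s)"
          using False s' u by (auto intro!: mult_right_mono)
        ultimately show ?thesis using s(1) s'(1) by (auto simp: strip_def)
      qed
      have "norm (zs 0 s' - zs 0 s) \<le> (B * T) * norm (s' - s)"
      proof (rule field_differentiable_bound[of "closed_segment s s'" "zs 0" "\<lambda>z. - zs 1 z"])
        fix z assume z: "z \<in> closed_segment s s'"
        show "(zs 0 has_field_derivative - zs 1 z) (at z within closed_segment s s')"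
          using seg[OF z] by (intro has_field_derivative_at_within[OF zs_0_has_field_derivative]) (auto simp: strip_def)
        show "norm (- zs 1 z) \<le> B * T"
          using Z1[of z] seg[OF z] s by (simp add: T_def tau_def)
      qed auto
      also have "norm (s' - s) = Re s' - Re s"
        using False s' by (simp add: cmod_def s'_def)
      also have "\<dots> \<le> \<rho> ^ 4" using s' s by (simp add: strip_def)
      finally have "norm (zs 0 s' - zs 0 s) \<le> B * T * \<rho> ^ 4" using B T by (simp add: mult_left_mono)
      moreover have "\<rho> ^ 3 \<le> 2 * B * T * norm (zs 0 s')"
        using low[of s' \<rho>] s' \<rho> by (simp add: T_def)
      moreover have "norm (zs 0 s') - norm (zs 0 s) \<le> norm (zs 0 s' - zs 0 s)" by (rule norm_triangle_ineq2)
      ultimately have le: "\<rho> ^ 3 \<le> 2 * B * T * norm (zs 0 s')" "norm (zs 0 s') \<le> norm (zs 0 s) + B * T * \<rho> ^ 4"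
        by linarith+
      have "2 * B * T * norm (zs 0 s') \<le> 2 * B * T * (norm (zs 0 s) + B * T * \<rho> ^ 4)"
        by (rule mult_left_mono[OF le(2)]) (use B T in auto)
      also have "\<dots> = 2 * B * T * norm (zs 0 s) + \<rho> ^ 3 * (2 * (B ^ 2 * T ^ 2 * \<rho>))"
        by (simp add: power2_eq_square power3_eq_cube power4_eq_xxxx algebra_simps)
      also have "B ^ 2 * T ^ 2 * \<rho> = 1/4" using B T by (simp add: \<rho>_def)
      finally show ?thesis using le(1) by simp
    qed
    then have "\<rho> ^ 3 * norm (ds 0 s) \<le> 4 * B * T * norm (zs 0 s) * norm (ds 0 s)"
      by (rule mult_right_mono) simp
    also have "\<dots> = 4 * B * T * norm (zs 0 s * ds 0 s)" by (simp add: norm_mult)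
    also have "zs 0 s * ds 0 s = 1"
      using zs_0_ds_0[of s] s by (simp add: strip_def)
    finally have "\<rho> ^ 3 * norm (ds 0 s) \<le> 4 * B * T" by simp
    moreover have "\<rho> ^ 3 = 1 / (64 * B ^ 6 * T ^ 6)"
      by (simp add: \<rho>_def power_divide power_mult_distrib flip: power_mult)
    ultimately have "norm (ds 0 s) \<le> 4 * B * T * (64 * B ^ 6 * T ^ 6)"
      using B T by (simp add: pos_divide_le_eq)
    also have "\<dots> = 256 * (B * B ^ 6) * (T * T ^ 6)" by simp
    also have "\<dots> = 256 * B ^ 7 * T ^ 7" by (simp flip: power_Suc)
    also have "T ^ 7 = tau s powr (7 * e)"
      using tau_ge_1[of s] by (simp add: T_def powr_power mult.commute)
    finally show ?thesis .
  qed
  then show ?thesis using B by (intro exI[of _ "256 * B ^ 7"]) auto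
qed

text \<open>The factor \<open>norm (s - 1)\<close> records the zero of 1 / zeta at the pole of zeta;
  it is what cancels the division by s - 1 in \<open>norm_ds_le\<close>. Near 1 it comes from the
  lower bound for (s - 1) * zeta(s). Elsewhere \<open>norm (s - 1)\<close> is at least a constant
  multiple of \<open>tau s\<close>, and 1 / zeta is bounded either by
  \<open>norm_ds_0_le_away\<close> or, if the imaginary part is small, by absolute convergence,
  since the real part then stays away from 1.\<close>

lemma norm_ds_0_le:
  assumes e: "0 < e" "e \<le> 1"
  shows "\<exists>C>0. \<forall>s\<in>strip. norm (ds 0 s) \<le> C * norm (s - 1) * tau s powr (e - 1)"
proof -
  obtain c where c: "c > 0" "c \<le> 1" "\<And>s. s \<in> strip \<Longrightarrow> norm (s - 1) \<le> c \<Longrightarrow> norm (ys 0 s) \<ge> 1/2"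
    using ys_0_lower_near_1 by blast
  obtain C1 where C1: "C1 > 0" "\<And>s. s \<in> strip \<Longrightarrow> \<bar>Im s\<bar> \<ge> c / 2 \<Longrightarrow> norm (ds 0 s) \<le> C1 * tau s powr e"
    using norm_ds_0_le_away[of "c / 2" "e / 7"] c e by auto
  define K where "K = (\<Sum>\<^sub>\<infinity>n::nat. real n powr (-(1 + c / 2)))"
  have K: "((\<lambda>n::nat. real n powr (-(1 + c / 2))) has_sum K) UNIV"
    unfolding K_def using c by (intro has_sum_infsum summable_on_nat_powr) auto
  have K0: "K \<ge> 0" unfolding K_def by (intro infsum_nonneg) auto
  define k where "k = c / (c + 2)"
  have k: "k > 0" "k \<le> c / 2" using c by (auto simp: k_def field_simps)
  define C where "C = 4 + (C1 + K) / k"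
  have C: "C \<ge> 4" "(C1 + K) / k \<le> C" using C1 K0 k by (auto simp: C_def)
  have "norm (ds 0 s) \<le> C * norm (s - 1) * tau s powr (e - 1)" if s: "s \<in> strip" for s
  proof (cases "norm (s - 1) \<le> c")
    case True
    have "norm (ys 0 s) * norm (ds 0 s) = norm (s - 1)"
      using zs_0_ds_0[of s] s by (simp add: ys_0 norm_mult[symmetric] mult.assoc strip_def)
    moreover have "1/2 * norm (ds 0 s) \<le> norm (ys 0 s) * norm (ds 0 s)"
      using c(3)[OF s True] by (intro mult_right_mono) auto
    ultimately have "norm (ds 0 s) \<le> 2 * norm (s - 1)" by simp
    also have "\<dots> \<le> 4 * norm (s - 1) * tau s powr (e - 1)"
    proof -
      have "tau s \<le> 2" using abs_Im_le_cmod[of "s - 1"] True c by (simp add: tau_def)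
      then have "1/2 \<le> 1 / tau s" using tau_ge_1[of s] by (simp add: field_simps)
      also have "\<dots> = tau s powr (-1)" using tau_ge_1[of s] by (simp add: powr_minus_divide)
      also have "\<dots> \<le> tau s powr (e - 1)" using e tau_ge_1[of s] by (intro powr_mono) auto
      finally have "4 * norm (s - 1) * (1/2) \<le> 4 * norm (s - 1) * tau s powr (e - 1)"
        by (intro mult_left_mono) auto
      then show ?thesis by simp
    qed
    also have "\<dots> \<le> C * norm (s - 1) * tau s powr (e - 1)"
      using C by (intro mult_right_mono) auto
    finally show ?thesis .
  next
    case False
    have te: "tau s powr e = tau s * tau s powr (e - 1)"
      using tau_ge_1[of s] powr_add[of "tau s" 1 "e - 1"] by simp
    have te1: "tau s powr e \<ge> 1" using tau_ge_1[of s] e by (simp add: ge_one_powr_ge_zero)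
    have "k * tau s \<le> norm (s - 1) \<and> norm (ds 0 s) \<le> (C1 + K) * tau s powr e"
    proof (cases "\<bar>Im s\<bar> \<ge> c / 2")
      case True
      have "k * tau s \<le> \<bar>Im s\<bar>" using True c by (simp add: k_def tau_def field_simps)
      also have "\<dots> \<le> norm (s - 1)" using abs_Im_le_cmod[of "s - 1"] by simp
      finally have "k * tau s \<le> norm (s - 1)" .
      moreover have "norm (ds 0 s) \<le> (C1 + K) * tau s powr e"
        using C1(2)[OF s True] K0 by (simp add: algebra_simps add_increasing2)
      ultimately show ?thesis by blast
    next
      case Im: False
      have "tau s \<le> 2" using Im c by (simp add: tau_def)
      then have kt: "k * tau s \<le> (c / 2) * 2" using k c tau_ge_1[of s] by (intro mult_mono) auto
      have "norm (s - 1) \<le> \<bar>Re (s - 1)\<bar> + \<bar>Im (s - 1)\<bar>" by (rule cmod_le)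
      then have "Re s \<ge> 1 + c / 2" using Im False s by (simp add: strip_def)
      have ds_eq: "ds 0 s = (\<Sum>\<^sub>\<infinity>n. of_int (moebius_mu n) * of_nat n powr (-s))"
        by (simp add: ds_def dser_def)
      have "norm (ds 0 s) \<le> K"
      proof (rule norm_infsum_le[OF _ K])
        show "((\<lambda>n. of_int (moebius_mu n) * of_nat n powr (-s)) has_sum ds 0 s) UNIV"
          unfolding ds_eq using dser_summable[OF ln_bdd_moebius_ln[of 0], of s] s
          by (intro has_sum_infsum) (simp add: strip_def)
        fix n :: nat
        show "norm (of_int (moebius_mu n) * of_nat n powr (-s)) \<le> real n powr (-(1 + c / 2))"
        proof (cases "n = 0")
          case False
          have "norm (of_int (moebius_mu n) :: complex) * norm (of_nat n powr (-s) :: complex) \<le> 1 * real n powr (-(1 + c / 2))"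
          proof (intro mult_mono)
            have "\<bar>real_of_int (moebius_mu n)\<bar> \<le> 1" using abs_moebius_mu_le[of n] by linarith
            then show "norm (of_int (moebius_mu n) :: complex) \<le> 1" by simp
            show "norm (of_nat n powr (-s) :: complex) \<le> real n powr (-(1 + c / 2))"
              unfolding norm_of_nat_powr using False \<open>Re s \<ge> 1 + c / 2\<close> by (intro powr_mono) auto
          qed auto
          then show ?thesis by (simp add: norm_mult)
        qed auto
      qed
      also have "K \<le> (C1 + K) * 1" using C1(1) by simp
      also have "\<dots> \<le> (C1 + K) * tau s powr e" using te1 K0 C1(1) by (intro mult_left_mono) auto
      finally show ?thesis using kt False by simp
    qed
    then have 1: "k * tau s \<le> norm (s - 1)" and 2: "norm (ds 0 s) \<le> (C1 + K) * tau s powr e" by auto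
    note 2
    also have "(C1 + K) * tau s powr e = (C1 + K) / k * (k * tau s) * tau s powr (e - 1)"
      using k by (simp add: te)
    also have "\<dots> \<le> C * norm (s - 1) * tau s powr (e - 1)"
      using C C1 K0 k 1 tau_ge_1[of s] by (intro mult_right_mono mult_mono) auto
    finally show ?thesis .
  qed
  then show ?thesis using C by (intro exI[of _ C]) auto
qed

text \<open>Leibniz rule for (s - 1) * zeta(s) * (1 / zeta(s)) = s - 1. The value -1 at A = 1 is the
  derivative of s - 1 with the sign (-1) ^ A that is built into \<open>ys\<close> and
  \<open>ds\<close>.\<close>

lemma ys_ds_convolution:
  assumes "Re s > 1"
  shows "(\<Sum>j\<le>A. of_nat (A choose j) * (ys j s * ds (A - j) s)) =
           (if A = 0 then s - 1 else if A = 1 then -1 else 0)"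
proof (cases A)
  case 0
  then show ?thesis using zs_0_ds_0[OF assms] by (simp add: ys_0 mult.assoc)
next
  case (Suc B)
  have "(\<Sum>j\<le>A. of_nat (A choose j) * (ys j s * ds (A - j) s)) =
     (s - 1) * (\<Sum>j\<le>A. of_nat (A choose j) * (zs j s * ds (A - j) s)) -
     (\<Sum>j\<le>A. of_nat (j * (A choose j)) * (zs (j - 1) s * ds (A - j) s))"
    by (simp add: ys_def sum_distrib_left sum_subtractf[symmetric] algebra_simps)
  also have "(\<Sum>j\<le>A. of_nat (j * (A choose j)) * (zs (j - 1) s * ds (A - j) s)) =
     (\<Sum>j\<le>B. of_nat (Suc j * (A choose Suc j)) * (zs j s * ds (B - j) s))"
    unfolding Suc by (subst sum.atMost_Suc_shift) simp
  also have "\<dots> = of_nat A * (\<Sum>j\<le>B. of_nat (B choose j) * (zs j s * ds (B - j) s))"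
    unfolding Suc Suc_times_binomial by (simp add: sum_distrib_left algebra_simps)
  finally show ?thesis unfolding zs_ds_convolution[OF assms] by (simp add: Suc)
qed

text \<open>By induction on \<open>A\<close>, the convolution identity is solved for its term j = 0,
  which gives (s - 1) * ds A s = ds 0 s * (R - S) with R - S of known size. The factor s - 1 cancels
  against the one in \<open>norm_ds_0_le\<close>, so nothing is lost near 1, and the exponents of
  \<open>tau s\<close> combine to (d - 1) + (1 + 2 * d) = 3 * d.\<close>

lemma norm_ds_le:
  assumes "e > 0"
  shows "\<exists>C>0. \<forall>s\<in>strip. norm (ds A s) \<le> C * tau s powr e"
  using assms
proof (induction A arbitrary: e rule: less_induct)
  case (less A)
  define d where "d = min 1 e / 3"
  have d: "d > 0" "d \<le> 1" "3 * d \<le> e" using less.prems by (auto simp: d_def)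
  obtain W where W: "W > 0" "\<And>s. s \<in> strip \<Longrightarrow> norm (ds 0 s) \<le> W * norm (s - 1) * tau s powr (d - 1)"
    using norm_ds_0_le[OF d(1,2)] by blast
  have "\<forall>j. \<exists>C>0. \<forall>s\<in>strip. norm (ys j s) \<le> C * tau s powr (1 + d)" using ys_upper[OF d(1)] by blast
  then obtain Y where Y: "\<And>j. Y j > 0" "\<And>j s. s \<in> strip \<Longrightarrow> norm (ys j s) \<le> Y j * tau s powr (1 + d)"
    by metis
  have "\<forall>j. \<exists>C>0. j < A \<longrightarrow> (\<forall>s\<in>strip. norm (ds j s) \<le> C * tau s powr d)"
    using less.IH[OF _ d(1)] by (metis zero_less_one)
  then obtain D where D: "\<And>j. D j > 0" "\<And>j s. j < A \<Longrightarrow> s \<in> strip \<Longrightarrow> norm (ds j s) \<le> D j * tau s powr d"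
    by metis
  define K where "K = 1 + (\<Sum>j=1..A. real (A choose j) * (Y j * D (A - j)))"
  have K: "K > 0" using Y(1) D(1) unfolding K_def
    by (intro add_pos_nonneg sum_nonneg mult_nonneg_nonneg) (auto intro: less_imp_le)
  have "norm (ds A s) \<le> (W * K) * tau s powr e" if s: "s \<in> strip" for s
  proof -
    have s1: "Re s > 1" and sne: "s \<noteq> 1" using s by (auto simp: strip_def)
    define T where "T = tau s"
    have T: "T \<ge> 1" by (simp add: T_def tau_ge_1)
    define R where "R = (if A = 0 then s - 1 else if A = 1 then -1 else 0)"
    define S where "S = (\<Sum>j=1..A. of_nat (A choose j) * (ys j s * ds (A - j) s))"
    have "{..A} = insert 0 {1..A}" by auto
    then have "R = ys 0 s * ds A s + S"
      using ys_ds_convolution[OF s1, of A] by (simp add: R_def S_def)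
    then have "ds 0 s * (R - S) = (zs 0 s * ds 0 s) * ((s - 1) * ds A s)"
      by (simp add: ys_0 mult_ac)
    then have eq: "(s - 1) * ds A s = ds 0 s * (R - S)"
      unfolding zs_0_ds_0[OF s1] by simp
    have "norm R \<le> T" using norm_le_tau(2)[OF s] T by (simp add: R_def T_def)
    also have "T \<le> 1 * T powr (1 + 2 * d)" using T d powr_mono[of 1 "1 + 2 * d" T] by simp
    finally have R: "norm R \<le> 1 * T powr (1 + 2 * d)" .
    have "norm S \<le> (\<Sum>j=1..A. (real (A choose j) * (Y j * D (A - j))) * T powr (1 + 2 * d))"
      unfolding S_def
    proof (rule sum_norm_le)
      fix j assume j: "j \<in> {1..A}"
      have "norm (ys j s) * norm (ds (A - j) s) \<le> (Y j * T powr (1 + d)) * (D (A - j) * T powr d)"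
        unfolding T_def using j Y(1)[of j] D(1)[of "A - j"] s
        by (intro mult_mono Y(2) D(2)) (auto intro: less_imp_le)
      also have "\<dots> = (Y j * D (A - j)) * T powr (1 + 2 * d)"
        by (simp add: powr_add[symmetric] algebra_simps)
      finally show "norm (of_nat (A choose j) * (ys j s * ds (A - j) s)) \<le> (real (A choose j) * (Y j * D (A - j))) * T powr (1 + 2 * d)"
        by (simp add: norm_mult mult_left_mono mult.assoc)
    qed
    then have S: "norm S \<le> (K - 1) * T powr (1 + 2 * d)" by (simp add: K_def sum_distrib_right)
    have "norm (R - S) \<le> norm R + norm S" by (rule norm_triangle_ineq4)
    also have "\<dots> \<le> K * T powr (1 + 2 * d)" using R S by (simp add: algebra_simps)
    finally have RS: "norm (R - S) \<le> K * T powr (1 + 2 * d)" .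
    have "norm (s - 1) * norm (ds A s) = norm (ds 0 s) * norm (R - S)"
      using arg_cong[OF eq, of norm] by (simp add: norm_mult)
    also have "\<dots> \<le> (W * norm (s - 1) * T powr (d - 1)) * (K * T powr (1 + 2 * d))"
      unfolding T_def by (intro mult_mono W(2)[OF s] RS[unfolded T_def]) (use W in auto)
    also have "\<dots> = norm (s - 1) * (W * K * T powr (3 * d))"
      by (simp add: powr_add[symmetric] algebra_simps)
    finally have "norm (ds A s) \<le> W * K * T powr (3 * d)" using sne by simp
    also have "\<dots> \<le> W * K * T powr e" using T d W K by (intro mult_left_mono powr_mono) auto
    finally show ?thesis by (simp add: T_def)
  qed
  then show ?case using W K by (intro exI[of _ "W * K"]) auto
qed

section \<open>Perron formula for Riesz means\<close>

text \<open>The Perron kernel for the weight max (1 - 1 / y) 0. Its quadratic decay is what makes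
  vertical integrals against \<open>ds\<close> converge absolutely.\<close>

definition riesz_kernel :: "real \<Rightarrow> complex \<Rightarrow> complex" where
  "riesz_kernel y s = of_real y powr s / (s * (s + 1))"

lemma norm_riesz_kernel:
  assumes "y > 0"
  shows "norm (riesz_kernel y s) = y powr Re s / (norm s * norm (s + 1))"
  using assms by (simp add: riesz_kernel_def norm_divide norm_mult norm_powr_real_powr)

lemma riesz_kernel_holomorphic:
  assumes "y > 0" "0 \<notin> S" "-1 \<notin> S"
  shows "riesz_kernel y holomorphic_on S"
proof -
  have "s * (s + 1) \<noteq> 0" if "s \<in> S" for s
    using that assms by (auto simp: eq_neg_iff_add_eq_0[symmetric])
  then show ?thesis unfolding riesz_kernel_def using assms by (intro holomorphic_intros) auto
qed

lemma norm_linepath_riesz_le: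
  assumes "y > 0" "B \<ge> 0" "\<And>s. s \<in> closed_segment a b \<Longrightarrow> norm (riesz_kernel y s) \<le> B"
    "0 \<notin> closed_segment a b" "-1 \<notin> closed_segment a b"
  shows "norm (contour_integral (linepath a b) (riesz_kernel y)) \<le> B * norm (b - a)"
  using assms
  by (intro contour_integral_bound_linepath contour_integrable_holomorphic_simple[OF _ open_Compl]
      contour_integrable_continuous_linepath holomorphic_on_imp_continuous_on riesz_kernel_holomorphic) auto

lemma segment_same_Im:
  assumes "z \<in> closed_segment (Complex a t) (Complex b t)"
  shows "Im z = t" "min a b \<le> Re z" "Re z \<le> max a b"
proof -
  from assms obtain u where u: "0 \<le> u" "u \<le> 1" "z = (1 - u) *\<^sub>R Complex a t + u *\<^sub>R Complex b t"
    by (auto simp: in_segment)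
  show "Im z = t" unfolding u by (simp add: algebra_simps)
  have "Re z \<in> closed_segment a b" unfolding in_segment using u by (intro exI[of _ u]) auto
  then show "min a b \<le> Re z" "Re z \<le> max a b" by (auto simp: closed_segment_eq_real_ivl split: if_splits)
qed

lemma segment_same_Re:
  assumes "z \<in> closed_segment (Complex a t) (Complex a u)"
  shows "Re z = a"
proof -
  from assms obtain v where v: "z = (1 - v) *\<^sub>R Complex a t + v *\<^sub>R Complex a u"
    by (auto simp: in_segment)
  show ?thesis unfolding v by (simp add: algebra_simps)
qed

text \<open>For y <= 1 the power y^s decreases to the right, so the segment is closed to a rectangle
  on that side, which contains no pole. With the far edge at real part T the kernel is at most
  y^\<sigma> / T^2 on all three new edges, whose total length is less than 4 * T.\<close>

lemma riesz_perron_le_1: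
  assumes y: "0 < y" "y \<le> 1" and \<sigma>: "1 < \<sigma>" "\<sigma> \<le> 2" and T: "T \<ge> 3"
  shows "norm (contour_integral (linepath (Complex \<sigma> (-T)) (Complex \<sigma> T)) (riesz_kernel y)) \<le> 4 * y powr \<sigma> / T"
proof -
  let ?f = "riesz_kernel y"
  let ?a = "Complex \<sigma> (-T)" and ?b = "Complex T (-T)" and ?c = "Complex T T" and ?d = "Complex \<sigma> T"
  let ?R = "cbox ?a ?c"
  have R: "Re z \<ge> \<sigma>" if "z \<in> ?R" for z using that by (auto simp: in_cbox_complex_iff)
  have hol: "?f holomorphic_on ?R"
    using y \<sigma> by (intro riesz_kernel_holomorphic) (auto dest!: R)
  have "(?f has_contour_integral 0) (rectpath ?a ?c)"
  proof (rule Cauchy_theorem_convex_simple[OF hol])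
    show "path_image (rectpath ?a ?c) \<subseteq> ?R" using \<sigma> T by (intro path_image_rectpath_subset_cbox) auto
  qed auto
  have seg: "closed_segment p q \<subseteq> ?R" if "p \<in> ?R" "q \<in> ?R" for p q
    using that by (intro closed_segment_subset) auto
  have corners: "?a \<in> ?R" "?b \<in> ?R" "?c \<in> ?R" "?d \<in> ?R" using \<sigma> T by (auto simp: in_cbox_complex_iff)
  have int: "?f contour_integrable_on (linepath p q)" if "p \<in> ?R" "q \<in> ?R" for p q
    using that by (intro contour_integrable_continuous_linepath holomorphic_on_imp_continuous_on
        holomorphic_on_subset[OF hol] seg)
  have "contour_integral (rectpath ?a ?c) ?f = 0"
    by (rule contour_integral_unique) fact
  also have "contour_integral (rectpath ?a ?c) ?f = contour_integral (linepath ?a ?b) ?f +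
      contour_integral (linepath ?b ?c) ?f + contour_integral (linepath ?c ?d) ?f + contour_integral (linepath ?d ?a) ?f"
    unfolding rectpath_def Let_def using int corners by (simp add: contour_integrable_joinI add.assoc)
  also have "contour_integral (linepath ?d ?a) ?f = - contour_integral (linepath ?a ?d) ?f"
    using int corners by (intro contour_integral_reverse_linepath holomorphic_on_imp_continuous_on
       holomorphic_on_subset[OF hol] seg)
  finally have eq: "contour_integral (linepath ?a ?d) ?f = contour_integral (linepath ?a ?b) ?f +
      contour_integral (linepath ?b ?c) ?f + contour_integral (linepath ?c ?d) ?f" by (simp add: algebra_simps)
  have n0: "0 \<notin> closed_segment p q" "-1 \<notin> closed_segment p q" if "p \<in> ?R" "q \<in> ?R" for p q
    using seg[OF that] \<sigma> by (auto dest!: R subsetD)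
  have ny: "y powr Re z \<le> y powr \<sigma>" if "z \<in> ?R" for z
    using R[OF that] y by (intro powr_mono') auto
  have hor: "norm (?f z) \<le> y powr \<sigma> / T ^ 2" if z: "z \<in> ?R" "\<bar>Im z\<bar> = T" for z
  proof -
    have "norm z \<ge> T" "norm (z + 1) \<ge> T" using abs_Im_le_cmod[of z] abs_Im_le_cmod[of "z + 1"] z by auto
    then have "T ^ 2 \<le> norm z * norm (z + 1)" unfolding power2_eq_square using T by (intro mult_mono) auto
    then show ?thesis unfolding norm_riesz_kernel[OF y(1)] using T ny[OF z(1)]
      by (intro frac_le) auto
  qed
  have ver: "norm (?f z) \<le> y powr \<sigma> / T ^ 2" if z: "z \<in> ?R" "Re z = T" for z
  proof -
    have "norm z \<ge> T" "norm (z + 1) \<ge> T" using abs_Re_le_cmod[of z] abs_Re_le_cmod[of "z + 1"] z T by auto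
    then have "T ^ 2 \<le> norm z * norm (z + 1)" unfolding power2_eq_square using T by (intro mult_mono) auto
    then show ?thesis unfolding norm_riesz_kernel[OF y(1)] using T ny[OF z(1)]
      by (intro frac_le) auto
  qed
  let ?B = "y powr \<sigma> / T ^ 2"
  have "norm (contour_integral (linepath ?a ?b) ?f) \<le> ?B * norm (?b - ?a)"
    using T by (intro norm_linepath_riesz_le y n0 corners hor subsetD[OF seg[OF corners(1,2)]]) (auto dest: segment_same_Im(1))
  also have "norm (?b - ?a) = T - \<sigma>" using \<sigma> T by (simp add: cmod_def)
  finally have 1: "norm (contour_integral (linepath ?a ?b) ?f) \<le> ?B * (T - \<sigma>)" .
  have "norm (contour_integral (linepath ?b ?c) ?f) \<le> ?B * norm (?c - ?b)"
    using T by (intro norm_linepath_riesz_le y n0 corners ver subsetD[OF seg[OF corners(2,3)]]) (auto dest: segment_same_Re)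
  also have "norm (?c - ?b) = 2 * T" using \<sigma> T by (simp add: cmod_def real_sqrt_mult)
  finally have 2: "norm (contour_integral (linepath ?b ?c) ?f) \<le> ?B * (2 * T)" .
  have "norm (contour_integral (linepath ?c ?d) ?f) \<le> ?B * norm (?d - ?c)"
    using T by (intro norm_linepath_riesz_le y n0 corners hor subsetD[OF seg[OF corners(3,4)]]) (auto dest: segment_same_Im(1))
  also have "norm (?d - ?c) = T - \<sigma>" using \<sigma> T by (simp add: cmod_def)
  finally have 3: "norm (contour_integral (linepath ?c ?d) ?f) \<le> ?B * (T - \<sigma>)" .
  have "norm (contour_integral (linepath ?a ?d) ?f) \<le> ?B * (T - \<sigma>) + ?B * (2 * T) + ?B * (T - \<sigma>)"
    unfolding eq by (intro order_trans[OF norm_triangle_ineq] add_mono 1 2 3)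
  also have "\<dots> = ?B * ((T - \<sigma>) + 2 * T + (T - \<sigma>))" by (simp only: distrib_left)
  also have "\<dots> = ?B * (4 * T - 2 * \<sigma>)" by simp
  also have "\<dots> \<le> ?B * (4 * T)" using \<sigma> by (intro mult_left_mono) auto
  also have "\<dots> = 4 * y powr \<sigma> / T" using T by (simp add: power2_eq_square)
  finally show ?thesis .
qed

text \<open>For y >= 1 the rectangle is closed to the left and encloses the poles 0 and -1, which
  are separated by partial fractions and have residues 1 and -1 / y. On the left edge |s + 1| is
  only known to be at least T / 2, hence the larger constant.\<close>

lemma riesz_perron_ge_1:
  assumes y: "y \<ge> 1" and \<sigma>: "1 < \<sigma>" "\<sigma> \<le> 2" and T: "T \<ge> 3"
  shows "norm (contour_integral (linepath (Complex \<sigma> (-T)) (Complex \<sigma> T)) (riesz_kernel y)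
             - of_real (2 * pi) * \<i> * of_real (1 - 1 / y)) \<le> 8 * y powr \<sigma> / T"
proof -
  let ?f = "riesz_kernel y"
  let ?a = "Complex (-T) (-T)" and ?b = "Complex \<sigma> (-T)" and ?c = "Complex \<sigma> T" and ?d = "Complex (-T) T"
  let ?R = "cbox ?a ?c"
  let ?E = "path_image (rectpath ?a ?c)"
  have box: "0 \<in> box ?a ?c" "-1 \<in> box ?a ?c" using \<sigma> T by (auto simp: in_box_complex_iff)
  have sub: "?E \<subseteq> ?R" using \<sigma> T by (intro path_image_rectpath_subset_cbox) auto
  have ni: "0 \<notin> ?E" "-1 \<notin> ?E"
    using path_image_rectpath_inter_box[of ?a ?c] box \<sigma> T by auto
  have hol0: "(\<lambda>s. of_real y powr s) holomorphic_on ?R" using y by (intro holomorphic_intros) auto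
  have C0: "((\<lambda>w. of_real y powr w / (w - 0)) has_contour_integral (of_real (2 * pi) * \<i> * 1 * of_real y powr 0)) (rectpath ?a ?c)"
  proof -
    have "((\<lambda>w. of_real y powr w / (w - 0)) has_contour_integral
       (of_real (2 * pi) * \<i> * winding_number (rectpath ?a ?c) 0 * of_real y powr 0)) (rectpath ?a ?c)"
      using box ni sub by (intro Cauchy_integral_formula_convex_simple[OF _ hol0]) (auto simp: interior_cbox)
    then show ?thesis using winding_number_rectpath[OF box(1)] by simp
  qed
  have C1: "((\<lambda>w. of_real y powr w / (w - (-1))) has_contour_integral (of_real (2 * pi) * \<i> * 1 * of_real y powr (-1))) (rectpath ?a ?c)"
  proof -
    have "((\<lambda>w. of_real y powr w / (w - (-1))) has_contour_integral
       (of_real (2 * pi) * \<i> * winding_number (rectpath ?a ?c) (-1) * of_real y powr (-1))) (rectpath ?a ?c)"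
      using box ni sub by (intro Cauchy_integral_formula_convex_simple[OF _ hol0]) (auto simp: interior_cbox)
    then show ?thesis using winding_number_rectpath[OF box(2)] by simp
  qed
  let ?I = "of_real (2 * pi) * \<i> * of_real (1 - 1 / y) :: complex"
  have "(?f has_contour_integral (of_real (2 * pi) * \<i> * 1 * of_real y powr 0) - (of_real (2 * pi) * \<i> * 1 * of_real y powr (-1))) (rectpath ?a ?c)"
  proof (rule has_contour_integral_eq[OF has_contour_integral_diff[OF C0 C1]])
    fix w assume "w \<in> ?E"
    then have "w \<noteq> 0" "w + 1 \<noteq> 0" using ni by (auto simp: add_eq_0_iff2)
    then show "of_real y powr w / (w - 0) - of_real y powr w / (w - (-1)) = ?f w"
      unfolding riesz_kernel_def by (simp add: field_simps)
  qed
  also have "(of_real (2 * pi) * \<i> * 1 * of_real y powr 0) - (of_real (2 * pi) * \<i> * 1 * of_real y powr (-1)) = ?I"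
    using y by (simp add: powr_minus_divide algebra_simps)
  finally have I: "contour_integral (rectpath ?a ?c) ?f = ?I" by (rule contour_integral_unique)
  have edges: "closed_segment ?a ?b \<subseteq> ?E" "closed_segment ?b ?c \<subseteq> ?E" "closed_segment ?c ?d \<subseteq> ?E" "closed_segment ?d ?a \<subseteq> ?E"
    by (auto simp: rectpath_def Let_def path_image_join)
  have hol: "?f holomorphic_on ?E" using ni y by (intro riesz_kernel_holomorphic) auto
  have int: "?f contour_integrable_on (linepath p q)" if "closed_segment p q \<subseteq> ?E" for p q
    using that by (intro contour_integrable_continuous_linepath holomorphic_on_imp_continuous_on
        holomorphic_on_subset[OF hol])
  have "contour_integral (rectpath ?a ?c) ?f = contour_integral (linepath ?a ?b) ?f +
      contour_integral (linepath ?b ?c) ?f + contour_integral (linepath ?c ?d) ?f + contour_integral (linepath ?d ?a) ?f"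
    using int[OF edges(1)] int[OF edges(2)] int[OF edges(3)] int[OF edges(4)]
    unfolding rectpath_def Let_def by (simp add: contour_integrable_joinI add.assoc)
  then have eq: "contour_integral (linepath ?b ?c) ?f - ?I =
     - (contour_integral (linepath ?a ?b) ?f + contour_integral (linepath ?c ?d) ?f + contour_integral (linepath ?d ?a) ?f)"
    unfolding I by (simp add: algebra_simps)
  have ny: "y powr Re z \<le> y powr \<sigma>" if "z \<in> ?E" for z
    using sub that y by (intro powr_mono) (auto simp: in_cbox_complex_iff)
  have hor: "norm (?f z) \<le> y powr \<sigma> / T ^ 2" if z: "z \<in> ?E" "\<bar>Im z\<bar> = T" for z
  proof -
    have "norm z \<ge> T" "norm (z + 1) \<ge> T" using abs_Im_le_cmod[of z] abs_Im_le_cmod[of "z + 1"] z by auto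
    then have "T ^ 2 \<le> norm z * norm (z + 1)" unfolding power2_eq_square using T by (intro mult_mono) auto
    then show ?thesis using T ny[OF z(1)] y by (subst norm_riesz_kernel) (auto intro!: frac_le)
  qed
  have ver: "norm (?f z) \<le> 2 * (y powr \<sigma> / T ^ 2)" if z: "z \<in> ?E" "Re z = -T" for z
  proof -
    have "norm z \<ge> T" "norm (z + 1) \<ge> T / 2" using abs_Re_le_cmod[of z] abs_Re_le_cmod[of "z + 1"] z T by auto
    then have "T * (T / 2) \<le> norm z * norm (z + 1)" using T by (intro mult_mono) auto
    have "norm (?f z) = y powr Re z / (norm z * norm (z + 1))"
      using y by (intro norm_riesz_kernel) auto
    also have "\<dots> \<le> y powr \<sigma> / (T * (T / 2))"
      by (rule frac_le) (use ny[OF z(1)] T \<open>T * (T / 2) \<le> _\<close> in auto)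
    finally show ?thesis by (simp add: power2_eq_square mult.commute)
  qed
  let ?B = "y powr \<sigma> / T ^ 2"
  have n0: "0 \<notin> closed_segment p q" "-1 \<notin> closed_segment p q" if "closed_segment p q \<subseteq> ?E" for p q
    using that ni by auto
  have y0: "y > 0" using y by simp
  have "norm (contour_integral (linepath ?a ?b) ?f) \<le> ?B * norm (?b - ?a)"
    using T by (intro norm_linepath_riesz_le y0 n0 edges hor subsetD[OF edges(1)]) (auto dest: segment_same_Im(1))
  also have "norm (?b - ?a) = T + \<sigma>" using \<sigma> T by (simp add: cmod_def)
  finally have 1: "norm (contour_integral (linepath ?a ?b) ?f) \<le> ?B * (T + \<sigma>)" .
  have "norm (contour_integral (linepath ?d ?a) ?f) \<le> (2 * ?B) * norm (?a - ?d)"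
    using T by (intro norm_linepath_riesz_le y0 n0 edges ver subsetD[OF edges(4)]) (auto dest: segment_same_Re)
  also have "norm (?a - ?d) = 2 * T" using \<sigma> T by (simp add: cmod_def real_sqrt_mult)
  finally have 2: "norm (contour_integral (linepath ?d ?a) ?f) \<le> (2 * ?B) * (2 * T)" .
  have "norm (contour_integral (linepath ?c ?d) ?f) \<le> ?B * norm (?d - ?c)"
    using T by (intro norm_linepath_riesz_le y0 n0 edges hor subsetD[OF edges(3)]) (auto dest: segment_same_Im(1))
  also have "norm (?d - ?c) = T + \<sigma>" using \<sigma> T by (simp add: cmod_def)
  finally have 3: "norm (contour_integral (linepath ?c ?d) ?f) \<le> ?B * (T + \<sigma>)" .
  have "norm (contour_integral (linepath ?b ?c) ?f - ?I) \<le> ?B * (T + \<sigma>) + ?B * (T + \<sigma>) + (2 * ?B) * (2 * T)"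
    unfolding eq norm_minus_cancel by (intro order_trans[OF norm_triangle_ineq] add_mono 1 2 3)
  also have "\<dots> = ?B * (T + \<sigma> + (T + \<sigma>) + 2 * (2 * T))" by (simp only: distrib_left distrib_right mult_ac)
  also have "\<dots> = ?B * (6 * T + 2 * \<sigma>)" by simp
  also have "\<dots> \<le> ?B * (8 * T)" using \<sigma> T by (intro mult_left_mono) auto
  also have "\<dots> = 8 * y powr \<sigma> / T" using T by (simp add: power2_eq_square)
  finally show ?thesis .
qed

text \<open>The integral of (1 + |t|) powr (-3/2) over [-T, T] in the parametrisation t = 2 * T * x
  - T that \<open>linepath\<close> produces; it is split at x = 1/2, where t changes sign.\<close>

lemma has_integral_powr_minus_3_2:
  fixes T :: real
  assumes "T \<ge> 0"
  shows "((\<lambda>x. 2 * T * (1 + \<bar>2 * T * x - T\<bar>) powr (-3/2)) has_integral (4 - 4 * (1 + T) powr (-1/2))) {0..1}"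
proof -
  let ?g = "\<lambda>x::real. 2 * T * (1 + \<bar>2 * T * x - T\<bar>) powr (-3/2)"
  let ?G1 = "\<lambda>x::real. 2 * (1 + (T - 2 * T * x)) powr (-1/2)"
  let ?G2 = "\<lambda>x::real. - 2 * (1 + (2 * T * x - T)) powr (-1/2)"
  have "(?g has_integral (?G1 (1/2) - ?G1 0)) {0..1/2}"
  proof (rule fundamental_theorem_of_calculus)
    fix x :: real assume x: "x \<in> {0..1/2}"
    have le: "2 * T * x \<le> T" using x mult_left_mono[of x "1/2" "2 * T"] assms by auto
    have "(?G1 has_real_derivative ?g x) (at x within {0..1/2})"
      using le by (auto intro!: derivative_eq_intros)
    then show "(?G1 has_vector_derivative ?g x) (at x within {0..1/2})"
      by (simp add: has_real_derivative_iff_has_vector_derivative)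
  qed auto
  moreover have "(?g has_integral (?G2 1 - ?G2 (1/2))) {1/2..1}"
  proof (rule fundamental_theorem_of_calculus)
    fix x :: real assume x: "x \<in> {1/2..1}"
    have le: "T \<le> 2 * T * x" using x mult_left_mono[of "1/2" x "2 * T"] assms by auto
    have "(?G2 has_real_derivative ?g x) (at x within {1/2..1})"
      using le by (auto intro!: derivative_eq_intros)
    then show "(?G2 has_vector_derivative ?g x) (at x within {1/2..1})"
      by (simp add: has_real_derivative_iff_has_vector_derivative)
  qed auto
  ultimately have "(?g has_integral ((?G1 (1/2) - ?G1 0) + (?G2 1 - ?G2 (1/2)))) {0..1}"
    by (intro has_integral_combine[of 0 "1/2" 1]) auto
  then show ?thesis by simp
qed

text \<open>The bound does not depend on \<open>T\<close>, so the height may later be chosen as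
  large as the Perron errors demand; 4 is the integral of (1 + |t|) powr (-3/2) over the whole
  line.\<close>

lemma norm_vertical_integral_le:
  assumes T: "T \<ge> 0" and B: "B \<ge> 0"
    and cont: "continuous_on (closed_segment (Complex \<sigma> (-T)) (Complex \<sigma> T)) g"
    and bound: "\<And>t. \<bar>t\<bar> \<le> T \<Longrightarrow> norm (g (Complex \<sigma> t)) \<le> B * (1 + \<bar>t\<bar>) powr (-3/2)"
  shows "norm (contour_integral (linepath (Complex \<sigma> (-T)) (Complex \<sigma> T)) g) \<le> 4 * B"
proof -
  let ?a = "Complex \<sigma> (-T)" and ?b = "Complex \<sigma> T"
  let ?h = "\<lambda>x. 2 * T * (1 + \<bar>2 * T * x - T\<bar>) powr (-3/2)"
  have "(g has_contour_integral contour_integral (linepath ?a ?b) g) (linepath ?a ?b)"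
    by (intro has_contour_integral_integral contour_integrable_continuous_linepath cont)
  then have I: "((\<lambda>x. g (linepath ?a ?b x) * (?b - ?a)) has_integral contour_integral (linepath ?a ?b) g) {0..1}"
    by (simp add: has_contour_integral_linepath)
  have "norm (contour_integral (linepath ?a ?b) g) \<le> B * (4 - 4 * (1 + T) powr (-1/2))"
  proof -
    have "norm (integral {0..1} (\<lambda>x. g (linepath ?a ?b x) * (?b - ?a))) \<le> integral {0..1} (\<lambda>x. B * ?h x)"
    proof (rule integral_norm_bound_integral)
      show "(\<lambda>x. g (linepath ?a ?b x) * (?b - ?a)) integrable_on {0..1}" using I by blast
      show "(\<lambda>x. B * ?h x) integrable_on {0..1}"
        using has_integral_mult_right[OF has_integral_powr_minus_3_2[OF T]] by blast
      fix x :: real assume x: "x \<in> {0..1}"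
      have lp: "linepath ?a ?b x = Complex \<sigma> (2 * T * x - T)"
        by (simp add: linepath_def complex_eq_iff algebra_simps)
      have "norm (?b - ?a) = 2 * T" using T by (simp add: cmod_def real_sqrt_mult)
      moreover have "0 \<le> 2 * T * x" "2 * T * x \<le> 2 * T" using x T by (auto intro: mult_left_le)
      then have "\<bar>2 * T * x - T\<bar> \<le> T" by linarith
      ultimately have "norm (g (linepath ?a ?b x) * (?b - ?a)) \<le> (B * (1 + \<bar>2 * T * x - T\<bar>) powr (-3/2)) * (2 * T)"
        unfolding norm_mult lp using T B by (intro mult_mono bound) auto
      then show "norm (g (linepath ?a ?b x) * (?b - ?a)) \<le> B * ?h x" by (simp add: mult_ac)
    qed
    also have "integral {0..1} (\<lambda>x. B * ?h x) = B * (4 - 4 * (1 + T) powr (-1/2))"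
      by (intro integral_unique has_integral_mult_right has_integral_powr_minus_3_2 T)
    finally show ?thesis using integral_unique[OF I] by simp
  qed
  also have "\<dots> \<le> B * 4" using B by (intro mult_left_mono) auto
  finally show ?thesis by simp
qed

text \<open>The absolute values of the terms do not depend on \<open>t\<close>, so one cut-off
  serves the whole vertical line. With a finite sum the contour integral can be taken term by
  term.\<close>

lemma ds_partial_sums_close:
  assumes "\<sigma> > 1" "\<delta> > 0"
  shows "\<exists>M\<ge>N. \<forall>t. norm (ds A (Complex \<sigma> t) -
     (\<Sum>n=1..M. of_int (moebius_mu n) * of_real (ln (real n) ^ A) * of_nat n powr (- Complex \<sigma> t))) < \<delta>"
proof -
  define f where "f = (\<lambda>t n. of_int (moebius_mu n) * of_real (ln (real n) ^ A) * of_nat n powr (- Complex \<sigma> t) :: complex)"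
  have "(\<lambda>n. norm (f 0 n)) summable_on UNIV"
    unfolding f_def by (rule dser_abs_summable[OF ln_bdd_moebius_ln]) (use assms in auto)
  then have sm: "summable (\<lambda>n. norm (f 0 n))"
    by (subst (asm) summable_on_UNIV_nonneg_real_iff) auto
  have nf: "norm (f t n) = norm (f 0 n)" for t n
    by (simp add: f_def norm_mult norm_of_nat_powr)
  obtain M0 where M0: "\<And>M. M \<ge> M0 \<Longrightarrow> norm (\<Sum>i. norm (f 0 (i + M))) < \<delta>"
    using suminf_exist_split[OF assms(2) sm] by blast
  define M where "M = max N M0"
  have "norm (ds A (Complex \<sigma> t) - (\<Sum>n=1..M. f t n)) < \<delta>" for t
  proof -
    have "(f t has_sum ds A (Complex \<sigma> t)) UNIV"
      using has_sum_infsum[OF dser_summable[OF ln_bdd_moebius_ln[of A], of "Complex \<sigma> t"]] assms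
      by (simp add: ds_def dser_def f_def)
    then have sums: "f t sums ds A (Complex \<sigma> t)" by (rule has_sum_imp_sums)
    have "(\<Sum>i<Suc M. f t i) = (\<Sum>n=1..M. f t n)"
      by (intro sum.mono_neutral_right) (auto simp: f_def not_less_eq_eq Suc_le_eq)
    then have "ds A (Complex \<sigma> t) - (\<Sum>n=1..M. f t n) = (\<Sum>i. f t (i + Suc M))"
      using suminf_split_initial_segment[OF sums_summable[OF sums], of "Suc M"] sums_unique[OF sums] by simp
    also have "norm \<dots> \<le> (\<Sum>i. norm (f t (i + Suc M)))"
      using summable_ignore_initial_segment[OF sm, of "Suc M"] by (intro summable_norm) (simp only: nf[of t])
    also have "\<dots> = (\<Sum>i. norm (f 0 (i + Suc M)))" by (simp only: nf[of t])
    also have "\<dots> \<le> norm \<dots>" by simp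
    also have "\<dots> < \<delta>" by (rule M0) (simp add: M_def)
    finally show ?thesis .
  qed
  then show ?thesis by (intro exI[of _ M]) (auto simp: M_def f_def)
qed

section \<open>Riesz means of the Moebius function with logarithmic weights\<close>

definition mu_log_sum :: "nat \<Rightarrow> nat \<Rightarrow> real" where
  "mu_log_sum A N = (\<Sum>n=1..N. of_int (moebius_mu n) * ln (real n) ^ A)"

definition mu_log_riesz :: "nat \<Rightarrow> nat \<Rightarrow> real" where
  "mu_log_riesz A N = (\<Sum>n=1..N. of_int (moebius_mu n) * ln (real n) ^ A * (real N - real n))"

text \<open>On the line of real part 1 + 1 / ln N the factor N^s has absolute value e * N, and
  \<open>ds A\<close> grows at most like \<open>tau s powr (1/2)\<close>, which is integrable
  against the kernel. The integral is therefore O(N) with a constant that knows nothing of the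
  closeness to the line of real part one.\<close>

lemma mu_log_riesz_bound:
  "\<exists>K>0. \<forall>N\<ge>3. \<bar>mu_log_riesz A N\<bar> \<le> K * real N ^ 2"
proof -
  obtain C where C: "C > 0" "\<And>s. s \<in> strip \<Longrightarrow> norm (ds A s) \<le> C * tau s powr (1/2)"
    using norm_ds_le[of "1/2" A] by auto
  have "\<bar>mu_log_riesz A N\<bar> \<le> (48 * (C + 1) + 24) * real N ^ 2" if N: "N \<ge> 3" for N
  proof -
    define \<sigma> where "\<sigma> = 1 + 1 / ln (real N)"
    have "exp 1 \<le> real N" using exp_le N by linarith
    then have lnN: "ln (real N) \<ge> 1" using N by (simp add: ln_ge_iff)
    then have \<sigma>: "1 < \<sigma>" "\<sigma> \<le> 2" by (auto simp: \<sigma>_def)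
    have "real N powr \<sigma> = real N * exp 1"
      using N lnN by (simp add: \<sigma>_def powr_add) (simp add: powr_def)
    then have N\<sigma>: "real N powr \<sigma> \<le> 3 * real N" using exp_le N by simp
    define a where "a = (\<lambda>n. of_int (moebius_mu n) * of_real (ln (real n) ^ A) :: complex)"
    obtain M where M: "M \<ge> N" "\<And>t. norm (ds A (Complex \<sigma> t) - (\<Sum>n=1..M. a n * of_nat n powr (- Complex \<sigma> t))) < 1"
      using ds_partial_sums_close[OF \<sigma>(1), of 1 N A] unfolding a_def by auto
    define H where "H = (\<Sum>n=1..M. norm (a n) * real n powr (-\<sigma>))"
    have H: "H \<ge> 0" unfolding H_def by (intro sum_nonneg) auto
    \<comment> \<open>With T >= H the sum of all Perron errors, at most 8 * N^\<sigma> * H / T, is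
      O(N). Such a choice is possible because the bound for the integral is uniform in T.\<close>
    define T where "T = 3 + H"
    have T: "T \<ge> 3" "H \<le> T" using H by (auto simp: T_def)
    let ?l = "linepath (Complex \<sigma> (-T)) (Complex \<sigma> T)"
    let ?S = "closed_segment (Complex \<sigma> (-T)) (Complex \<sigma> T)"
    have ni: "0 \<notin> ?S" "-1 \<notin> ?S" using \<sigma> by (auto dest!: segment_same_Re)
    have cont: "continuous_on ?S (riesz_kernel y)" if "y > 0" for y
      using that ni by (intro holomorphic_on_imp_continuous_on riesz_kernel_holomorphic)
    define g where "g = (\<lambda>s. \<Sum>n=1..M. a n * riesz_kernel (real N / real n) s)"
    have g_eq: "g s = (\<Sum>n=1..M. a n * of_nat n powr (-s)) * (of_nat N powr s / (s * (s + 1)))" for s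
      unfolding g_def sum_distrib_right
    proof (intro sum.cong refl)
      fix n assume n: "n \<in> {1..M}"
      have "(of_real (real N / real n) :: complex) powr s = of_nat N powr s * of_nat n powr (-s)"
      proof -
        have "of_nat N powr s = (of_real (real N / real n) * of_nat n :: complex) powr s" using n by simp
        also have "\<dots> = of_real (real N / real n) powr s * of_nat n powr s" by (intro powr_times_real) auto
        finally show ?thesis using n by (simp add: powr_minus)
      qed
      then show "a n * riesz_kernel (real N / real n) s = a n * of_nat n powr (-s) * (of_nat N powr s / (s * (s + 1)))"
        by (simp add: riesz_kernel_def)
    qed
    have contg: "continuous_on ?S g"
      unfolding g_def using N by (intro continuous_intros cont) auto
    have int: "riesz_kernel (real N / real n) contour_integrable_on ?l" if "n \<in> {1..M}" for n
      using that N by (intro contour_integrable_continuous_linepath cont) auto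
    have gi: "contour_integral ?l g = (\<Sum>n=1..M. a n * contour_integral ?l (riesz_kernel (real N / real n)))"
      unfolding g_def using int
      by (subst contour_integral_sum) (auto intro!: contour_integrable_lmul sum.cong contour_integral_lmul)
    have g1: "norm (contour_integral ?l g) \<le> 4 * (4 * (C + 1) * (3 * real N))"
    proof (rule norm_vertical_integral_le[OF _ _ contg])
      fix t :: real assume t: "\<bar>t\<bar> \<le> T"
      define s where "s = Complex \<sigma> t"
      have s: "s \<in> strip" "tau s = 1 + \<bar>t\<bar>" using \<sigma> by (auto simp: s_def strip_def tau_def)
      have half: "tau s / 2 \<le> norm z" if "Re z \<ge> 1" "Im z = t" for z
        using abs_Re_le_cmod[of z] abs_Im_le_cmod[of z] that s by auto
      have s2: "(tau s / 2) * (tau s / 2) \<le> norm s * norm (s + 1)"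
        using \<sigma> tau_ge_1[of s] by (intro mult_mono half) (auto simp: s_def)
      have "norm (\<Sum>n=1..M. a n * of_nat n powr (-s)) \<le> norm (ds A s) + 1"
        using M(2)[of t] norm_triangle_ineq3[of "ds A s" "\<Sum>n=1..M. a n * of_nat n powr (-s)"] unfolding s_def by linarith
      also have "\<dots> \<le> (C + 1) * tau s powr (1/2)"
      proof -
        have "1 \<le> tau s powr (1/2)" using tau_ge_1[of s] by (simp add: ge_one_powr_ge_zero)
        then show ?thesis using C(2)[OF s(1)] by (simp add: algebra_simps)
      qed
      finally have F: "norm (\<Sum>n=1..M. a n * of_nat n powr (-s)) \<le> (C + 1) * tau s powr (1/2)" .
      have "norm (of_nat N powr s :: complex) = real N powr \<sigma>"
        using norm_of_nat_powr[of N "-s"] by (simp add: s_def)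
      then have "norm (of_nat N powr s / (s * (s + 1))) = real N powr \<sigma> / (norm s * norm (s + 1))"
        by (simp add: norm_divide norm_mult)
      also have "\<dots> \<le> (3 * real N) / ((tau s / 2) * (tau s / 2))"
        using N\<sigma> s2 tau_ge_1[of s] by (intro frac_le) auto
      finally have "norm (g s) \<le> ((C + 1) * tau s powr (1/2)) * ((3 * real N) / ((tau s / 2) * (tau s / 2)))"
        unfolding g_eq norm_mult using C by (intro mult_mono F) auto
      also have "\<dots> = 4 * (C + 1) * (3 * real N) * (tau s powr (1/2) / tau s ^ 2)"
        by (simp add: power2_eq_square field_simps)
      also have "tau s powr (1/2) / tau s ^ 2 = tau s powr (-3/2)"
        using tau_ge_1[of s] powr_diff[of "tau s" "1/2" 2] by simp
      finally show "norm (g (Complex \<sigma> t)) \<le> 4 * (C + 1) * (3 * real N) * (1 + \<bar>t\<bar>) powr (-3/2)"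
        using s by (simp add: s_def)
    qed (use T C in auto)
    let ?p = "of_real (2 * pi) * \<i> :: complex"
    let ?w = "\<lambda>n. if n \<le> N then 1 - real n / real N else 0"
    have trm: "norm (contour_integral ?l (riesz_kernel (real N / real n)) - ?p * of_real (?w n)) \<le> 8 * (real N / real n) powr \<sigma> / T"
      if n: "n \<in> {1..M}" for n
    proof (cases "n \<le> N")
      case True
      then show ?thesis using riesz_perron_ge_1[OF _ \<sigma> T(1), of "real N / real n"] n by simp
    next
      case False
      then have "norm (contour_integral ?l (riesz_kernel (real N / real n))) \<le> 4 * (real N / real n) powr \<sigma> / T"
        using N by (intro riesz_perron_le_1 \<sigma> T) auto
      also have "\<dots> \<le> 8 * (real N / real n) powr \<sigma> / T" using T by (intro divide_right_mono mult_right_mono) auto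
      finally show ?thesis using False by simp
    qed
    have "norm (contour_integral ?l g - (\<Sum>n=1..M. a n * (?p * of_real (?w n)))) =
       norm (\<Sum>n=1..M. a n * (contour_integral ?l (riesz_kernel (real N / real n)) - ?p * of_real (?w n)))"
      unfolding gi by (simp only: right_diff_distrib sum_subtractf)
    also have "\<dots> \<le> (\<Sum>n=1..M. norm (a n) * (8 * (real N / real n) powr \<sigma> / T))"
    proof (rule sum_norm_le)
      fix n assume n: "n \<in> {1..M}"
      show "norm (a n * (contour_integral ?l (riesz_kernel (real N / real n)) - ?p * of_real (?w n))) \<le>
              norm (a n) * (8 * (real N / real n) powr \<sigma> / T)"
        unfolding norm_mult by (rule mult_left_mono[OF trm[OF n]]) simp
    qed
    also have "\<dots> = (\<Sum>n=1..M. (8 * real N powr \<sigma> / T) * (norm (a n) * real n powr (-\<sigma>)))"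
      by (intro sum.cong refl) (auto simp: powr_divide powr_minus_divide mult_ac)
    also have "\<dots> = 8 * real N powr \<sigma> * (H / T)" unfolding sum_distrib_left[symmetric] H_def[symmetric] by simp
    also have "\<dots> \<le> 8 * (3 * real N) * 1"
      using N\<sigma> T H by (intro mult_mono) auto
    finally have "norm (\<Sum>n=1..M. a n * (?p * of_real (?w n))) \<le> 48 * (C + 1) * real N + 24 * real N"
      using g1 norm_triangle_ineq3[of "contour_integral ?l g" "\<Sum>n=1..M. a n * (?p * of_real (?w n))"] by (simp add: algebra_simps)
    also have "(\<Sum>n=1..M. a n * (?p * of_real (?w n))) = (\<Sum>n=1..N. a n * (?p * of_real (?w n)))"
      using M(1) by (intro sum.mono_neutral_right) auto
    also have "\<dots> = ?p * of_real (\<Sum>n=1..N. of_int (moebius_mu n) * ln (real n) ^ A * ((real N - real n) / real N))"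
      unfolding of_real_sum sum_distrib_left using N
      by (intro sum.cong refl) (simp add: a_def field_simps)
    also have "(\<Sum>n=1..N. of_int (moebius_mu n) * ln (real n) ^ A * ((real N - real n) / real N)) = mu_log_riesz A N / real N"
      unfolding mu_log_riesz_def sum_divide_distrib by (intro sum.cong refl) simp
    also have "norm (?p * of_real (mu_log_riesz A N / real N)) = 2 * pi * (\<bar>mu_log_riesz A N\<bar> / real N)"
      by (simp add: norm_mult norm_divide)
    finally have "2 * pi * (\<bar>mu_log_riesz A N\<bar> / real N) \<le> (48 * (C + 1) + 24) * real N" by (simp add: algebra_simps)
    moreover have "1 * (\<bar>mu_log_riesz A N\<bar> / real N) \<le> 2 * pi * (\<bar>mu_log_riesz A N\<bar> / real N)"
      using pi_ge_two by (intro mult_right_mono) auto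
    ultimately have "\<bar>mu_log_riesz A N\<bar> / real N \<le> (48 * (C + 1) + 24) * real N" by linarith
    then show ?thesis using N by (simp add: field_simps power2_eq_square)
  qed
  then show ?thesis using C(1) by (intro exI[of _ "48 * (C + 1) + 24"]) auto
qed

section \<open>The Mertens function\<close>

lemma mu_log_sum_le_trivial:
  assumes "n1 \<le> n2"
  shows "\<bar>\<Sum>n=n1..n2. of_int (moebius_mu n) * w n\<bar> \<le> (\<Sum>n=n1..n2. \<bar>w n\<bar> :: real)"
proof -
  have "\<bar>of_int (moebius_mu n) * w n\<bar> \<le> \<bar>w n\<bar>" for n
  proof -
    have "\<bar>real_of_int (moebius_mu n)\<bar> \<le> 1" using abs_moebius_mu_le[of n] by linarith
    then show ?thesis unfolding abs_mult by (intro mult_left_le_one_le) auto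
  qed
  then show ?thesis by (intro sum_abs[THEN order_trans] sum_mono)
qed

text \<open>The difference of the Riesz means at N + h and N is h times the wanted sum plus an error
  of at most h^2 * l^(2 * B). The choice of h near N / l^B balances N^2 / h against h * l^(2 * B)
  and yields N * l^B, which is l^B better than the trivial bound.\<close>

lemma mu_log_sum_bound:
  "\<exists>C>0. \<forall>N\<ge>1. \<bar>mu_log_sum (2 * B) N\<bar> \<le> C * real N * (1 + ln (real N)) ^ B"
proof -
  obtain K where K: "K > 0" "\<And>N. N \<ge> 3 \<Longrightarrow> \<bar>mu_log_riesz (2 * B) N\<bar> \<le> K * real N ^ 2"
    using mu_log_riesz_bound[of "2 * B"] by blast
  obtain C1 where C1: "C1 > 0" "\<And>x::real. x \<ge> 1 \<Longrightarrow> (1 + ln x) ^ (2 * B) \<le> C1 * x powr 1"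
    using one_plus_ln_power_le[of 1 "2 * B"] by auto
  define C where "C = 5 * K + 1 + 2 * C1"
  have "\<bar>mu_log_sum (2 * B) N\<bar> \<le> C * real N * (1 + ln (real N)) ^ B" if N: "N \<ge> 1" for N
  proof (cases "N \<ge> 3")
    case False
    then have N2: "N \<le> 2" by simp
    have "\<bar>mu_log_sum (2 * B) N\<bar> \<le> (\<Sum>n=1..N. \<bar>ln (real n) ^ (2 * B)\<bar>)"
      unfolding mu_log_sum_def using N by (intro mu_log_sum_le_trivial)
    also have "\<dots> \<le> (\<Sum>n=1..N. 1)"
    proof (intro sum_mono)
      fix n assume n: "n \<in> {1..N}"
      have "ln (real n) \<le> ln 2" using n N2 by simp
      then have "ln (real n) \<le> 1" using ln_2_less_1 by linarith
      then show "\<bar>ln (real n) ^ (2 * B)\<bar> \<le> 1" using n by (simp add: power_le_one)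
    qed
    also have "\<dots> = 1 * real N * 1" by simp
    also have "\<dots> \<le> C * real N * (1 + ln (real N)) ^ B"
      using K(1) C1(1) N by (intro mult_mono) (auto simp: C_def one_le_power)
    finally show ?thesis .
  next
    case True
    define l where "l = 1 + ln (real N)"
    have l: "l \<ge> 1" using N by (simp add: l_def)
    define h where "h = nat \<lceil>real N / l ^ B\<rceil>"
    have lB: "l ^ B \<ge> 1" using l by (rule one_le_power)
    have "0 < real N / l ^ B" "real N / l ^ B \<le> real N"
      using N lB by (auto simp: divide_le_eq mult_le_cancel_left1 intro!: divide_pos_pos)
    then have h: "1 \<le> h" "h \<le> N" "real h \<ge> real N / l ^ B" "real h \<le> real N / l ^ B + 1"
      unfolding h_def by linarith+
    define a where "a = (\<lambda>n. of_int (moebius_mu n) * ln (real n) ^ (2 * B) :: real)"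
    define E where "E = (\<Sum>n=Suc N..N + h. a n * (real (N + h) - real n))"
    have "{1..N + h} = {1..N} \<union> {Suc N..N + h}" "{1..N} \<inter> {Suc N..N + h} = {}" using N by auto
    then have "mu_log_riesz (2 * B) (N + h) = (\<Sum>n=1..N. a n * (real (N + h) - real n)) + E"
      unfolding mu_log_riesz_def a_def E_def by (subst sum.union_disjoint[symmetric]) auto
    also have "(\<Sum>n=1..N. a n * (real (N + h) - real n)) = mu_log_riesz (2 * B) N + real h * mu_log_sum (2 * B) N"
      unfolding mu_log_riesz_def mu_log_sum_def sum_distrib_left sum.distrib[symmetric] a_def
      by (intro sum.cong refl) (simp add: algebra_simps)
    finally have eq: "real h * mu_log_sum (2 * B) N = mu_log_riesz (2 * B) (N + h) - mu_log_riesz (2 * B) N - E"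
      by simp
    have "\<bar>E\<bar> \<le> (\<Sum>n=Suc N..N + h. \<bar>ln (real n) ^ (2 * B) * (real (N + h) - real n)\<bar>)"
      unfolding E_def a_def mult.assoc by (intro mu_log_sum_le_trivial) (use h in auto)
    also have "\<dots> \<le> (\<Sum>n=Suc N..N + h. l ^ (2 * B) * real h)"
    proof (intro sum_mono)
      fix n assume n: "n \<in> {Suc N..N + h}"
      have "ln (real n) \<le> ln (2 * real N)" using n h by simp
      also have "\<dots> = ln 2 + ln (real N)" using N by (simp add: ln_mult)
      also have "\<dots> \<le> l" using ln_2_less_1 by (simp add: l_def)
      finally have "ln (real n) ^ (2 * B) \<le> l ^ (2 * B)" using n by (intro power_mono) auto
      then show "\<bar>ln (real n) ^ (2 * B) * (real (N + h) - real n)\<bar> \<le> l ^ (2 * B) * real h"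
        unfolding abs_mult using n by (intro mult_mono) auto
    qed
    also have "\<dots> = real h * (real h * l ^ (2 * B))" by simp
    finally have E: "\<bar>E\<bar> \<le> real h * (real h * l ^ (2 * B))" .
    have "real h * \<bar>mu_log_sum (2 * B) N\<bar> = \<bar>mu_log_riesz (2 * B) (N + h) - mu_log_riesz (2 * B) N - E\<bar>"
      unfolding eq[symmetric] by (simp add: abs_mult)
    also have "\<dots> \<le> \<bar>mu_log_riesz (2 * B) (N + h)\<bar> + \<bar>mu_log_riesz (2 * B) N\<bar> + \<bar>E\<bar>" by linarith
    also have "\<dots> \<le> K * (2 * real N) ^ 2 + K * real N ^ 2 + real h * (real h * l ^ (2 * B))"
    proof (intro add_mono E)
      have "\<bar>mu_log_riesz (2 * B) (N + h)\<bar> \<le> K * real (N + h) ^ 2" using True by (intro K(2)) auto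
      also have "\<dots> \<le> K * (2 * real N) ^ 2" using h K(1) by (intro mult_left_mono power_mono) auto
      finally show "\<bar>mu_log_riesz (2 * B) (N + h)\<bar> \<le> K * (2 * real N) ^ 2" .
    qed (use K(2) True in auto)
    finally have *: "real h * \<bar>mu_log_sum (2 * B) N\<bar> \<le> 5 * K * real N * real N + real h * (real h * l ^ (2 * B))"
      by (simp add: power2_eq_square algebra_simps)
    have "real N \<le> real h * l ^ B" using h(3) lB by (simp add: field_simps)
    then have "5 * K * real N * real N \<le> 5 * K * real N * (real h * l ^ B)"
      using K(1) by (intro mult_left_mono) auto
    with * have "real h * \<bar>mu_log_sum (2 * B) N\<bar> \<le> real h * (5 * K * real N * l ^ B + real h * l ^ (2 * B))"
      by (simp add: algebra_simps)
    then have "\<bar>mu_log_sum (2 * B) N\<bar> \<le> 5 * K * real N * l ^ B + real h * l ^ (2 * B)"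
      using h(1) by (subst (asm) mult_le_cancel_left_pos) auto
    also have "real h * l ^ (2 * B) \<le> (real N / l ^ B + 1) * l ^ (2 * B)"
      using h(4) l by (intro mult_right_mono) auto
    also have "\<dots> = real N * l ^ B + l ^ (2 * B)"
    proof -
      have "l ^ (2 * B) = l ^ B * l ^ B" by (simp add: mult_2 power_add)
      then show ?thesis using l by (simp add: distrib_right)
    qed
    also have "l ^ (2 * B) \<le> C1 * real N * l ^ B"
    proof -
      have "l ^ (2 * B) \<le> C1 * real N" using C1(2)[of N] N by (simp add: l_def)
      also have "\<dots> \<le> C1 * real N * l ^ B" using mult_left_mono[OF lB, of "C1 * real N"] C1(1) by simp
      finally show ?thesis .
    qed
    also have "5 * K * real N * l ^ B + (real N * l ^ B + C1 * real N * l ^ B) \<le> C * real N * l ^ B"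
      using C1(1) l by (simp add: C_def algebra_simps)
    finally show ?thesis by (simp add: l_def)
  qed
  moreover have "C > 0" using K(1) C1(1) by (simp add: C_def)
  ultimately show ?thesis by blast
qed

lemma sum_by_parts_atLeastAtMost:
  fixes a c :: "nat \<Rightarrow> real"
  assumes "m < N"
  shows "(\<Sum>n=Suc m..N. a n * c n) = (\<Sum>k=1..N. a k) * c N - (\<Sum>k=1..m. a k) * c (Suc m) +
           (\<Sum>n=Suc m..<N. (\<Sum>k=1..n. a k) * (c n - c (Suc n)))"
proof -
  have "Suc m \<le> N" using assms by simp
  then show ?thesis
  proof (induction N rule: dec_induct)
    case (step N)
    have "{Suc m..Suc N} = insert (Suc N) {Suc m..N}" using step by auto
    moreover have "{Suc m..<Suc N} = insert N {Suc m..<N}" using step by auto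
    ultimately show ?case using step by (simp add: algebra_simps)
  qed (simp add: algebra_simps)
qed

definition mertens_sum :: "nat \<Rightarrow> real" where
  "mertens_sum N = (\<Sum>n=1..N. of_int (moebius_mu n))"

lemma abs_mertens_sum_le: "\<bar>mertens_sum N\<bar> \<le> real N"
proof (cases "N = 0")
  case False
  then show ?thesis
    using mu_log_sum_le_trivial[of 1 N "\<lambda>_. 1"] by (simp add: mertens_sum_def)
qed (simp add: mertens_sum_def)

text \<open>Partial summation against 1 / ln n ^ (2 * B) removes the weight. It is carried out only
  for n above sqrt N, where ln n is comparable with ln N and the weight is far from its singularity
  at 1; the remaining n contribute at most sqrt N.\<close>

lemma mertens_sum_bound:
  "\<exists>C>0. \<forall>N\<ge>1. \<bar>mertens_sum N\<bar> \<le> C * real N / (1 + ln (real N)) ^ B"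
proof -
  obtain C where C: "C > 0" "\<And>N. N \<ge> 1 \<Longrightarrow> \<bar>mu_log_sum (2 * B) N\<bar> \<le> C * real N * (1 + ln (real N)) ^ B"
    using mu_log_sum_bound[of B] by blast
  obtain D where D: "D > 0" "\<And>x::real. x \<ge> 1 \<Longrightarrow> (1 + ln x) ^ B \<le> D * x powr (1/2)"
    using one_plus_ln_power_le[of "1/2" B] by auto
  define F where "F = 3 ^ B * 3 + D + 3 * C * 4 ^ (2 * B)"
  have "\<bar>mertens_sum N\<bar> \<le> F * real N / (1 + ln (real N)) ^ B" if N: "N \<ge> 1" for N
  proof (cases "N \<ge> 3")
    case False
    have l: "0 < 1 + ln (real N)" using N by (simp add: add_pos_nonneg)
    have "ln (real N) \<le> ln 2" using False N by simp
    then have "1 + ln (real N) \<le> 3" using ln_2_less_1 by linarith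
    then have "(1 + ln (real N)) ^ B \<le> 3 ^ B" using N by (intro power_mono) auto
    then have "\<bar>mertens_sum N\<bar> * (1 + ln (real N)) ^ B \<le> real N * 3 ^ B"
      using abs_mertens_sum_le[of N] l by (intro mult_mono) auto
    also have "\<dots> \<le> F * real N" using C(1) D(1) by (simp add: F_def algebra_simps)
    finally show ?thesis using l by (simp add: field_simps)
  next
    case True
    define l where "l = 1 + ln (real N)"
    have "exp 1 \<le> real N" using exp_le True by linarith
    then have lnN: "ln (real N) \<ge> 1" using N by (simp add: ln_ge_iff)
    then have l: "l \<ge> 1" "l \<le> 2 * ln (real N)" by (auto simp: l_def)
    define m where "m = nat \<lfloor>sqrt (real N)\<rfloor>"
    have sq: "1 < sqrt (real N)" "sqrt (real N) < real N" using True
      by (auto simp: real_sqrt_less_iff intro: real_less_lsqrt simp: power2_eq_square)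
    have m: "m \<ge> 1" "real m \<le> sqrt (real N)" "real m + 1 > sqrt (real N)" "m < N"
      using sq unfolding m_def by linarith+
    define a where "a = (\<lambda>n. of_int (moebius_mu n) * ln (real n) ^ (2 * B) :: real)"
    define c where "c = (\<lambda>n. 1 / ln (real n) ^ (2 * B) :: real)"
    define S where "S = (\<lambda>n. \<Sum>k=1..n. a k)"
    have S: "\<bar>S n\<bar> \<le> C * real N * l ^ B" if "n \<ge> 1" "n \<le> N" for n
    proof -
      have "\<bar>S n\<bar> \<le> C * real n * (1 + ln (real n)) ^ B"
        using C(2)[OF that(1)] by (simp add: S_def a_def mu_log_sum_def)
      also have "\<dots> \<le> C * real N * l ^ B"
        using C(1) that N by (intro mult_mono power_mono) (auto simp: l_def)
      finally show ?thesis .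
    qed
    have cdec: "c (Suc n) \<le> c n" "c n \<ge> 0" if "n \<ge> 2" for n
      using that unfolding c_def by (auto intro!: divide_left_mono power_mono mult_pos_pos zero_less_power)
    have m2: "Suc m \<ge> 2" using m by simp
    have cs: "c (Suc m) \<le> 4 ^ (2 * B) / l ^ (2 * B)"
    proof -
      have "ln (real N) / 2 = ln (sqrt (real N))" using N by (simp add: ln_sqrt)
      also have "\<dots> \<le> ln (real (Suc m))" using m sq by (subst ln_le_cancel_iff) auto
      finally have "l / 4 \<le> ln (real (Suc m))" using l by linarith
      then have "(l / 4) ^ (2 * B) \<le> ln (real (Suc m)) ^ (2 * B)" using l by (intro power_mono) auto
      then have "c (Suc m) \<le> 1 / (l / 4) ^ (2 * B)" unfolding c_def using l m(1)
        by (intro divide_left_mono mult_pos_pos zero_less_power) auto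
      then show ?thesis by (simp add: power_divide)
    qed
    have cN: "c N \<le> c (Suc m)"
      using m(4) unfolding Suc_le_eq[symmetric]
    proof (induction N rule: dec_induct)
      case (step n)
      then show ?case using cdec(1)[of n] m2 by simp
    qed simp
    have tel: "(\<Sum>n=Suc m..<N. c n - c (Suc n)) = c (Suc m) - c N"
      using m(4) unfolding Suc_le_eq[symmetric] by (induction N rule: dec_induct) (auto simp: algebra_simps)
    have "{1..N} = {1..m} \<union> {Suc m..N}" "{1..m} \<inter> {Suc m..N} = {}" using m by auto
    then have "mertens_sum N = mertens_sum m + (\<Sum>n=Suc m..N. of_int (moebius_mu n))"
      unfolding mertens_sum_def by (subst sum.union_disjoint[symmetric]) auto
    also have "(\<Sum>n=Suc m..N. of_int (moebius_mu n)) = (\<Sum>n=Suc m..N. a n * c n)"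
      using m2 by (intro sum.cong refl) (auto simp: a_def c_def)
    also have "\<dots> = S N * c N - S m * c (Suc m) + (\<Sum>n=Suc m..<N. S n * (c n - c (Suc n)))"
      unfolding S_def using m(4) by (rule sum_by_parts_atLeastAtMost)
    finally have "\<bar>mertens_sum N\<bar> \<le> \<bar>mertens_sum m\<bar> + \<bar>S N * c N\<bar> + \<bar>S m * c (Suc m)\<bar> + \<bar>\<Sum>n=Suc m..<N. S n * (c n - c (Suc n))\<bar>"
      by linarith
    also have "\<bar>\<Sum>n=Suc m..<N. S n * (c n - c (Suc n))\<bar> \<le> (\<Sum>n=Suc m..<N. (C * real N * l ^ B) * (c n - c (Suc n)))"
    proof (intro sum_abs[THEN order_trans] sum_mono)
      fix n assume n: "n \<in> {Suc m..<N}"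
      have "\<bar>c n - c (Suc n)\<bar> = c n - c (Suc n)" using cdec(1)[of n] n m2 by simp
      then show "\<bar>S n * (c n - c (Suc n))\<bar> \<le> (C * real N * l ^ B) * (c n - c (Suc n))"
        unfolding abs_mult using n S[of n] cdec(1)[of n] m2 by (auto intro!: mult_right_mono)
    qed
    also have "\<dots> = (C * real N * l ^ B) * (c (Suc m) - c N)" by (simp add: sum_distrib_left[symmetric] tel)
    also have "\<dots> \<le> (C * real N * l ^ B) * c (Suc m)"
      using C(1) l cdec(2)[of N] True by (intro mult_left_mono) auto
    also have "\<bar>S N * c N\<bar> \<le> (C * real N * l ^ B) * c (Suc m)"
      unfolding abs_mult using S[of N] cN cdec(2)[of N] N True C(1) l by (intro mult_mono) auto
    also have "\<bar>S m * c (Suc m)\<bar> \<le> (C * real N * l ^ B) * c (Suc m)"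
      unfolding abs_mult using S[of m] cdec(2)[OF m2] m C(1) l by (intro mult_mono) auto
    also have "\<bar>mertens_sum m\<bar> \<le> sqrt (real N)" using abs_mertens_sum_le[of m] m by linarith
    finally have "\<bar>mertens_sum N\<bar> \<le> sqrt (real N) + 3 * ((C * real N * l ^ B) * c (Suc m))" by simp
    also have "(C * real N * l ^ B) * c (Suc m) \<le> (C * real N * l ^ B) * (4 ^ (2 * B) / l ^ (2 * B))"
      using C(1) l by (intro mult_left_mono cs) auto
    also have "\<dots> = C * 4 ^ (2 * B) * real N / l ^ B" 
    proof -
      have "l ^ (2 * B) = l ^ B * l ^ B" by (simp add: mult_2 power_add)
      moreover have "l ^ B > 0" using l by simp
      moreover have "x * y * z * (w / (z * z)) = x * w * y / z" if "z > 0" for x y z w :: real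
        using that by simp
      ultimately show ?thesis by metis
    qed
    also have "sqrt (real N) \<le> D * real N / l ^ B"
    proof -
      have "l ^ B \<le> D * sqrt (real N)" using D(2)[of N] N by (simp add: l_def powr_half_sqrt)
      then have "l ^ B * sqrt (real N) \<le> D * sqrt (real N) * sqrt (real N)" by (intro mult_right_mono) auto
      then show ?thesis using l by (simp add: field_simps)
    qed
    finally have "\<bar>mertens_sum N\<bar> \<le> (D + 3 * C * 4 ^ (2 * B)) * real N / l ^ B"
      unfolding distrib_right add_divide_distrib by (simp add: mult_ac)
    also have "\<dots> \<le> F * real N / l ^ B"
      using l by (intro divide_right_mono mult_right_mono) (auto simp: F_def)
    finally show ?thesis by (simp add: l_def)
  qed
  moreover have "F > 0" using C(1) D(1) unfolding F_def by (intro add_pos_nonneg) auto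
  ultimately show ?thesis by blast
qed

section \<open>Prime sums and smooth numbers\<close>

lemma prod_primes_dvd:
  fixes m :: nat
  assumes "finite A" "\<And>q. q \<in> A \<Longrightarrow> prime q" "\<And>q. q \<in> A \<Longrightarrow> q dvd m"
  shows "\<Prod>A dvd m"
  using assms
proof (induction A rule: finite_induct)
  case (insert q A)
  have "coprime q (\<Prod>A)"
    using insert by (intro prod_coprime_right) (auto intro: primes_coprime)
  then show ?case using insert by (auto intro: divides_mult)
qed auto

text \<open>Every prime in (n, 2n] divides (2n)! but not n!, hence divides the central binomial
  coefficient.\<close>

lemma prod_primes_doubling_le: "\<Prod>{q. prime q \<and> n < q \<and> q \<le> 2 * n} \<le> (4::nat) ^ n"
proof -
  let ?A = "{q. prime q \<and> n < q \<and> q \<le> 2 * n}"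
  have "q dvd (2 * n choose n)" if q: "q \<in> ?A" for q
  proof -
    have "fact n * fact (2 * n - n) * (2 * n choose n) = (fact (2 * n) :: nat)"
      by (rule binomial_fact_lemma) simp
    then have "q dvd fact n * fact n * (2 * n choose n)"
      using q by (simp add: prime_dvd_fact_iff mult_2)
    then show ?thesis using q by (auto simp: prime_dvd_mult_iff prime_dvd_fact_iff)
  qed
  then have "\<Prod>?A dvd (2 * n choose n)" by (intro prod_primes_dvd) auto
  then have "\<Prod>?A \<le> (2 * n choose n)" by (rule dvd_imp_le) simp
  also have "\<dots> \<le> 2 ^ (2 * n)" by (rule binomial_le_pow2)
  finally show ?thesis by (simp add: power_mult)
qed

text \<open>Strong induction with m the upper half of n: the primes in (m, 2m] add at most 2 * m,
  and 4 * m + 2 * m <= 3 * n + 3 <= 4 * n for n >= 3.\<close>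

lemma sum_ln_primes_le: "(\<Sum>q | prime q \<and> q \<le> n. ln (real q)) \<le> 4 * real n"
proof (induction n rule: less_induct)
  case (less n)
  show ?case
  proof (cases "n \<le> 2")
    case True
    have "{q. prime q \<and> q \<le> n} \<subseteq> {2..n}" using prime_ge_2_nat by auto
    then have "(\<Sum>q | prime q \<and> q \<le> n. ln (real q)) \<le> (\<Sum>q\<in>{2..n}. ln (real q))"
      by (intro sum_mono2) auto
    also have "\<dots> \<le> (\<Sum>q\<in>{2..n}. 1)"
    proof (intro sum_mono)
      fix q assume "q \<in> {2..n}"
      then have "q = 2" using True by auto
      then show "ln (real q) \<le> 1" using ln_2_less_1 by simp
    qed
    finally show ?thesis by simp
  next
    case False
    define m where "m = (n + 1) div 2"
    have m: "m < n" "n \<le> 2 * m" "2 * m \<le> n + 1" "m \<ge> 2" using False by (auto simp: m_def)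
    let ?A = "{q. prime q \<and> m < q \<and> q \<le> 2 * m}"
    have fin: "finite {q. prime q \<and> q \<le> k}" for k :: nat by simp
    have "(\<Sum>q | prime q \<and> q \<le> n. ln (real q)) \<le> (\<Sum>q\<in>{q. prime q \<and> q \<le> m} \<union> ?A. ln (real q))"
    proof (rule sum_mono2)
      show "0 \<le> ln (real q)" if "q \<in> {q. prime q \<and> q \<le> m} \<union> ?A - {q. prime q \<and> q \<le> n}" for q
        using that prime_gt_0_nat[of q] by auto
    qed (use m in auto)
    also have "\<dots> = (\<Sum>q | prime q \<and> q \<le> m. ln (real q)) + (\<Sum>q\<in>?A. ln (real q))"
      by (intro sum.union_disjoint) auto
    also have "(\<Sum>q\<in>?A. ln (real q)) = ln (\<Prod>q\<in>?A. real q)"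
      by (subst ln_prod) (auto simp: prime_gt_0_nat)
    also have "(\<Prod>q\<in>?A. real q) = real (\<Prod>?A)" by simp
    also have "ln \<dots> \<le> ln (real (4 ^ m))"
    proof -
      have "\<Prod>?A > 0" by (intro prod_pos) (auto simp: prime_gt_0_nat)
      then show ?thesis using prod_primes_doubling_le[of m] by (subst ln_le_cancel_iff) (auto simp del: of_nat_prod of_nat_power)
    qed
    also have "\<dots> = real m * (2 * ln 2)" using ln_realpow[of 2 2] by (simp add: ln_realpow)
    also have "\<dots> \<le> real m * 2" using ln_2_less_1 by (intro mult_left_mono) auto
    also have "(\<Sum>q | prime q \<and> q \<le> m. ln (real q)) \<le> 4 * real m" by (rule less.IH) fact
    finally show ?thesis using m by linarith
  qed
qed

text \<open>The product of these primes is at least (2^j) to the power of their number and at most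
  4^(2^j), so there are at most 2^(j + 1) / j of them.\<close>

lemma sum_inverse_primes_dyadic_le:
  assumes "j \<ge> 1"
  shows "(\<Sum>q | prime q \<and> 2 ^ j < q \<and> q \<le> (2::nat) ^ Suc j. 1 / real q) \<le> 2 / real j"
proof -
  let ?A = "{q. prime q \<and> (2::nat) ^ j < q \<and> q \<le> 2 ^ Suc j}"
  have fin: "finite ?A" by simp
  have "(2 ^ j) ^ card ?A = (\<Prod>q\<in>?A. (2::nat) ^ j)" by simp
  also have "\<dots> \<le> \<Prod>?A" by (intro prod_mono) auto
  also have "\<dots> \<le> 4 ^ 2 ^ j" using prod_primes_doubling_le[of "2 ^ j"] by simp
  also have "\<dots> = 2 ^ (2 ^ Suc j)" by (simp add: power_mult)
  finally have "j * card ?A \<le> 2 ^ Suc j" by (simp add: power_mult[symmetric] power_increasing_iff)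
  then have c: "real j * real (card ?A) \<le> 2 ^ Suc j" 
    by (metis of_nat_le_iff of_nat_mult of_nat_numeral of_nat_power)
  have "(\<Sum>q\<in>?A. 1 / real q) \<le> (\<Sum>q\<in>?A. 1 / 2 ^ j)"
  proof (intro sum_mono divide_left_mono)
    fix q assume q: "q \<in> ?A"
    then have "2 ^ j \<le> q" by simp
    then show "(2::real) ^ j \<le> real q" by (metis of_nat_le_iff of_nat_numeral of_nat_power)
    show "0 < real q * 2 ^ j" using q by (auto simp: prime_gt_0_nat)
  qed auto
  also have "\<dots> = real (card ?A) / 2 ^ j" by simp
  also have "\<dots> \<le> 2 / real j" using c assms by (simp add: field_simps)
  finally show ?thesis .
qed

lemma sum_inverse_le_ln_ratio:
  assumes "1 \<le> a" "a \<le> b"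
  shows "(\<Sum>j=a..b. 1 / real j) \<le> 1 + ln (real b / real a)"
  using assms(2)
proof (induction b rule: dec_induct)
  case base
  then show ?case using assms(1) by (simp add: field_simps)
next
  case (step b)
  have "ln (real b / real (Suc b)) \<le> real b / real (Suc b) - 1"
    using step assms by (intro ln_le_minus_one) auto
  also have "\<dots> = - (1 / real (Suc b))" by (simp add: field_simps)
  finally have "1 / real (Suc b) \<le> ln (real (Suc b)) - ln (real b)"
    using step assms by (simp add: ln_div)
  moreover have "{a..Suc b} = insert (Suc b) {a..b}" using step by auto
  ultimately show ?case using step assms by (simp add: ln_div)
qed

lemma sum_inverse_primes_pow2_le:
  assumes "1 \<le> a" "a \<le> b"
  shows "(\<Sum>q | prime q \<and> 2 ^ a < q \<and> q \<le> (2::nat) ^ Suc b. 1 / real q) \<le> 2 + 2 * ln (real b / real a)"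
proof -
  have "(\<Sum>q | prime q \<and> 2 ^ a < q \<and> q \<le> (2::nat) ^ Suc b. 1 / real q) \<le> (\<Sum>j=a..b. 2 / real j)"
    using assms(2)
  proof (induction b rule: dec_induct)
    case base
    then show ?case using sum_inverse_primes_dyadic_le[OF assms(1)] by simp
  next
    case (step b)
    have "(2::nat) ^ a \<le> 2 ^ Suc b" using step by (intro power_increasing) auto
    then have "{q. prime q \<and> 2 ^ a < q \<and> q \<le> (2::nat) ^ Suc (Suc b)} =
          {q. prime q \<and> 2 ^ a < q \<and> q \<le> (2::nat) ^ Suc b} \<union> {q. prime q \<and> 2 ^ Suc b < q \<and> q \<le> (2::nat) ^ Suc (Suc b)}"
      by auto
    then have "(\<Sum>q | prime q \<and> 2 ^ a < q \<and> q \<le> (2::nat) ^ Suc (Suc b). 1 / real q) =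
         (\<Sum>q | prime q \<and> 2 ^ a < q \<and> q \<le> (2::nat) ^ Suc b. 1 / real q) +
         (\<Sum>q | prime q \<and> 2 ^ Suc b < q \<and> q \<le> (2::nat) ^ Suc (Suc b). 1 / real q)"
      by (simp only:) (intro sum.union_disjoint, auto)
    also have "\<dots> \<le> (\<Sum>j=a..b. 2 / real j) + 2 / real (Suc b)"
      by (intro add_mono step sum_inverse_primes_dyadic_le) simp
    also have "\<dots> = (\<Sum>j=a..Suc b. 2 / real j)" using step by simp
    finally show ?case .
  qed
  also have "\<dots> = 2 * (\<Sum>j=a..b. 1 / real j)" by (simp add: sum_distrib_left)
  also have "\<dots> \<le> 2 * (1 + ln (real b / real a))" by (intro mult_left_mono sum_inverse_le_ln_ratio assms) auto
  finally show ?thesis by simp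
qed

text \<open>A one-sided theorem of Mertens, with factor 2 in place of 1 because the dyadic counts
  lose a constant. This factor becomes the square in \<open>prod_rough_primes_le\<close>.\<close>

lemma sum_inverse_primes_interval_le:
  assumes "2 \<le> z" "z \<le> y"
  shows "(\<Sum>q | prime q \<and> z < q \<and> q \<le> y. 1 / real q) \<le> 5 + 2 * ln (ln (real y) / ln (real z))"
proof -
  obtain a where a: "2 ^ a \<le> z" "z < 2 ^ Suc a" using ex_power_ivl1[of 2 z] assms by auto
  obtain b where b: "2 ^ b \<le> y" "y < 2 ^ Suc b" using ex_power_ivl1[of 2 y] assms by auto
  have a1: "1 \<le> a"
  proof (rule ccontr)
    assume "\<not> 1 \<le> a"
    then have "a = 0" by simp
    then show False using a(2) assms by simp
  qed
  have ab: "a \<le> b"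
  proof (rule ccontr)
    assume "\<not> a \<le> b"
    then have "(2::nat) ^ Suc b \<le> 2 ^ a" by (intro power_increasing) auto
    then show False using a b assms by linarith
  qed
  have ln: "real n * ln 2 \<le> ln (real m)" if "2 ^ n \<le> m" for n m :: nat
  proof -
    have "(2::real) ^ n \<le> real m" using that by (metis of_nat_le_iff of_nat_numeral of_nat_power)
    then have "ln ((2::real) ^ n) \<le> ln (real m)" by (intro ln_mono) (auto intro: less_le_trans[of 0 "2 ^ n"])
    then show ?thesis by (simp add: ln_realpow)
  qed
  have ln': "ln (real m) \<le> real n * ln 2" if "m < 2 ^ n" "m > 0" for n m :: nat
  proof -
    have "real m < (2::real) ^ n" using that by (metis of_nat_less_iff of_nat_numeral of_nat_power)
    then have "ln (real m) \<le> ln ((2::real) ^ n)" using that by (intro ln_mono) auto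
    then show ?thesis by (simp add: ln_realpow)
  qed
  have l2: "ln 2 > (0::real)" by simp
  have y: "real b * ln 2 \<le> ln (real y)" by (rule ln) fact
  have "ln (real z) \<le> real (Suc a) * ln 2" by (rule ln') (use a assms in auto)
  also have "\<dots> \<le> (2 * real a) * ln 2" using a1 by (intro mult_right_mono) auto
  finally have z: "ln (real z) \<le> 2 * (real a * ln 2)" by simp
  have lz: "ln (real z) > 0" using assms by simp
  have "real b / real a = (real b * ln 2) / (real a * ln 2)" by simp
  also have "\<dots> \<le> ln (real y) / (ln (real z) / 2)"
    using y z lz a1 assms by (intro frac_le) auto
  finally have ba: "real b / real a \<le> 2 * (ln (real y) / ln (real z))" by (simp add: mult.commute)
  have "(\<Sum>q | prime q \<and> z < q \<and> q \<le> y. 1 / real q) \<le> (\<Sum>q | prime q \<and> 2 ^ a < q \<and> q \<le> (2::nat) ^ Suc b. 1 / real q)"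
    using a b by (intro sum_mono2) auto
  also have "\<dots> \<le> 2 + 2 * ln (real b / real a)" by (rule sum_inverse_primes_pow2_le) fact+
  also have "ln (real b / real a) \<le> ln (2 * (ln (real y) / ln (real z)))"
    using ba a1 ab by (intro ln_mono) auto
  also have "\<dots> = ln 2 + ln (ln (real y) / ln (real z))"
    using lz assms by (subst ln_mult) (auto intro: divide_pos_pos)
  also have "ln 2 \<le> (1::real)" using ln_2_less_1 by simp
  finally show ?thesis by simp
qed

section \<open>Smooth numbers and Moebius sums free of given primes\<close>

lemma real_div_le: "real (m div n) \<le> real m / real n"
proof (cases "n = 0")
  case False
  have "real (m div n * n) \<le> real m" by (simp only: of_nat_le_iff div_times_less_eq_dividend)
  then show ?thesis using False by (simp add: field_simps)
qed auto

definition smooth_upto :: "nat set \<Rightarrow> nat \<Rightarrow> nat set" where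
  "smooth_upto Q u = {h \<in> {1..u}. prime_factors h \<subseteq> Q}"

lemma finite_smooth_upto [simp]: "finite (smooth_upto Q u)"
  by (simp add: smooth_upto_def)

lemma smooth_upto_empty: "u \<ge> 1 \<Longrightarrow> smooth_upto {} u = {1}"
  by (auto simp: smooth_upto_def prime_factorization_empty_iff)

lemma smooth_upto_insert:
  assumes "prime q"
  shows "smooth_upto (insert q Q) u \<subseteq> smooth_upto Q u \<union> (*) q ` smooth_upto (insert q Q) (u div q)"
    and "(*) q ` smooth_upto (insert q Q) (u div q) \<subseteq> smooth_upto (insert q Q) u"
proof -
  have q0: "q > 0" using assms prime_gt_0_nat by blast
  show "smooth_upto (insert q Q) u \<subseteq> smooth_upto Q u \<union> (*) q ` smooth_upto (insert q Q) (u div q)"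
  proof
    fix h assume h: "h \<in> smooth_upto (insert q Q) u"
    show "h \<in> smooth_upto Q u \<union> (*) q ` smooth_upto (insert q Q) (u div q)"
    proof (cases "q dvd h")
      case True
      then obtain m where m: "h = q * m" by auto
      have "m \<noteq> 0" using h m by (auto simp: smooth_upto_def)
      then have "m \<in> smooth_upto (insert q Q) (u div q)"
        using h m q0 by (auto simp: smooth_upto_def prime_factors_product less_eq_div_iff_mult_less_eq mult.commute)
      then show ?thesis using m by auto
    next
      case False
      then show ?thesis using h by (auto simp: smooth_upto_def dest: in_prime_factors_imp_dvd)
    qed
  qed
  show "(*) q ` smooth_upto (insert q Q) (u div q) \<subseteq> smooth_upto (insert q Q) u"
    using q0 assms by (auto simp: smooth_upto_def prime_factors_product prime_factorization_prime
        less_eq_div_iff_mult_less_eq mult.commute Suc_le_eq)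
qed

lemma smooth_upto_mono: "u \<le> v \<Longrightarrow> smooth_upto Q u \<subseteq> smooth_upto Q v"
  by (auto simp: smooth_upto_def)

text \<open>For completely multiplicative \<open>f\<close>, the multiples of \<open>q\<close> in the
  set are \<open>q\<close> times elements of the same kind. Hence the sum S satisfies S <= S' + f q
  * S, where S' is the sum without \<open>q\<close>, and this can be solved for S as f q <
  1.\<close>

lemma sum_smooth_upto_le_prod:
  fixes f :: "nat \<Rightarrow> real"
  assumes "finite Q" "\<And>q. q \<in> Q \<Longrightarrow> prime q"
    and mult: "\<And>a b. f (a * b) = f a * f b" and f: "f 1 = 1" "\<And>n. f n \<ge> 0" "\<And>q. q \<in> Q \<Longrightarrow> f q < 1"
  shows "(\<Sum>h\<in>smooth_upto Q u. f h) \<le> (\<Prod>q\<in>Q. 1 / (1 - f q))"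
  using assms(1,2) f(3)
proof (induction Q arbitrary: u rule: finite_induct)
  case empty
  show ?case
  proof (cases "u \<ge> 1")
    case True
    then show ?thesis by (simp add: smooth_upto_empty f del: One_nat_def)
  qed (auto simp: smooth_upto_def)
next
  case (insert q Q)
  have q: "prime q" using insert by auto
  then have q0: "q > 0" using prime_gt_0_nat by blast
  let ?S = "\<Sum>h\<in>smooth_upto (insert q Q) u. f h"
  have "?S \<le> (\<Sum>h\<in>smooth_upto Q u \<union> (*) q ` smooth_upto (insert q Q) (u div q). f h)"
    by (intro sum_mono2 smooth_upto_insert q) (auto simp: f)
  also have "\<dots> \<le> (\<Sum>h\<in>smooth_upto Q u. f h) + (\<Sum>h\<in>(*) q ` smooth_upto (insert q Q) (u div q). f h)"
    by (subst sum_Un) (auto intro!: sum_nonneg f)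
  also have "(\<Sum>h\<in>(*) q ` smooth_upto (insert q Q) (u div q). f h) = f q * (\<Sum>h\<in>smooth_upto (insert q Q) (u div q). f h)"
    using q0 by (subst sum.reindex) (auto simp: inj_on_def mult sum_distrib_left)
  also have "f q * (\<Sum>h\<in>smooth_upto (insert q Q) (u div q). f h) \<le> f q * ?S"
    by (intro mult_left_mono sum_mono2 smooth_upto_mono) (auto simp: f)
  finally have "?S \<le> (\<Sum>h\<in>smooth_upto Q u. f h) + f q * ?S" by simp
  then have "(1 - f q) * ?S \<le> (\<Sum>h\<in>smooth_upto Q u. f h)" by (simp add: algebra_simps)
  also have "\<dots> \<le> (\<Prod>q\<in>Q. 1 / (1 - f q))" using insert by auto
  finally have "?S \<le> (\<Prod>q\<in>Q. 1 / (1 - f q)) / (1 - f q)"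
    using insert.prems(2)[of q] by (simp add: field_simps)
  then show ?case using insert by simp
qed

definition mertens_coprime :: "nat set \<Rightarrow> nat \<Rightarrow> real" where
  "mertens_coprime Q u = (\<Sum>e | e \<in> {1..u} \<and> (\<forall>q\<in>Q. \<not> q dvd e). of_int (moebius_mu e))"

text \<open>Among the e free of primes in \<open>Q\<close>, the multiples q * m contribute - mu(m)
  if \<open>q\<close> does not divide m, and 0 otherwise.\<close>

lemma mertens_coprime_insert:
  assumes "prime q" "q \<notin> Q" "\<And>r. r \<in> Q \<Longrightarrow> prime r"
  shows "mertens_coprime (insert q Q) u = mertens_coprime Q u + mertens_coprime (insert q Q) (u div q)"
proof -
  let ?F = "\<lambda>Q u. {e::nat. e \<in> {1..u} \<and> (\<forall>q\<in>Q. \<not> q dvd e)}"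
  have q0: "q > 0" using assms prime_gt_0_nat by blast
  have fin: "finite (?F Q u)" for Q u by (rule finite_subset[of _ "{1..u}"]) auto
  let ?A = "(*) q ` ?F (insert q Q) (u div q)"
  have nd: "\<not> r dvd q" if "r \<in> Q" for r using that assms primes_dvd_imp_eq[of r q] by auto
  have sub: "?A \<subseteq> ?F Q u"
    using q0 nd assms by (auto simp: less_eq_div_iff_mult_less_eq mult.commute prime_dvd_mult_iff Suc_le_eq)
  have "mertens_coprime Q u = (\<Sum>e\<in>?F (insert q Q) u \<union> ?A. of_int (moebius_mu e))"
    unfolding mertens_coprime_def
  proof (rule sum.mono_neutral_right)
    show "\<forall>e\<in>?F Q u - (?F (insert q Q) u \<union> ?A). real_of_int (moebius_mu e) = 0"
    proof
      fix e assume e: "e \<in> ?F Q u - (?F (insert q Q) u \<union> ?A)"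
      then obtain m where m: "e = q * m" by auto
      have "q dvd m"
      proof (rule ccontr)
        assume "\<not> q dvd m"
        then have "m \<in> ?F (insert q Q) (u div q)"
          using e m q0 by (auto simp: less_eq_div_iff_mult_less_eq mult.commute Suc_le_eq intro: Nat.gr0I)
        then show False using e m by auto
      qed
      then show "real_of_int (moebius_mu e) = 0" using m assms moebius_mu_prime_mult_dvd by simp
    qed
  qed (use fin sub in auto)
  also have "\<dots> = mertens_coprime (insert q Q) u + (\<Sum>e\<in>?A. of_int (moebius_mu e))"
    unfolding mertens_coprime_def using fin by (intro sum.union_disjoint) auto
  also have "(\<Sum>e\<in>?A. of_int (moebius_mu e)) = - mertens_coprime (insert q Q) (u div q)"
    unfolding mertens_coprime_def using q0 assms
    by (subst sum.reindex) (auto simp: inj_on_def moebius_mu_prime_mult sum_negf[symmetric] intro!: sum.cong)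
  finally show ?thesis by simp
qed

text \<open>Iterating \<open>mertens_coprime_insert\<close> expands the restricted sum over all
  \<open>h\<close> composed of primes in \<open>Q\<close>; on Dirichlet series this divides 1 / zeta
  by its Euler factors at \<open>Q\<close>. The outer induction runs over \<open>Q\<close>, the
  inner one over \<open>u\<close>, since the recursion returns to the same set with u div q.\<close>

lemma abs_mertens_coprime_le:
  assumes "finite Q" "\<And>q. q \<in> Q \<Longrightarrow> prime q"
  shows "\<bar>mertens_coprime Q u\<bar> \<le> (\<Sum>h\<in>smooth_upto Q u. \<bar>mertens_coprime {} (u div h)\<bar>)"
  using assms
proof (induction Q arbitrary: u rule: finite_induct)
  case empty
  show ?case
  proof (cases "u \<ge> 1")
    case True
    then show ?thesis by (simp add: smooth_upto_empty)
  next
    case False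
    then show ?thesis by (simp add: mertens_coprime_def smooth_upto_def)
  qed
next
  case (insert q Q)
  have q: "prime q" using insert by auto
  then have q1: "q > 1" using prime_gt_1_nat by blast
  show ?case
  proof (induction u rule: less_induct)
    case (less u)
    show ?case
    proof (cases "u \<ge> 1")
      case True
      let ?f = "\<lambda>h. \<bar>mertens_coprime {} (u div h)\<bar>"
      let ?B = "smooth_upto (insert q Q) (u div q)"
      have "\<bar>mertens_coprime (insert q Q) u\<bar> \<le> \<bar>mertens_coprime Q u\<bar> + \<bar>mertens_coprime (insert q Q) (u div q)\<bar>"
        using insert q by (subst mertens_coprime_insert) (auto intro: abs_triangle_ineq)
      also have "\<dots> \<le> (\<Sum>h\<in>smooth_upto Q u. ?f h) + (\<Sum>h\<in>?B. \<bar>mertens_coprime {} (u div q div h)\<bar>)"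
        using True q1 insert by (intro add_mono less.IH insert.IH) auto
      also have "(\<Sum>h\<in>?B. \<bar>mertens_coprime {} (u div q div h)\<bar>) = (\<Sum>h\<in>(*) q ` ?B. ?f h)"
        using q1 by (subst sum.reindex) (auto simp: inj_on_def div_mult2_eq)
      also have "(\<Sum>h\<in>smooth_upto Q u. ?f h) + \<dots> = (\<Sum>h\<in>smooth_upto Q u \<union> (*) q ` ?B. ?f h)"
      proof (rule sum.union_disjoint[symmetric])
        show "smooth_upto Q u \<inter> (*) q ` ?B = {}"
        proof (rule ccontr)
          assume "smooth_upto Q u \<inter> (*) q ` ?B \<noteq> {}"
          then obtain m where "q * m \<in> smooth_upto Q u" by auto
          then have "q \<in> prime_factors (q * m)" "prime_factors (q * m) \<subseteq> Q"
            using q by (auto simp: smooth_upto_def in_prime_factors_iff)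
          then show False using insert by auto
        qed
      qed auto
      also have "\<dots> \<le> (\<Sum>h\<in>smooth_upto (insert q Q) u. ?f h)"
        using smooth_upto_insert(2)[OF q, of Q u] by (intro sum_mono2) (auto simp: smooth_upto_def)
      finally show ?thesis .
    next
      case False
      then show ?thesis by (simp add: mertens_coprime_def smooth_upto_def)
    qed
  qed
qed

section \<open>Counting squarefree numbers through the logarithms of their primes\<close>

lemma prod_prime_factors_squarefree:
  fixes n :: nat
  assumes "squarefree n"
  shows "\<Prod>(prime_factors n) = n"
proof -
  have n0: "n \<noteq> 0" using assms by (auto intro: Nat.gr0I)
  have "(\<Prod>q\<in>prime_factors n. q ^ multiplicity q n) = n" using prod_prime_factors[OF n0] by simp
  moreover have "multiplicity q n = 1" if "q \<in> prime_factors n" for q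
    using that assms squarefree_factorial_semiring'[OF n0] by auto
  ultimately show ?thesis by simp
qed

lemma ln_squarefree:
  assumes "squarefree n"
  shows "ln (real n) = (\<Sum>q\<in>prime_factors n. ln (real q))"
proof -
  have "(\<Sum>q\<in>prime_factors n. ln (real q)) = ln (\<Prod>q\<in>prime_factors n. real q)"
    by (subst ln_prod) (auto simp: in_prime_factors_iff prime_gt_0_nat)
  also have "(\<Prod>q\<in>prime_factors n. real q) = real n"
    using arg_cong[OF prod_prime_factors_squarefree[OF assms], of real] by simp
  finally show ?thesis by simp
qed

text \<open>Split ln y = ln n + ln (y / n). The second part is at most y / n. The first is the sum
  of ln q over q dividing n; summing over q for fixed m = n / q and applying Chebyshev's bound up to
  y / m gives 4 * y / m. A count is thus reduced to sums of reciprocals with the gain of a full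
  logarithm.\<close>

lemma card_mult_ln_le:
  assumes S: "\<And>n. n \<in> S \<Longrightarrow> squarefree n"
    and div: "\<And>n q. n \<in> S \<Longrightarrow> q \<in> prime_factors n \<Longrightarrow> n div q \<in> S'"
    and y: "y \<ge> 1"
  shows "real (card (S \<inter> {1..y})) * ln (real y) \<le>
           real y * (4 * (\<Sum>m\<in>S' \<inter> {1..y}. 1 / real m) + (\<Sum>n\<in>S \<inter> {1..y}. 1 / real n))"
proof -
  let ?A = "S \<inter> {1..y}" and ?B = "S' \<inter> {1..y}"
  let ?P = "\<lambda>m. {q. prime q \<and> q \<le> y div m}"
  have "real (card ?A) * ln (real y) = (\<Sum>n\<in>?A. ln (real n) + ln (real y / real n))"
    using y by (simp add: ln_div)
  also have "\<dots> = (\<Sum>n\<in>?A. ln (real n)) + (\<Sum>n\<in>?A. ln (real y / real n))" by (rule sum.distrib)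
  also have "(\<Sum>n\<in>?A. ln (real y / real n)) \<le> (\<Sum>n\<in>?A. real y * (1 / real n))"
    using y by (intro sum_mono) (auto intro!: ln_bound)
  also have "(\<Sum>n\<in>?A. ln (real n)) = (\<Sum>n\<in>?A. \<Sum>q\<in>prime_factors n. ln (real q))"
    using S by (intro sum.cong) (auto intro!: ln_squarefree)
  also have "\<dots> = (\<Sum>(n, q)\<in>Sigma ?A prime_factors. ln (real q))"
    by (intro sum.Sigma) auto
  also have "\<dots> \<le> (\<Sum>(m, q)\<in>Sigma ?B ?P. ln (real q))"
  proof (rule sum_le_included[where i = "\<lambda>(m, q). (m * q, q)"])
    show "\<forall>z\<in>Sigma ?A prime_factors. \<exists>w\<in>Sigma ?B ?P. (case w of (m, q) \<Rightarrow> (m * q, q)) = z \<and>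
            (case z of (n, q) \<Rightarrow> ln (real q)) \<le> (case w of (m, q) \<Rightarrow> ln (real q))"
    proof
      fix z assume "z \<in> Sigma ?A prime_factors"
      then obtain n q where z: "z = (n, q)" "n \<in> ?A" "q \<in> prime_factors n" by auto
      then obtain m where m: "n = q * m" "prime q" by (auto simp: in_prime_factors_iff)
      have q0: "q > 0" using m prime_gt_0_nat by blast
      have m0: "m > 0" using z m by (auto intro: Nat.gr0I)
      have "n div q = m" using m q0 by simp
      then have "m \<in> S'" using div[of n q] z by auto
      moreover have "m \<le> q * m" "q * m \<le> y" using q0 z m(1) by auto
      then have "m \<le> y" by linarith
      moreover have "q \<le> y div m" using z m m0 by (auto simp: less_eq_div_iff_mult_less_eq)
      ultimately show "\<exists>w\<in>Sigma ?B ?P. (case w of (m, q) \<Rightarrow> (m * q, q)) = z \<and>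
            (case z of (n, q) \<Rightarrow> ln (real q)) \<le> (case w of (m, q) \<Rightarrow> ln (real q))"
        using m0 m z by (intro bexI[of _ "(m, q)"]) auto
    qed
  qed (auto simp: prime_gt_0_nat intro!: finite_SigmaI ln_ge_zero simp: Suc_le_eq)
  also have "\<dots> = (\<Sum>m\<in>?B. \<Sum>q\<in>?P m. ln (real q))" by (intro sum.Sigma[symmetric]) auto
  also have "\<dots> \<le> (\<Sum>m\<in>?B. 4 * (real y * (1 / real m)))"
  proof (intro sum_mono)
    fix m assume "m \<in> ?B"
    have "(\<Sum>q\<in>?P m. ln (real q)) \<le> 4 * real (y div m)" by (rule sum_ln_primes_le)
    also have "\<dots> \<le> 4 * (real y * (1 / real m))" using real_div_le[of y m] by simp
    finally show "(\<Sum>q\<in>?P m. ln (real q)) \<le> 4 * (real y * (1 / real m))" .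
  qed
  finally show ?thesis by (simp add: sum_distrib_left algebra_simps)
qed

lemma sum_inverse_primes_upto_le:
  assumes "real y \<le> x" "x > 1" "ln (ln x) \<ge> 1"
  shows "(\<Sum>q | prime q \<and> q \<le> y. 1 / real q) \<le> 7 + 2 * ln (ln x)"
proof (cases "y \<ge> 2")
  case True
  have "{q. prime q \<and> q \<le> y} = insert 2 {q. prime q \<and> 2 < q \<and> q \<le> y}"
    using True prime_ge_2_nat by (auto simp: le_less)
  then have "(\<Sum>q | prime q \<and> q \<le> y. 1 / real q) = 1 / 2 + (\<Sum>q | prime q \<and> 2 < q \<and> q \<le> y. 1 / real q)"
    by simp
  also have "\<dots> \<le> 1 / 2 + (5 + 2 * ln (ln (real y) / ln (real 2)))"
    by (intro add_left_mono sum_inverse_primes_interval_le True) simp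
  also have "ln (ln (real y) / ln (real 2)) \<le> ln (3 / 2 * ln x)"
  proof (intro ln_mono)
    have "ln (real y) \<le> ln x" using True assms by (intro ln_mono) auto
    then have "ln (real y) / ln 2 \<le> ln x / (2 / 3)" using ln2_ge_two_thirds True assms(2) by (intro frac_le) auto
    then show "ln (real y) / ln (real 2) \<le> 3 / 2 * ln x" by simp
    show "0 < ln (real y) / ln (real 2)" using True by simp
  qed
  also have "\<dots> = ln (3 / 2) + ln (ln x)"
  proof -
    have "ln x > 0" using assms(2) by simp
    then show ?thesis by (subst ln_mult) auto
  qed
  also have "ln (3 / 2) \<le> (3 / 2 - 1 :: real)" by (intro ln_le_minus_one) auto
  finally show ?thesis by simp
next
  case False
  then have "{q. prime q \<and> q \<le> y} = {}" by (auto dest!: prime_ge_2_nat)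
  then have "(\<Sum>q | prime q \<and> q \<le> y. 1 / real q) = 0" by (simp only: sum.empty)
  then show ?thesis using assms(3) by simp
qed

section \<open>Saving in Moebius sums over integers free of small primes\<close>

lemma mertens_coprime_empty: "mertens_coprime {} u = mertens_sum u"
  unfolding mertens_coprime_def mertens_sum_def by (intro sum.cong) auto

lemma exp_lnln:
  assumes "x > (1::real)" "ln (ln x) \<ge> 1"
  shows "exp (ln (ln x)) = ln x" "ln x \<ge> 2"
proof -
  have "ln x > 0" using assms by simp
  then show "exp (ln (ln x)) = ln x" by simp
  have "exp 1 \<le> ln x" using assms \<open>ln x > 0\<close> by (simp add: ln_ge_iff)
  moreover have "1 + 1 \<le> exp (1::real)" by (rule exp_ge_add_one_self)
  ultimately show "ln x \<ge> 2" by linarith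
qed

text \<open>Rankin's trick: the large smooth numbers \<open>h\<close> are weighted by \<open>(h / sqrt u) powr e\<close>
  with \<open>e = ln 2 / (2 * ln p)\<close>.\<close>

lemma mertens_coprime_saving:
  "\<exists>C>0. \<forall>x p D u. x > 1 \<longrightarrow> ln (ln x) \<ge> 1 \<longrightarrow> prime p \<longrightarrow> finite D \<longrightarrow> (\<forall>q\<in>D. prime q) \<longrightarrow> card D \<le> i \<longrightarrow>
     real u \<le> x \<longrightarrow> 100 * ln (ln x) * ln (real p) \<le> ln (real u) \<longrightarrow>
     \<bar>mertens_coprime ({q. prime q \<and> q \<le> p} \<union> D) u\<bar> \<le> C * real u / (1 + ln (real u)) ^ 2"
proof -
  obtain C1 where C1: "C1 > 0" "\<And>N. N \<ge> 1 \<Longrightarrow> \<bar>mertens_sum N\<bar> \<le> C1 * real N / (1 + ln (real N)) ^ 3"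
    using mertens_sum_bound[of 3] by blast
  define C where "C = 64 * C1 + 4 * (exp 42 * 4 ^ i)"
  have "\<bar>mertens_coprime ({q. prime q \<and> q \<le> p} \<union> D) u\<bar> \<le> C * real u / (1 + ln (real u)) ^ 2"
    if x1: "x > 1" and L: "ln (ln x) \<ge> 1" and p: "prime p" and D: "finite D" "\<forall>q\<in>D. prime q" "card D \<le> i"
      and ux: "real u \<le> x" and big: "100 * ln (ln x) * ln (real p) \<le> ln (real u)" for x p D u
  proof -
    define L where "L = ln (ln x)"
    have L1: "L \<ge> 1" using L by (simp add: L_def)
    define lu where "lu = ln (real u)"
    define lp where "lp = ln (real p)"
    have p2: "real p \<ge> 2" using prime_ge_2_nat[OF p] by simp
    have lp: "lp \<ge> ln 2" "lp > 0" using p2 by (auto simp: lp_def)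
    have "0 < 100 * L * lp" using L1 lp by simp
    moreover have "100 * L * lp \<le> lu" using big by (simp add: lu_def lp_def L_def)
    ultimately have lu: "lu > 0" "100 * L * lp \<le> lu" by linarith+
    have "real u > 0" using lu(1) by (cases "u = 0") (auto simp: lu_def)
    then have u1: "real u > 1" using lu(1) by (simp add: lu_def)
    then have u0: "u \<ge> 1" by simp
    define Q1 where "Q1 = {q. prime q \<and> q \<le> p}"
    \<comment> \<open>With this \<open>e\<close> one has p powr e = sqrt 2, so \<open>f q\<close> is
      at most a constant multiple of 1 / q for every prime q up to \<open>p\<close>.\<close>
    define e where "e = ln 2 / (2 * lp)"
    have e: "0 < e" "e \<le> 1 / 2" using lp by (auto simp: e_def field_simps)
    define f where "f = (\<lambda>n. real n powr (e - 1))"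
    have f34: "f q \<le> 3 / 4" "f q \<ge> 0" if "prime q" for q
    proof -
      have "real q \<ge> 2" using prime_ge_2_nat[OF that] by simp
      then have "f q \<le> 2 powr (e - 1)" unfolding f_def using e by (intro powr_mono2') auto
      also have "\<dots> \<le> 2 powr (- (1 / 2))" using e by (intro powr_mono) auto
      also have "\<dots> = 1 / sqrt 2" by (simp add: powr_minus_divide powr_half_sqrt)
      also have "\<dots> \<le> 3 / 4"
      proof -
        have "4 / 3 \<le> sqrt 2" by (rule real_le_rsqrt) (simp add: power2_eq_square)
        then show ?thesis by (simp add: field_simps)
      qed
      finally show "f q \<le> 3 / 4" .
      show "f q \<ge> 0" by (simp add: f_def)
    qed
    \<comment> \<open>\<open>A1\<close> serves the h with h * h <= u, where 1 + ln (u div h) is at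
      least a quarter of 1 + ln u, whence 64 = 4^3. \<open>A2\<close> serves the other h, for which
      the trivial bound u / h is combined with the weight.\<close>
    define A1 where "A1 = 64 * C1 * real u / (1 + lu) ^ 3"
    define A2 where "A2 = real u powr (1 - e / 2)"
    have A: "A1 \<ge> 0" "A2 \<ge> 0" using C1 lu by (auto simp: A1_def A2_def)
    have trm: "\<bar>mertens_coprime {} (u div h)\<bar> \<le> A1 * (1 / real h) + A2 * f h" if h: "h \<in> {1..u}" for h
    proof (cases "h * h \<le> u")
      case True
      have h0: "h \<ge> 1" "h \<le> u" using h by auto
      define v where "v = u div h"
      have v1: "v \<ge> 1" using h0 by (simp add: v_def Suc_le_eq div_greater_zero_iff)
      have vle: "real v \<le> real u / real h" unfolding v_def by (rule real_div_le)
      have "u < (v + 1) * h" unfolding v_def using dividend_less_div_times[of h u] h0 by (simp add: add.commute)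
      then have "real u < (real v + 1) * real h" by (metis of_nat_less_iff of_nat_mult of_nat_add of_nat_1)
      also have "\<dots> \<le> (2 * real v) * real h" using v1 by (intro mult_right_mono) auto
      finally have vge: "real u / real h \<le> 2 * real v" using h0 by (simp add: field_simps)
      have "real h * real h \<le> real u" using True by (metis of_nat_le_iff of_nat_mult)
      then have "ln (real h * real h) \<le> lu" unfolding lu_def using h0 by (intro ln_mono) auto
      then have lh: "2 * ln (real h) \<le> lu" using h0 by (simp add: ln_mult)
      have "ln (real u / real h) \<le> ln (2 * real v)" using vge h0 u0 by (intro ln_mono) auto
      then have "lu - ln (real h) \<le> ln 2 + ln (real v)" using h0 u0 v1 by (simp add: ln_div ln_mult lu_def)
      then have lv: "(1 + lu) / 4 \<le> 1 + ln (real v)" proof -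
        have "lu / 2 - 25 / 36 \<le> ln (real v)"
          using lh ln2_le_25_over_36 \<open>lu - ln (real h) \<le> ln 2 + ln (real v)\<close> by linarith
        then show ?thesis using lu(1) unfolding add_divide_distrib by linarith
      qed
      have "\<bar>mertens_coprime {} v\<bar> \<le> C1 * real v / (1 + ln (real v)) ^ 3"
        unfolding mertens_coprime_empty by (rule C1(2)[OF v1])
      also have "\<dots> \<le> C1 * (real u / real h) / ((1 + lu) / 4) ^ 3"
        using C1(1) vle lv lu by (intro frac_le mult_left_mono power_mono) auto
      also have "\<dots> = A1 * (1 / real h)" by (simp add: A1_def power_divide field_simps)
      also have "\<dots> \<le> A1 * (1 / real h) + A2 * f h" using A by (simp add: f_def)
      finally show ?thesis by (simp add: v_def)
    next
      case False
      have h0: "real h > 0" using h by simp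
      have "real u \<le> real h * real h" using False by (metis of_nat_le_iff of_nat_mult nle_le)
      then have "real u powr (e / 2) \<le> (real h * real h) powr (e / 2)" using e by (intro powr_mono2) auto
      also have "\<dots> = real h powr e" using h0 by (simp add: powr_mult powr_add[symmetric])
      finally have hu: "real u powr (e / 2) \<le> real h powr e" .
      have "\<bar>mertens_coprime {} (u div h)\<bar> \<le> real (u div h)"
        unfolding mertens_coprime_empty by (rule abs_mertens_sum_le)
      also have "\<dots> \<le> real u / real h" by (rule real_div_le)
      also have "\<dots> = (real u powr (1 - e / 2) * real u powr (e / 2)) / real h"
        using u1 by (simp add: powr_add[symmetric])
      also have "\<dots> \<le> (real u powr (1 - e / 2) * real h powr e) / real h"
        using h0 hu by (intro divide_right_mono mult_left_mono) auto
      also have "\<dots> = A2 * f h" using h0 by (simp add: A2_def f_def powr_diff)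
      also have "\<dots> \<le> A1 * (1 / real h) + A2 * f h" using A by simp
      finally show ?thesis .
    qed
    have prQ: "prime q" if "q \<in> Q1 \<union> D" for q using that D by (auto simp: Q1_def)
    have fin: "finite Q1" "finite (Q1 \<union> D)" using D by (auto simp: Q1_def)
    have "\<bar>mertens_coprime (Q1 \<union> D) u\<bar> \<le> (\<Sum>h\<in>smooth_upto (Q1 \<union> D) u. \<bar>mertens_coprime {} (u div h)\<bar>)"
      using fin prQ by (intro abs_mertens_coprime_le) auto
    also have "\<dots> \<le> (\<Sum>h\<in>smooth_upto (Q1 \<union> D) u. A1 * (1 / real h) + A2 * f h)"
      by (intro sum_mono trm) (auto simp: smooth_upto_def)
    also have "\<dots> = A1 * (\<Sum>h\<in>smooth_upto (Q1 \<union> D) u. 1 / real h) + A2 * (\<Sum>h\<in>smooth_upto (Q1 \<union> D) u. f h)"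
      by (simp add: sum.distrib sum_distrib_left)
    also have "\<dots> \<le> A1 * (1 + lu) + A2 * (exp (42 + 12 * L) * 4 ^ i)"
    proof (intro add_mono mult_left_mono A)
      have "(\<Sum>h\<in>smooth_upto (Q1 \<union> D) u. 1 / real h) \<le> (\<Sum>h=1..u. 1 / real h)"
        by (intro sum_mono2) (auto simp: smooth_upto_def)
      also have "\<dots> \<le> 1 + lu" unfolding lu_def by (rule sum_inverse_le_ln[OF u0])
      finally show "(\<Sum>h\<in>smooth_upto (Q1 \<union> D) u. 1 / real h) \<le> 1 + lu" .
    next
      have "(\<Sum>h\<in>smooth_upto (Q1 \<union> D) u. f h) \<le> (\<Prod>q\<in>Q1 \<union> D. 1 / (1 - f q))"
      proof (rule sum_smooth_upto_le_prod)
        show "f q < 1" if "q \<in> Q1 \<union> D" for q using f34(1)[OF prQ[OF that]] by simp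
        show "f (a * b) = f a * f b" for a b by (simp add: f_def powr_mult)
      qed (use fin prQ in \<open>auto simp: f_def\<close>)
      also have "\<dots> = (\<Prod>q\<in>Q1. 1 / (1 - f q)) * (\<Prod>q\<in>D - Q1. 1 / (1 - f q))"
        using fin D by (subst prod.union_disjoint[symmetric]) (auto intro!: prod.cong)
      also have "\<dots> \<le> exp (42 + 12 * L) * 4 ^ i"
      proof (intro mult_mono)
        have "(\<Prod>q\<in>Q1. 1 / (1 - f q)) \<le> (\<Prod>q\<in>Q1. exp (6 * (1 / real q)))"
        proof (intro prod_mono conjI)
          fix q assume q: "q \<in> Q1"
          have fq: "0 \<le> f q" "f q \<le> 3 / 4" using f34 prQ q by auto
          then show "0 \<le> 1 / (1 - f q)" by simp
          have q0: "real q > 0" using q by (auto simp: Q1_def prime_gt_0_nat)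
          have "f q * 1 \<le> f q * (4 * (1 - f q))" using fq by (intro mult_left_mono) auto
          then have "1 / (1 - f q) \<le> 1 + 4 * f q" using fq by (simp add: field_simps)
          also have "\<dots> \<le> exp (4 * f q)" by (rule exp_ge_add_one_self)
          also have "4 * f q \<le> 6 * (1 / real q)"
          proof -
            have "real q powr e \<le> real p powr e" using q e by (intro powr_mono2) (auto simp: Q1_def)
            also have "\<dots> = exp (e * lp)" using p2 by (simp add: powr_def lp_def)
            also have "e * lp = ln 2 / 2" using lp by (simp add: e_def)
            also have "exp (ln 2 / 2) = sqrt (2::real)" by (simp add: powr_half_sqrt[symmetric] powr_def)
            also have "\<dots> \<le> 3 / 2" by (rule real_le_lsqrt) (auto simp: power2_eq_square)
            finally show ?thesis using q0 by (simp add: f_def powr_diff divide_right_mono)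
          qed
          finally show "1 / (1 - f q) \<le> exp (6 * (1 / real q))" by simp
        qed
        also have "\<dots> = exp (6 * (\<Sum>q\<in>Q1. 1 / real q))" using fin by (simp add: exp_sum sum_distrib_left)
        \<comment> \<open>Six times the bound 7 + 2 * L for the sum of 1 / q; the six comes from 4 *
          f q <= 4 * sqrt 2 / q and sqrt 2 <= 3/2.\<close>
        also have "\<dots> \<le> exp (42 + 12 * L)"
        proof -
          have "1 * lp \<le> 100 * L * lp" using L1 lp by (intro mult_right_mono) auto
          then have "ln (real p) \<le> ln (real u)" using lu by (simp add: lp_def lu_def)
          then have "real p \<le> real u" using p2 u1 by (subst (asm) ln_le_cancel_iff) auto
          then have "(\<Sum>q\<in>Q1. 1 / real q) \<le> 7 + 2 * L"
            unfolding Q1_def L_def using ux L x1 by (intro sum_inverse_primes_upto_le) auto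
          then show ?thesis by simp
        qed
        finally show "(\<Prod>q\<in>Q1. 1 / (1 - f q)) \<le> exp (42 + 12 * L)" .
        have "(\<Prod>q\<in>D - Q1. 1 / (1 - f q)) \<le> (\<Prod>q\<in>D - Q1. 4)"
        proof (intro prod_mono conjI)
          fix q assume q: "q \<in> D - Q1"
          have fq: "f q \<le> 3 / 4" using f34 prQ q by auto
          then show "0 \<le> 1 / (1 - f q)" by simp
          show "1 / (1 - f q) \<le> 4" using fq by (simp add: field_simps)
        qed
        also have "\<dots> = 4 ^ card (D - Q1)" by simp
        also have "\<dots> \<le> 4 ^ i"
          using D card_mono[of D "D - Q1"] by (intro power_increasing) auto
        finally show "(\<Prod>q\<in>D - Q1. 1 / (1 - f q)) \<le> 4 ^ i" .
        show "0 \<le> (\<Prod>q\<in>D - Q1. 1 / (1 - f q))"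
        proof (intro prod_nonneg)
          fix q assume "q \<in> D - Q1"
          then have "f q \<le> 3 / 4" using f34 prQ by auto
          then show "0 \<le> 1 / (1 - f q)" by simp
        qed
      qed auto
      finally show "(\<Sum>h\<in>smooth_upto (Q1 \<union> D) u. f h) \<le> exp (42 + 12 * L) * 4 ^ i" .
    qed
    finally have main: "\<bar>mertens_coprime (Q1 \<union> D) u\<bar> \<le> A1 * (1 + lu) + A2 * (exp (42 + 12 * L) * 4 ^ i)" .
    have A1eq: "A1 * (1 + lu) = 64 * C1 * real u / (1 + lu) ^ 2"
      using lu by (simp add: A1_def power3_eq_cube power2_eq_square)
    have A2le: "A2 * (exp (42 + 12 * L) * 4 ^ i) \<le> 4 * (exp 42 * 4 ^ i) * real u / (1 + lu) ^ 2"
    proof -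
      have "A2 = real u * exp (- (e / 2 * lu))"
        using u1 by (simp add: A2_def powr_diff) (simp add: powr_def lu_def exp_minus field_simps)
      also have "\<dots> \<le> real u * exp (- (16 * L))"
      proof -
        \<comment> \<open>Here the threshold 100 is spent: e / 2 * lu is at least 25 * L * ln 2,
          which exceeds the 12 * L lost in the Euler product by 4 * L, and exp (- (4 * L)) is ln x
          to the power -4.\<close>
        have "16 * L \<le> 25 * L * ln 2" using ln2_ge_two_thirds L1 mult_left_mono[of "2/3" "ln 2" "25 * L"] by auto
        also have "\<dots> = (ln 2 / (4 * lp)) * (100 * L * lp)" using lp by simp
        also have "\<dots> \<le> (ln 2 / (4 * lp)) * lu" using lp lu by (intro mult_left_mono) auto
        also have "\<dots> = e / 2 * lu" by (simp add: e_def)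
        finally show ?thesis by (intro mult_left_mono) auto
      qed
      finally have "A2 * (exp (42 + 12 * L) * 4 ^ i) \<le> real u * exp (- (16 * L)) * (exp (42 + 12 * L) * 4 ^ i)"
        by (intro mult_right_mono) auto
      also have "\<dots> = exp 42 * 4 ^ i * real u * exp (- (4 * L))"
      proof -
        have "exp (- (16 * L)) * exp (42 + 12 * L) = exp 42 * exp (- (4 * L))"
          by (simp add: exp_add[symmetric])
        then show ?thesis by (simp add: mult_ac)
      qed
      also have "\<dots> \<le> exp 42 * 4 ^ i * real u * (4 / (1 + lu) ^ 2)"
      proof -
        have eL: "exp L = ln x" and lx: "ln x \<ge> 2" using exp_lnln[OF x1 L] by (auto simp: L_def)
        have "lu \<le> ln x" unfolding lu_def using u1 ux by (intro ln_mono) auto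
        then have "(1 + lu) ^ 2 \<le> (2 * ln x) ^ 2" using lu lx by (intro power_mono) auto
        also have "\<dots> \<le> 4 * ln x ^ 4" using lx power_increasing[of 2 4 "ln x"] by (simp add: power_mult_distrib)
        also have "ln x ^ 4 = exp (4 * L)" unfolding eL[symmetric] by (simp add: exp_of_nat_mult[symmetric])
        finally have "exp (- (4 * L)) \<le> 4 / (1 + lu) ^ 2" using lu by (simp add: exp_minus field_simps)
        then show ?thesis by (intro mult_left_mono) auto
      qed
      finally show ?thesis by (simp add: mult_ac)
    qed
    have "64 * C1 * real u / (1 + lu) ^ 2 + 4 * (exp 42 * 4 ^ i) * real u / (1 + lu) ^ 2 = C * real u / (1 + lu) ^ 2"
      by (simp only: C_def distrib_right add_divide_distrib)
    then show ?thesis using main A1eq A2le unfolding Q1_def lu_def by linarith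
  qed
  moreover have "C > 0" unfolding C_def using C1(1) by (intro add_pos_pos mult_pos_pos) auto
  ultimately show ?thesis by blast
qed

section \<open>Numbers with a given number of prime factors\<close>

lemma sum_inverse_consecutive_le: "(\<Sum>n=2..y. 1 / (real n * (real n - 1))) \<le> 1"
proof (cases "y \<ge> 2")
  case True
  then have "(\<Sum>n=2..y. 1 / (real n * (real n - 1))) = 1 - 1 / real y"
  proof (induction y rule: dec_induct)
    case (step n)
    have "1 / (real (Suc n) * (real (Suc n) - 1)) = 1 / real n - 1 / real (Suc n)"
      using step by (simp add: field_simps)
    then show ?case using step by simp
  qed simp
  then show ?thesis by simp
qed auto

lemma prod_rough_primes_le:
  assumes "2 \<le> z" "z \<le> y"
  shows "(\<Prod>q | prime q \<and> z < q \<and> q \<le> y. 1 / (1 - 1 / real q)) \<le> exp 6 * (ln (real y) / ln (real z)) ^ 2"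
proof -
  let ?Q = "{q. prime q \<and> z < q \<and> q \<le> y}"
  have "(\<Prod>q\<in>?Q. 1 / (1 - 1 / real q)) \<le> (\<Prod>q\<in>?Q. exp (1 / real q + 1 / (real q * (real q - 1))))"
  proof (intro prod_mono conjI)
    fix q assume q: "q \<in> ?Q"
    then have q2: "real q > 2" using assms by auto
    then show "0 \<le> 1 / (1 - 1 / real q)" by (simp add: field_simps)
    have "1 / (1 - 1 / real q) = 1 + (1 / real q + 1 / (real q * (real q - 1)))"
      using q2 by (simp add: field_simps)
    also have "\<dots> \<le> exp (1 / real q + 1 / (real q * (real q - 1)))" by (rule exp_ge_add_one_self)
    finally show "1 / (1 - 1 / real q) \<le> exp (1 / real q + 1 / (real q * (real q - 1)))" .
  qed
  also have "\<dots> = exp ((\<Sum>q\<in>?Q. 1 / real q) + (\<Sum>q\<in>?Q. 1 / (real q * (real q - 1))))"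
    by (simp add: exp_sum sum.distrib[symmetric])
  also have "\<dots> \<le> exp ((5 + 2 * ln (ln (real y) / ln (real z))) + 1)"
  proof (subst exp_le_cancel_iff, intro add_mono sum_inverse_primes_interval_le assms)
    have "(\<Sum>q\<in>?Q. 1 / (real q * (real q - 1))) \<le> (\<Sum>n=2..y. 1 / (real n * (real n - 1)))"
      using assms by (intro sum_mono2) auto
    also have "\<dots> \<le> 1" by (rule sum_inverse_consecutive_le)
    finally show "(\<Sum>q\<in>?Q. 1 / (real q * (real q - 1))) \<le> 1" .
  qed
  also have "\<dots> = exp (6 + (ln (ln (real y) / ln (real z)) + ln (ln (real y) / ln (real z))))"
    by (rule arg_cong[where f = exp]) simp
  also have "\<dots> = exp 6 * (ln (real y) / ln (real z)) ^ 2"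
    using assms by (simp only: exp_add) (simp add: power2_eq_square)
  finally show ?thesis .
qed

lemma sum_inverse_rough_le:
  assumes "2 \<le> z" "z \<le> y" and A: "A \<subseteq> {1..N}" "\<And>n q. n \<in> A \<Longrightarrow> q \<in> prime_factors n \<Longrightarrow> z < q \<and> q \<le> y"
  shows "(\<Sum>n\<in>A. 1 / real n) \<le> exp 6 * (ln (real y) / ln (real z)) ^ 2"
proof -
  let ?Q = "{q. prime q \<and> z < q \<and> q \<le> y}"
  have "A \<subseteq> smooth_upto ?Q N"
    using A by (fastforce simp: smooth_upto_def)
  then have "(\<Sum>n\<in>A. 1 / real n) \<le> (\<Sum>n\<in>smooth_upto ?Q N. 1 / real n)"
    by (intro sum_mono2) auto
  also have "\<dots> \<le> (\<Prod>q\<in>?Q. 1 / (1 - 1 / real q))"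
    using assms by (intro sum_smooth_upto_le_prod) auto
  also have "\<dots> \<le> exp 6 * (ln (real y) / ln (real z)) ^ 2" by (rule prod_rough_primes_le) fact+
  finally show ?thesis .
qed

text \<open>The induction proves the sharper bound 2 - 1 / (1 + ln N), an integral test in
  telescoping form. This convergence is the reason for saving two logarithms in
  \<open>mertens_coprime_saving\<close>.\<close>

lemma sum_inverse_ln_square_le: "(\<Sum>e=1..N. 1 / (real e * (1 + ln (real e)) ^ 2)) \<le> 2"
proof (cases "N \<ge> 1")
  case True
  then have "(\<Sum>e=1..N. 1 / (real e * (1 + ln (real e)) ^ 2)) \<le> 2 - 1 / (1 + ln (real N))"
  proof (induction N rule: dec_induct)
    case (step n)
    define a where "a = 1 + ln (real n)"
    define b where "b = 1 + ln (real (Suc n))"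
    have a: "a \<ge> 1" using step by (simp add: a_def)
    have "ln (real n / real (Suc n)) \<le> real n / real (Suc n) - 1"
      using step by (intro ln_le_minus_one) auto
    also have "\<dots> = - (1 / real (Suc n))" by (simp add: field_simps)
    finally have ab: "1 / real (Suc n) \<le> b - a" using step by (simp add: ln_div a_def b_def)
    then have "a < b" by (smt (verit) divide_pos_pos of_nat_0_less_iff zero_less_Suc)
    have "1 / (real (Suc n) * b ^ 2) = (1 / real (Suc n)) / b ^ 2" by simp
    also have "\<dots> \<le> (b - a) / (a * b)"
      using ab a \<open>a < b\<close> by (intro frac_le) (auto simp: power2_eq_square)
    also have "\<dots> = 1 / a - 1 / b" using a \<open>a < b\<close> by (simp add: field_simps)
    finally have "1 / (real (Suc n) * b ^ 2) \<le> 1 / a - 1 / b" .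
    then show ?case using step by (simp add: a_def b_def)
  qed simp
  also have "\<dots> \<le> 2" using True by simp
  finally show ?thesis .
qed simp

section \<open>Squarefree numbers with exactly i prime factors\<close>

definition sqf_omega :: "nat \<Rightarrow> nat \<Rightarrow> nat set" where
  "sqf_omega i y = {d \<in> {1..y}. squarefree d \<and> omega d = i}"

lemma finite_sqf_omega [simp]: "finite (sqf_omega i y)"
  by (simp add: sqf_omega_def)

lemma squarefree_div_prime:
  assumes "squarefree n" "q \<in> prime_factors n"
  shows "squarefree (n div q)" "omega n = Suc (omega (n div q))" "n = q * (n div q)"
    "\<not> q dvd n div q" "n div q > 0"
proof -
  from assms obtain m where m: "n = q * m" "prime q" by (auto simp: in_prime_factors_iff)
  have q0: "q > 0" using m prime_gt_0_nat by blast
  then have nm: "n div q = m" using m by simp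
  have n0: "n > 0" using assms(1) by (auto intro: Nat.gr0I)
  then have m0: "m > 0" using m by (auto intro: Nat.gr0I)
  show "squarefree (n div q)" unfolding nm using assms(1) m by (auto dest: squarefree_multD)
  show nd: "\<not> q dvd n div q"
  proof
    assume "q dvd n div q"
    then have "moebius_mu n = 0" using m nm moebius_mu_prime_mult_dvd by simp
    then show False using assms(1) by (simp add: moebius_mu_def)
  qed
  then have "coprime q m" using m nm by (simp add: prime_imp_coprime)
  then show "omega n = Suc (omega (n div q))" unfolding nm m(1) using m q0 m0 by (simp add: omega_mult_coprime)
  show "n = q * (n div q)" unfolding nm by (rule m(1))
  show "n div q > 0" using m0 nm by simp
qed

lemma omega_pos: "n \<ge> 2 \<Longrightarrow> omega n \<ge> 1"
  by (auto simp: omega_def Suc_le_eq card_gt_0_iff prime_factorization_empty_iff)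

text \<open>Each number is written as a prime times a number with one prime factor less; counting it
  once for every choice of that prime only enlarges the bound.\<close>

lemma sum_inverse_sqf_omega_le:
  "(\<Sum>d\<in>sqf_omega i y. 1 / real d) \<le> (\<Sum>q | prime q \<and> q \<le> y. 1 / real q) ^ i"
proof (induction i)
  case 0
  have "sqf_omega 0 y \<subseteq> {1}"
  proof
    fix d assume d: "d \<in> sqf_omega 0 y"
    then have "\<not> 2 \<le> d" using omega_pos[of d] by (auto simp: sqf_omega_def)
    then show "d \<in> {1}" using d by (auto simp: sqf_omega_def)
  qed
  then have "(\<Sum>d\<in>sqf_omega 0 y. 1 / real d) \<le> (\<Sum>d\<in>{1}. 1 / real d)" by (intro sum_mono2) auto
  then show ?case by simp
next
  case (Suc i)
  let ?P = "{q. prime q \<and> q \<le> y}"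
  have "(\<Sum>d\<in>sqf_omega (Suc i) y. 1 / real d) \<le> (\<Sum>(q, m)\<in>?P \<times> sqf_omega i y. 1 / real q * (1 / real m))"
  proof (rule sum_le_included[where i = "\<lambda>(q, m). q * m"])
    show "\<forall>d\<in>sqf_omega (Suc i) y. \<exists>w\<in>?P \<times> sqf_omega i y. (case w of (q, m) \<Rightarrow> q * m) = d \<and>
            1 / real d \<le> (case w of (q, m) \<Rightarrow> 1 / real q * (1 / real m))"
    proof
      fix d assume d: "d \<in> sqf_omega (Suc i) y"
      then have "prime_factors d \<noteq> {}" by (auto simp: sqf_omega_def omega_def)
      then obtain q where q: "q \<in> prime_factors d" by blast
      define m where "m = d div q"
      have sq: "squarefree d" using d by (simp add: sqf_omega_def)
      note * = squarefree_div_prime[OF sq q, folded m_def]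
      have pq: "prime q" "q > 0" using q by (auto simp: in_prime_factors_iff prime_gt_0_nat)
      have "q * 1 \<le> q * m" "1 * m \<le> q * m" using *(5) pq by (intro mult_le_mono; simp)+
      moreover have "d \<le> y" using d by (simp add: sqf_omega_def)
      ultimately have "q \<le> y" "m \<le> y" using *(3) by linarith+
      then have "m \<in> sqf_omega i y" "q \<in> ?P" using *(1,2,5) d pq by (auto simp: sqf_omega_def)
      moreover have "1 / real d = 1 / real q * (1 / real m)" using *(3) by simp
      ultimately show "\<exists>w\<in>?P \<times> sqf_omega i y. (case w of (q, m) \<Rightarrow> q * m) = d \<and>
            1 / real d \<le> (case w of (q, m) \<Rightarrow> 1 / real q * (1 / real m))"
        using *(3) by (intro bexI[of _ "(q, m)"]) auto
    qed
  qed auto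
  also have "\<dots> = (\<Sum>q\<in>?P. 1 / real q) * (\<Sum>m\<in>sqf_omega i y. 1 / real m)"
    by (simp add: sum_product sum.cartesian_product)
  also have "\<dots> \<le> (\<Sum>q\<in>?P. 1 / real q) * (\<Sum>q\<in>?P. 1 / real q) ^ i"
    by (intro mult_left_mono Suc sum_nonneg) auto
  finally show ?case by simp
qed

text \<open>An application of \<open>card_mult_ln_le\<close>: removing a prime leaves i - 1 prime
  factors, and both reciprocal sums are bounded by powers of the prime sum. The added 1 makes these
  powers increase with the exponent.\<close>

lemma card_sqf_omega_le:
  assumes "y \<ge> 1"
  shows "real (card (sqf_omega i y)) * ln (real y) \<le> 5 * real y * (1 + (\<Sum>q | prime q \<and> q \<le> y. 1 / real q)) ^ i"
proof -
  define P where "P = (\<Sum>q | prime q \<and> q \<le> y. 1 / real q)"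
  have P: "P \<ge> 0" unfolding P_def by (intro sum_nonneg) auto
  \<comment> \<open>Writing \<open>Suc (omega d) = i\<close> instead of subtracting 1 makes the
    second set empty for \<open>i = 0\<close>, where no prime can be removed.\<close>
  let ?S = "{d. squarefree d \<and> omega d = i}" and ?S' = "{d. squarefree d \<and> Suc (omega d) = i}"
  have S: "?S \<inter> {1..y} = sqf_omega i y" by (auto simp: sqf_omega_def)
  have "real (card (?S \<inter> {1..y})) * ln (real y) \<le>
     real y * (4 * (\<Sum>m\<in>?S' \<inter> {1..y}. 1 / real m) + (\<Sum>n\<in>?S \<inter> {1..y}. 1 / real n))"
    using assms by (intro card_mult_ln_le) (use squarefree_div_prime in auto)
  also have "\<dots> \<le> real y * (4 * (1 + P) ^ i + (1 + P) ^ i)"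
  proof (intro mult_left_mono add_mono)
    show "(\<Sum>m\<in>?S' \<inter> {1..y}. 1 / real m) \<le> (1 + P) ^ i"
    proof (cases i)
      case 0
      then show ?thesis by simp
    next
      case (Suc j)
      then have "?S' \<inter> {1..y} = sqf_omega j y" by (auto simp: sqf_omega_def)
      then have "(\<Sum>m\<in>?S' \<inter> {1..y}. 1 / real m) \<le> P ^ j"
        using sum_inverse_sqf_omega_le[of j y] by (simp add: P_def)
      also have "\<dots> \<le> (1 + P) ^ j" using P by (intro power_mono) auto
      also have "\<dots> \<le> (1 + P) ^ i" using P Suc by (intro power_increasing) auto
      finally show ?thesis .
    qed
    have "(\<Sum>n\<in>?S \<inter> {1..y}. 1 / real n) \<le> P ^ i"
      unfolding S P_def by (rule sum_inverse_sqf_omega_le)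
    also have "\<dots> \<le> (1 + P) ^ i" using P by (intro power_mono) auto
    finally show "(\<Sum>n\<in>?S \<inter> {1..y}. 1 / real n) \<le> (1 + P) ^ i" .
  qed auto
  finally show ?thesis unfolding S P_def by (simp add: mult_ac)
qed

text \<open>A divisor of a squarefree number is determined by its set of primes, which may be any
  subset.\<close>

lemma card_divisors_omega:
  assumes "squarefree m"
  shows "card {d. d dvd m \<and> omega d = i} = omega m choose i"
proof -
  have m0: "m > 0" using assms by (auto intro: Nat.gr0I)
  have "bij_betw prime_factors {d. d dvd m \<and> omega d = i} {B. B \<subseteq> prime_factors m \<and> card B = i}"
  proof (rule bij_betw_byWitness[where f' = "\<lambda>B. \<Prod>B"])
    show "\<forall>d\<in>{d. d dvd m \<and> omega d = i}. \<Prod>(prime_factors d) = d"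
      using assms squarefree_mono prod_prime_factors_squarefree by blast
    have pf: "prime_factors (\<Prod>B) = B" if "B \<subseteq> prime_factors m" for B
    proof -
      have "finite B" using that by (rule finite_subset) simp
      then show ?thesis using that
      proof (induction B rule: finite_induct)
        case (insert x F)
        have pr: "prime x" "\<forall>y\<in>F. prime y" using insert.prems by (auto simp: in_prime_factors_iff)
        have "\<Prod>F > 0" using pr by (intro prod_pos) (auto simp: prime_gt_0_nat)
        then have "prime_factors (x * \<Prod>F) = prime_factors x \<union> prime_factors (\<Prod>F)"
          using pr prime_gt_0_nat[of x] by (intro prime_factors_product) auto
        also have "\<dots> = insert x F" using insert pr by (simp add: prime_factorization_prime)
        finally show ?case using insert by simp
      qed simp
    qed
    then show "\<forall>B\<in>{B. B \<subseteq> prime_factors m \<and> card B = i}. prime_factors (\<Prod>B) = B" by blast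
    show "prime_factors ` {d. d dvd m \<and> omega d = i} \<subseteq> {B. B \<subseteq> prime_factors m \<and> card B = i}"
      using m0 by (auto simp: omega_def in_prime_factors_iff intro: dvd_trans)
    show "(\<lambda>B. \<Prod>B) ` {B. B \<subseteq> prime_factors m \<and> card B = i} \<subseteq> {d. d dvd m \<and> omega d = i}"
    proof clarify
      fix B assume B: "B \<subseteq> prime_factors m" "i = card B"
      have "\<Prod>B dvd m" using B by (intro prod_primes_dvd) (auto intro: finite_subset)
      moreover have "omega (\<Prod>B) = card B" using pf[OF B(1)] by (simp add: omega_def)
      ultimately show "\<Prod>B dvd m \<and> omega (\<Prod>B) = card B" by blast
    qed
  qed
  then have "card {d. d dvd m \<and> omega d = i} = card {B. B \<subseteq> prime_factors m \<and> card B = i}"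
    by (rule bij_betw_same_card)
  also have "\<dots> = omega m choose i" unfolding omega_def by (rule n_subsets) simp
  finally show ?thesis .
qed

section \<open>Splitting off the least prime factor\<close>

definition rough :: "nat \<Rightarrow> nat \<Rightarrow> bool" where
  "rough p m \<longleftrightarrow> (\<forall>q. prime q \<longrightarrow> q dvd m \<longrightarrow> p < q)"

lemma least_prime_factor_prime_mult:
  assumes "prime p" "m > 0" "rough p m"
  shows "least_prime_factor (p * m) = p"
  unfolding least_prime_factor_def
proof (rule Min_eqI)
  have p0: "p > 0" using assms prime_gt_0_nat by blast
  show "p \<in> prime_factors (p * m)" using assms p0 by (auto simp: in_prime_factors_iff)
  fix q assume "q \<in> prime_factors (p * m)"
  then have q: "prime q" "q dvd p \<or> q dvd m" by (auto simp: in_prime_factors_iff prime_dvd_mult_iff)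
  then have "q = p \<or> p < q" using assms primes_dvd_imp_eq[of q p] by (auto simp: rough_def)
  then show "p \<le> q" by auto
qed simp

lemma least_prime_factor_decompose:
  assumes "n \<ge> 2" "squarefree n" "least_prime_factor n = p"
  shows "prime p" "p dvd n" "rough p (n div p)" "squarefree (n div p)"
proof -
  have ne: "prime_factors n \<noteq> {}" using assms(1) by (auto simp: prime_factorization_empty_iff)
  then have p: "p \<in> prime_factors n"
    using Min_in[of "prime_factors n"] assms(3) by (auto simp: least_prime_factor_def)
  then show "prime p" "p dvd n" by (auto simp: in_prime_factors_iff)
  note * = squarefree_div_prime[OF assms(2) p]
  show "squarefree (n div p)" by (rule *(1))
  show "rough p (n div p)" unfolding rough_def
  proof (intro allI impI)
    fix q assume q: "prime q" "q dvd n div p"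
    then have "q \<in> prime_factors n" using *(3) assms(1) by (metis dvd_mult in_prime_factors_iff not_numeral_le_zero)
    then have "p \<le> q" using assms(3) by (auto simp: least_prime_factor_def)
    moreover have "p \<noteq> q" using *(4) q by auto
    ultimately show "p < q" by simp
  qed
qed

definition avoid :: "nat \<Rightarrow> nat \<Rightarrow> nat set" where
  "avoid p d = {q. prime q \<and> q \<le> p} \<union> prime_factors d"

lemma avoid_iff:
  assumes "d > 0"
  shows "(\<forall>q\<in>avoid p d. \<not> q dvd e) \<longleftrightarrow> rough p e \<and> (\<forall>q. prime q \<longrightarrow> q dvd d \<longrightarrow> \<not> q dvd e)"
  using assms by (auto simp: avoid_def rough_def in_prime_factors_iff not_le)

lemma coprime_iff_no_prime:
  "coprime d (e::nat) \<longleftrightarrow> (\<forall>q. prime q \<longrightarrow> q dvd d \<longrightarrow> \<not> q dvd e)"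
proof (intro iffI allI impI notI)
  fix q assume "coprime d e" "prime q" "q dvd d" "q dvd e"
  then show False using coprime_common_divisor[of d e q] not_prime_unit[of q] by blast
next
  assume no: "\<forall>q. prime q \<longrightarrow> q dvd d \<longrightarrow> \<not> q dvd e"
  show "coprime d e"
  proof (rule ccontr)
    assume "\<not> coprime d e"
    then have "gcd d e \<noteq> 1" using coprime_iff_gcd_eq_1[of d e] by blast
    then obtain q where q: "prime q" "q dvd gcd d e" using prime_factor_nat[of "gcd d e"] by blast
    have "q dvd d" "q dvd e" using dvd_trans[OF q(2) gcd_dvd1] dvd_trans[OF q(2) gcd_dvd2] by blast+
    then show False using no q(1) by blast
  qed
qed

text \<open>Since \<open>m = d * e\<close> is squarefree, \<open>d\<close> and \<open>e\<close> are
  coprime, and this is expressed as a condition on \<open>e\<close> alone once \<open>d\<close> is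
  fixed: it avoids the primes of \<open>d\<close>. The sum over \<open>e\<close> can then be taken
  as the inner one; its terms with non-squarefree \<open>e\<close> vanish.\<close>

lemma sum_moebius_binomial_rough:
  "(\<Sum>m | m \<in> {1..Y} \<and> squarefree m \<and> rough p m. of_int (moebius_mu m) * real (omega m choose i)) =
   (\<Sum>d | d \<in> sqf_omega i Y \<and> rough p d. of_int (moebius_mu d) * mertens_coprime (avoid p d) (Y div d))"
proof -
  let ?M = "{m. m \<in> {1..Y} \<and> squarefree m \<and> rough p m}"
  let ?D = "{d. d \<in> sqf_omega i Y \<and> rough p d}"
  let ?E = "\<lambda>d. {e. e \<in> {1..Y div d} \<and> squarefree e \<and> (\<forall>q\<in>avoid p d. \<not> q dvd e)}"
  have finM: "finite ?M" by (rule finite_subset[of _ "{1..Y}"]) auto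
  have finD: "finite ?D" by (rule finite_subset[of _ "{1..Y}"]) (auto simp: sqf_omega_def)
  have finE: "finite (?E d)" for d by (rule finite_subset[of _ "{1..Y div d}"]) auto
  have "(\<Sum>m\<in>?M. of_int (moebius_mu m) * real (omega m choose i)) =
        (\<Sum>m\<in>?M. \<Sum>d | d dvd m \<and> omega d = i. of_int (moebius_mu m))"
    by (intro sum.cong refl) (auto simp: card_divisors_omega)
  also have "\<dots> = (\<Sum>(m, d)\<in>Sigma ?M (\<lambda>m. {d. d dvd m \<and> omega d = i}). of_int (moebius_mu m))"
    using finM by (intro sum.Sigma) auto
  also have "\<dots> = (\<Sum>(d, e)\<in>Sigma ?D ?E. of_int (moebius_mu d) * of_int (moebius_mu e))"
  proof (rule sum.reindex_bij_witness[where i = "\<lambda>(d, e). (d * e, d)" and j = "\<lambda>(m, d). (d, m div d)"])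
    fix z assume "z \<in> Sigma ?M (\<lambda>m. {d. d dvd m \<and> omega d = i})"
    then obtain m d where z: "z = (m, d)" and m: "m \<in> ?M" and d: "d dvd m" "omega d = i" by auto
    from d obtain e where e: "m = d * e" by auto
    have m0: "m > 0" using m by auto
    then have d0: "d > 0" and e0: "e > 0" using e by (auto intro: Nat.gr0I)
    have sq: "squarefree d" "squarefree e" using m e by (auto dest: squarefree_multD)
    have cop: "coprime d e" unfolding coprime_iff_no_prime
    proof (intro allI impI notI)
      fix q assume q: "prime q" "q dvd d" "q dvd e"
      then have "q * q dvd m" unfolding e by (intro mult_dvd_mono)
      then have "q dvd 1" using m by (intro squarefreeD[of m q]) (auto simp: power2_eq_square)
      then show False using q by simp
    qed
    have "d * 1 \<le> d * e" using e0 by (intro mult_le_mono2) simp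
    moreover have "d * e \<le> Y" using m e by simp
    ultimately have "d \<le> Y" by linarith
    moreover have "rough p d" "rough p e" using m e by (auto simp: rough_def)
    moreover have "e \<le> Y div d" using m e d0 by (auto simp: less_eq_div_iff_mult_less_eq mult.commute)
    ultimately have "(d, e) \<in> Sigma ?D ?E"
      using sq d d0 e0 cop by (auto simp: sqf_omega_def avoid_iff[OF d0] coprime_iff_no_prime simp del: One_nat_def)
    then show "(case z of (m, d) \<Rightarrow> (d, m div d)) \<in> Sigma ?D ?E" using z e d0 by simp
    show "(case (case z of (m, d) \<Rightarrow> (d, m div d)) of (d, e) \<Rightarrow> (d * e, d)) = z" using z e d0 by simp
    show "(case (case z of (m, d) \<Rightarrow> (d, m div d)) of (d, e) \<Rightarrow> of_int (moebius_mu d) * of_int (moebius_mu e))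
           = (case z of (m, d) \<Rightarrow> real_of_int (moebius_mu m))"
      using z e d0 moebius_mu_mult_coprime[OF cop] by simp
  next
    fix z assume "z \<in> Sigma ?D ?E"
    then obtain d e where z: "z = (d, e)" and d: "d \<in> sqf_omega i Y" "rough p d" and e: "e \<in> ?E d" by auto
    have d0: "d > 0" using d by (auto simp: sqf_omega_def)
    have cop: "coprime d e" and re: "rough p e"
      using e unfolding coprime_iff_no_prime by (auto simp: avoid_iff[OF d0])
    have "d * e \<le> Y" using e d0 by (auto simp: less_eq_div_iff_mult_less_eq mult.commute)
    then have "d * e \<in> ?M"
      using d e d0 re cop by (auto simp: sqf_omega_def squarefree_mult_coprime rough_def prime_dvd_mult_iff Suc_le_eq)
    then show "(case z of (d, e) \<Rightarrow> (d * e, d)) \<in> Sigma ?M (\<lambda>m. {d. d dvd m \<and> omega d = i})"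
      using z d by (auto simp: sqf_omega_def)
    show "(case (case z of (d, e) \<Rightarrow> (d * e, d)) of (m, d) \<Rightarrow> (d, m div d)) = z" using z d0 by simp
  qed
  also have "\<dots> = (\<Sum>d\<in>?D. \<Sum>e\<in>?E d. of_int (moebius_mu d) * of_int (moebius_mu e))"
    using finD finE by (intro sum.Sigma[symmetric]) auto
  also have "\<dots> = (\<Sum>d\<in>?D. of_int (moebius_mu d) * mertens_coprime (avoid p d) (Y div d))"
  proof (intro sum.cong refl)
    fix d assume "d \<in> ?D"
    have "mertens_coprime (avoid p d) (Y div d) = (\<Sum>e\<in>?E d. of_int (moebius_mu e))"
      unfolding mertens_coprime_def
      by (rule sum.mono_neutral_right)
         (auto simp: moebius_mu_def intro: finite_subset[of _ "{1..Y div d}"])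
    then show "(\<Sum>e\<in>?E d. of_int (moebius_mu d) * of_int (moebius_mu e)) =
        of_int (moebius_mu d) * mertens_coprime (avoid p d) (Y div d)"
      by (simp add: sum_distrib_left)
  qed
  finally show ?thesis .
qed

text \<open>With n = p * m the number omega n - 1 becomes omega m, which is why the binomial weights
  are taken in omega n - 1. Non-squarefree n vanish, and once absolute values are taken the sum over
  rough \<open>d\<close> may be enlarged to all of \<open>sqf_omega\<close>.\<close>

lemma abs_sum_moebius_lpf_le:
  assumes p: "prime p"
  shows "\<bar>\<Sum>n | n \<in> {2..X} \<and> least_prime_factor n = p. of_int (moebius_mu n) * real ((omega n - 1) choose i)\<bar>
     \<le> (\<Sum>d\<in>sqf_omega i (X div p). \<bar>mertens_coprime (avoid p d) (X div p div d)\<bar>)"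
proof -
  let ?N = "{n. n \<in> {2..X} \<and> least_prime_factor n = p}"
  let ?M = "{m. m \<in> {1..X div p} \<and> squarefree m \<and> rough p m}"
  let ?g = "\<lambda>n. of_int (moebius_mu n) * real ((omega n - 1) choose i)"
  have p2: "p \<ge> 2" using p by (rule prime_ge_2_nat)
  have ndp: "\<not> p dvd m" if "rough p m" for m using that p by (auto simp: rough_def)
  have "(\<Sum>n\<in>?N. ?g n) = (\<Sum>n\<in>(*) p ` ?M. ?g n)"
  proof (rule sum.mono_neutral_right)
    show "finite ?N" by (rule finite_subset[of _ "{2..X}"]) auto
    show "(*) p ` ?M \<subseteq> ?N"
    proof
      fix n assume "n \<in> (*) p ` ?M"
      then obtain m where m: "n = p * m" "m \<in> ?M" by auto
      have "2 * 1 \<le> p * m" using m p2 by (intro mult_le_mono) auto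
      moreover have "p * m \<le> X" using m p2 by (auto simp: less_eq_div_iff_mult_less_eq mult.commute)
      ultimately show "n \<in> ?N" using m p p2 by (auto simp: least_prime_factor_prime_mult)
    qed
    show "\<forall>n\<in>?N - (*) p ` ?M. ?g n = 0"
    proof
      fix n assume n: "n \<in> ?N - (*) p ` ?M"
      have "\<not> squarefree n"
      proof
        assume sq: "squarefree n"
        note * = least_prime_factor_decompose[of n p]
        have "n = p * (n div p)" using * n sq by simp
        moreover have "n div p \<in> ?M"
        proof -
          have "n div p > 0" using n sq *(2) p2 by (auto simp: div_greater_zero_iff dest!: dvd_imp_le)
          then show ?thesis using n sq * by (auto intro: div_le_mono)
        qed
        ultimately show False using n by blast
      qed
      then show "?g n = 0" by (simp add: moebius_mu_def)
    qed
  qed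
  also have "\<dots> = (\<Sum>m\<in>?M. - (of_int (moebius_mu m) * real (omega m choose i)))"
  proof (subst sum.reindex)
    show "inj_on ((*) p) ?M" using p2 by (auto simp: inj_on_def)
    show "sum (?g \<circ> (*) p) ?M = (\<Sum>m\<in>?M. - (of_int (moebius_mu m) * real (omega m choose i)))"
    proof (intro sum.cong refl)
      fix m assume m: "m \<in> ?M"
      have "\<not> p dvd m" using m ndp by auto
      then have "coprime p m" using p by (simp add: prime_imp_coprime)
      then have "omega (p * m) = Suc (omega m)" using m p2 p by (simp add: omega_mult_coprime)
      then show "(?g \<circ> (*) p) m = - (of_int (moebius_mu m) * real (omega m choose i))"
        using \<open>\<not> p dvd m\<close> p by (simp add: moebius_mu_prime_mult)
    qed
  qed
  also have "\<dots> = - (\<Sum>d | d \<in> sqf_omega i (X div p) \<and> rough p d. of_int (moebius_mu d) * mertens_coprime (avoid p d) (X div p div d))"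
    unfolding sum_negf sum_moebius_binomial_rough ..
  finally have "\<bar>\<Sum>n\<in>?N. ?g n\<bar> \<le> (\<Sum>d | d \<in> sqf_omega i (X div p) \<and> rough p d. \<bar>of_int (moebius_mu d) * mertens_coprime (avoid p d) (X div p div d)\<bar>)"
    by (simp only: abs_minus_cancel sum_abs)
  also have "\<dots> \<le> (\<Sum>d | d \<in> sqf_omega i (X div p) \<and> rough p d. \<bar>mertens_coprime (avoid p d) (X div p div d)\<bar>)"
  proof (intro sum_mono)
    fix d
    have "\<bar>real_of_int (moebius_mu d)\<bar> \<le> 1" using abs_moebius_mu_le[of d] by linarith
    then show "\<bar>of_int (moebius_mu d) * mertens_coprime (avoid p d) (X div p div d)\<bar> \<le> \<bar>mertens_coprime (avoid p d) (X div p div d)\<bar>"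
      unfolding abs_mult by (intro mult_left_le_one_le) auto
  qed
  also have "\<dots> \<le> (\<Sum>d\<in>sqf_omega i (X div p). \<bar>mertens_coprime (avoid p d) (X div p div d)\<bar>)"
    by (intro sum_mono2) auto
  finally show ?thesis .
qed

section \<open>Sums over the least prime factor\<close>

text \<open>Meant for a majorant \<open>c\<close> that does not depend on \<open>d\<close>: after
  the exchange, the scarcity of the numbers \<open>d\<close> up to Y div e is available for each
  \<open>e\<close>.\<close>

lemma sum_sqf_omega_swap:
  "(\<Sum>d\<in>sqf_omega i Y. \<Sum>e=1..Y div d. c e) = (\<Sum>e=1..Y. c e * real (card (sqf_omega i (Y div e))))"
proof -
  have "(\<Sum>d\<in>sqf_omega i Y. \<Sum>e=1..Y div d. c e) = (\<Sum>(d, e)\<in>Sigma (sqf_omega i Y) (\<lambda>d. {1..Y div d}). c e)"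
    by (intro sum.Sigma) auto
  also have "\<dots> = (\<Sum>(e, d)\<in>Sigma {1..Y} (\<lambda>e. sqf_omega i (Y div e)). c e)"
  proof (rule sum.reindex_bij_witness[where i = "\<lambda>(e, d). (d, e)" and j = "\<lambda>(d, e). (e, d)"])
    fix z assume "z \<in> Sigma (sqf_omega i Y) (\<lambda>d. {1..Y div d})"
    then obtain d e where z: "z = (d, e)" "d \<in> sqf_omega i Y" "1 \<le> e" "e \<le> Y div d" by auto
    have d0: "d > 0" using z by (auto simp: sqf_omega_def)
    have de: "d * e \<le> Y" using z d0 by (simp add: less_eq_div_iff_mult_less_eq mult.commute)
    moreover have "1 * e \<le> d * e" using d0 by (intro mult_le_mono) auto
    ultimately have "e \<le> Y" by linarith
    moreover have "d \<le> Y div e" using de z by (simp add: less_eq_div_iff_mult_less_eq)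
    ultimately show "(case z of (d, e) \<Rightarrow> (e, d)) \<in> Sigma {1..Y} (\<lambda>e. sqf_omega i (Y div e))"
      using z by (auto simp: sqf_omega_def)
  next
    fix z assume "z \<in> Sigma {1..Y} (\<lambda>e. sqf_omega i (Y div e))"
    then obtain e d where z: "z = (e, d)" "1 \<le> e" "d \<in> sqf_omega i (Y div e)" by auto
    have d0: "d > 0" "d \<le> Y div e" using z by (auto simp: sqf_omega_def)
    have de: "d * e \<le> Y" using z d0 by (simp add: less_eq_div_iff_mult_less_eq)
    moreover have "d * 1 \<le> d * e" using z by (intro mult_le_mono) auto
    ultimately have "d \<le> Y" by linarith
    moreover have "e \<le> Y div d" using de d0 by (simp add: less_eq_div_iff_mult_less_eq mult.commute)
    ultimately show "(case z of (e, d) \<Rightarrow> (d, e)) \<in> Sigma (sqf_omega i Y) (\<lambda>d. {1..Y div d})"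
      using z by (auto simp: sqf_omega_def)
  qed auto
  also have "\<dots> = (\<Sum>e=1..Y. \<Sum>d\<in>sqf_omega i (Y div e). c e)"
    by (intro sum.Sigma[symmetric]) auto
  finally show ?thesis by (simp add: mult.commute)
qed

text \<open>Each inner Moebius sum is majorised by a sum over \<open>e\<close> of a weight
  \<open>c e\<close> independent of \<open>d\<close>, and the order of summation is exchanged. For
  \<open>e\<close> up to about sqrt x the number of admissible \<open>d\<close> is of order (x / (p
  * e)) * L^i / ln x, and the sum of c e / e is O(L^2) by the sieve for rough \<open>e\<close> and
  by \<open>sum_inverse_ln_square_le\<close>.\<close>

lemma sum_mertens_coprime_small_prime:
  "\<exists>K>0. \<forall>x p. x > 1 \<longrightarrow> ln (ln x) \<ge> 1 \<longrightarrow> ln x \<ge> 8 \<longrightarrow> prime p \<longrightarrow> 400 * ln (ln x) * ln (real p) \<le> ln x \<longrightarrow>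
     (\<Sum>d\<in>sqf_omega i (nat \<lfloor>x\<rfloor> div p). \<bar>mertens_coprime (avoid p d) (nat \<lfloor>x\<rfloor> div p div d)\<bar>)
       \<le> K * (x / real p) * ln (ln x) ^ (i + 2) / ln x"
proof -
  obtain C where C: "C > 0" "\<And>x p D u. x > 1 \<Longrightarrow> ln (ln x) \<ge> 1 \<Longrightarrow> prime p \<Longrightarrow> finite D \<Longrightarrow> (\<forall>q\<in>D. prime q) \<Longrightarrow>
     card D \<le> i \<Longrightarrow> real u \<le> x \<Longrightarrow> 100 * ln (ln x) * ln (real p) \<le> ln (real u) \<Longrightarrow>
     \<bar>mertens_coprime ({q. prime q \<and> q \<le> p} \<union> D) u\<bar> \<le> C * real u / (1 + ln (real u)) ^ 2"
    using mertens_coprime_saving[of i] by blast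
  define K where "K = 10 ^ i * (20 * (exp 6 * 10000 + 2 * C) + 4 * C)"
  have "(\<Sum>d\<in>sqf_omega i (nat \<lfloor>x\<rfloor> div p). \<bar>mertens_coprime (avoid p d) (nat \<lfloor>x\<rfloor> div p div d)\<bar>)
       \<le> K * (x / real p) * ln (ln x) ^ (i + 2) / ln x"
    if x1: "x > 1" and Lx: "ln (ln x) \<ge> 1" and x8: "ln x \<ge> 8" and p: "prime p"
      and small: "400 * ln (ln x) * ln (real p) \<le> ln x" for x p
  proof -
    define L where "L = ln (ln x)"
    define lx where "lx = ln x"
    define lp where "lp = ln (real p)"
    define R where "R = 100 * L"
    define X where "X = nat \<lfloor>x\<rfloor>"
    define Y where "Y = X div p"
    have L: "L \<ge> 1" "R \<ge> 100" using Lx by (auto simp: L_def R_def)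
    have lx: "lx \<ge> 8" using x8 by (simp add: lx_def)
    have p2: "p \<ge> 2" using p by (rule prime_ge_2_nat)
    have lp: "lp > 0" using p2 by (simp add: lp_def)
    \<comment> \<open>As 400 is four times 100, p powr R is at most x powr (1/4).\<close>
    have Rlp: "4 * (R * lp) \<le> lx" using small by (simp add: R_def L_def lp_def lx_def)
    have Xx: "real X \<le> x" "x < real X + 1" using x1 unfolding X_def by linarith+
    have Yx: "real Y \<le> x / real p"
      using real_div_le[of X p] Xx(1) divide_right_mono[of "real X" x "real p"] unfolding Y_def by linarith
    have YX: "Y \<le> X" by (simp add: Y_def)
    \<comment> \<open>The first part counts rough \<open>e\<close> up to p powr R and is used when
      the range u is that short. Otherwise the saving C * u / (1 + ln u)^2 is spread over the e up
      to u; the terms of the second part decrease in e, so their sum dominates it.\<close>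
    define c where "c = (\<lambda>e. (if rough p e \<and> ln (real e) \<le> R * lp then 1 else 0) + C / (1 + ln (real e)) ^ 2)"
    have c0: "c e \<ge> 0" for e using C(1) by (auto simp: c_def)
    have P: "(\<Sum>q | prime q \<and> q \<le> y. 1 / real q) \<le> 10 * L - 1" if "y \<le> X" for y
    proof -
      have "real y \<le> x" using that Xx by linarith
      then have "(\<Sum>q | prime q \<and> q \<le> y. 1 / real q) \<le> 7 + 2 * L"
        unfolding L_def using x1 Lx by (rule sum_inverse_primes_upto_le)
      then show ?thesis using L by linarith
    qed
    have P0: "(\<Sum>q | prime q \<and> q \<le> y. 1 / real q) \<ge> 0" for y by (intro sum_nonneg) auto
    have "(\<Sum>d\<in>sqf_omega i Y. \<bar>mertens_coprime (avoid p d) (Y div d)\<bar>) \<le> (\<Sum>d\<in>sqf_omega i Y. \<Sum>e=1..Y div d. c e)"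
    proof (intro sum_mono)
      fix d assume d: "d \<in> sqf_omega i Y"
      define u where "u = Y div d"
      have d0: "d > 0" and di: "card (prime_factors d) = i" using d by (auto simp: sqf_omega_def omega_def)
      have "u \<le> X" using YX unfolding u_def by (meson div_le_dividend le_trans)
      then have ux: "real u \<le> x" using Xx by linarith
      show "\<bar>mertens_coprime (avoid p d) (Y div d)\<bar> \<le> (\<Sum>e=1..Y div d. c e)" unfolding u_def[symmetric]
      proof (cases "R * lp \<le> ln (real u)")
        case True
        then have "\<bar>mertens_coprime (avoid p d) u\<bar> \<le> C * real u / (1 + ln (real u)) ^ 2"
          unfolding avoid_def using di p x1 Lx ux
          by (intro C(2)) (auto simp: R_def L_def lp_def in_prime_factors_iff)
        also have "\<dots> = (\<Sum>e=1..u. C / (1 + ln (real u)) ^ 2)" by simp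
        also have "\<dots> \<le> (\<Sum>e=1..u. c e)"
        proof (intro sum_mono)
          fix e assume e: "e \<in> {1..u}"
          have "C / (1 + ln (real u)) ^ 2 \<le> C / (1 + ln (real e)) ^ 2"
            using e C(1) by (intro divide_left_mono power_mono mult_pos_pos zero_less_power) (auto simp: add_pos_nonneg)
          then show "C / (1 + ln (real u)) ^ 2 \<le> c e" unfolding c_def by auto
        qed
        finally show "\<bar>mertens_coprime (avoid p d) u\<bar> \<le> (\<Sum>e=1..u. c e)" .
      next
        case False
        let ?E = "{e. e \<in> {1..u} \<and> (\<forall>q\<in>avoid p d. \<not> q dvd e)}"
        have "\<bar>mertens_coprime (avoid p d) u\<bar> \<le> (\<Sum>e\<in>?E. c e)"
          unfolding mertens_coprime_def
        proof (intro sum_abs[THEN order_trans] sum_mono)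
          fix e assume e: "e \<in> ?E"
          have "\<bar>real_of_int (moebius_mu e)\<bar> \<le> 1" using abs_moebius_mu_le[of e] by linarith
          moreover have "ln (real e) \<le> ln (real u)" using e by simp
          then have "ln (real e) \<le> R * lp" using False by linarith
          then have "1 \<le> c e" using e C(1) by (auto simp: c_def avoid_iff[OF d0])
          ultimately show "\<bar>real_of_int (moebius_mu e)\<bar> \<le> c e" by linarith
        qed
        also have "\<dots> \<le> (\<Sum>e=1..u. c e)" by (intro sum_mono2 c0) auto
        finally show "\<bar>mertens_coprime (avoid p d) u\<bar> \<le> (\<Sum>e=1..u. c e)" .
      qed
    qed
    also have "\<dots> = (\<Sum>e=1..Y. c e * real (card (sqf_omega i (Y div e))))"
      by (rule sum_sqf_omega_swap)
    also have "\<dots> \<le> (\<Sum>e=1..Y. 20 * (x / real p) * (10 * L) ^ i / lx * (c e / real e) +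
                         4 * C / lx ^ 2 * real (card (sqf_omega i (Y div e))))"
    proof (intro sum_mono)
      fix e assume e: "e \<in> {1..Y}"
      define N where "N = real (card (sqf_omega i (Y div e)))"
      have N0: "N \<ge> 0" by (simp add: N_def)
      have e0: "e > 0" using e by simp
      have A0: "0 \<le> 20 * (x / real p) * (10 * L) ^ i / lx * (c e / real e)" using x1 L lx c0[of e] by simp
      have B0: "0 \<le> 4 * C / lx ^ 2 * N" using C(1) N0 by simp
      show "c e * N \<le> 20 * (x / real p) * (10 * L) ^ i / lx * (c e / real e) + 4 * C / lx ^ 2 * N"
      \<comment> \<open>For \<open>e\<close> up to sqrt X the quotient Y div e is at least x powr
        (1/4), so its logarithm is comparable with ln x; \<open>lx >= 8\<close> absorbs the
        rounding. For larger \<open>e\<close>, which lie beyond p powr R, the first part of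
        \<open>c e\<close> vanishes and the second is O(1 / lx^2), so the trivial count
        suffices.\<close>
      proof (cases "e * e \<le> X")
        case True
        define y where "y = Y div e"
        have y1: "y \<ge> 1" using e e0 by (simp add: y_def div_greater_zero_iff Suc_le_eq)
        have yX: "y \<le> X" using YX unfolding y_def by (meson div_le_dividend le_trans)
        have "y = X div (p * e)" by (simp add: y_def Y_def div_mult2_eq)
        then have "X < (y + 1) * (p * e)" using dividend_less_div_times[of "p * e" X] e0 p2 by (simp add: add.commute)
        then have "X + 1 \<le> (y + 1) * (p * e)" by simp
        then have "real (X + 1) \<le> real ((y + 1) * (p * e))" by (simp only: of_nat_le_iff)
        then have "x \<le> (real y + 1) * (real p * real e)" using Xx unfolding of_nat_mult of_nat_add of_nat_1 by linarith
        also have "\<dots> \<le> (2 * real y) * (real p * real e)" using y1 by (intro mult_right_mono) auto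
        finally have "ln x \<le> ln ((2 * real y) * (real p * real e))" using x1 by (intro ln_mono) auto
        also have "\<dots> = ln 2 + ln (real y) + (lp + ln (real e))"
          using y1 p2 e0 by (simp add: ln_mult lp_def)
        finally have 1: "lx \<le> ln 2 + ln (real y) + (lp + ln (real e))" by (simp add: lx_def)
        have "real (e * e) \<le> real X" using True by (simp only: of_nat_le_iff)
        then have "real e * real e \<le> x" using Xx by simp
        then have "ln (real e * real e) \<le> ln x" using e0 by (intro ln_mono) auto
        then have 2: "2 * ln (real e) \<le> lx" using e0 by (simp add: ln_mult lx_def)
        have "100 * lp \<le> R * lp" using L lp by (intro mult_right_mono) auto
        then have 3: "400 * lp \<le> lx" using Rlp by linarith
        have ly: "lx / 4 \<le> ln (real y)" using 1 2 3 lx ln_2_less_1 by linarith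
        have "N * (lx / 4) \<le> N * ln (real y)" using N0 ly by (intro mult_left_mono) auto
        also have "\<dots> \<le> 5 * real y * (1 + (\<Sum>q | prime q \<and> q \<le> y. 1 / real q)) ^ i"
          unfolding N_def y_def[symmetric] by (rule card_sqf_omega_le[OF y1])
        also have "\<dots> \<le> 5 * ((x / real p) / real e) * (10 * L) ^ i"
        proof (intro mult_mono power_mono)
          have "real y \<le> real Y / real e" unfolding y_def by (rule real_div_le)
          also have "\<dots> \<le> (x / real p) / real e" using Yx by (intro divide_right_mono) auto
          finally show "real y \<le> (x / real p) / real e" .
          show "1 + (\<Sum>q | prime q \<and> q \<le> y. 1 / real q) \<le> 10 * L" using P[OF yX] by simp
        qed (use x1 L P0[of y] in auto)
        finally have "N \<le> 20 * (x / real p) * (10 * L) ^ i / lx * (1 / real e)"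
          using lx e0 p2 by (simp add: field_simps)
        then have "c e * N \<le> c e * (20 * (x / real p) * (10 * L) ^ i / lx * (1 / real e))"
          by (rule mult_left_mono) (rule c0)
        also have "\<dots> = 20 * (x / real p) * (10 * L) ^ i / lx * (c e / real e)" by simp
        finally show ?thesis using B0 by linarith
      next
        case False
        then have "X + 1 \<le> e * e" by simp
        then have "real (X + 1) \<le> real (e * e)" by (simp only: of_nat_le_iff)
        then have "x \<le> real e * real e" using Xx unfolding of_nat_mult of_nat_add of_nat_1 by linarith
        then have "ln x \<le> ln (real e * real e)" using x1 by (intro ln_mono) auto
        then have le: "lx / 2 \<le> ln (real e)" using e0 by (simp add: ln_mult lx_def)
        then have "\<not> ln (real e) \<le> R * lp" using Rlp lx by linarith
        then have "c e = C / (1 + ln (real e)) ^ 2" by (simp add: c_def)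
        also have "\<dots> \<le> C / (lx / 2) ^ 2"
          using le lx C(1) by (intro divide_left_mono power_mono mult_pos_pos zero_less_power) auto
        also have "\<dots> = 4 * C / lx ^ 2" by (simp add: power_divide)
        finally have "c e * N \<le> 4 * C / lx ^ 2 * N" using N0 by (rule mult_right_mono)
        then show ?thesis using A0 by linarith
      qed
    qed
    also have "\<dots> = 20 * (x / real p) * (10 * L) ^ i / lx * (\<Sum>e=1..Y. c e / real e) +
                    4 * C / lx ^ 2 * (\<Sum>e=1..Y. 1 * real (card (sqf_omega i (Y div e))))"
      by (simp add: sum.distrib sum_distrib_left)
    also have "\<dots> \<le> 20 * (x / real p) * (10 * L) ^ i / lx * (exp 6 * R ^ 2 + 2 * C) +
                    4 * C / lx ^ 2 * ((x / real p) * (10 * L) ^ i)"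
    proof (intro add_mono mult_left_mono)
      let ?A = "{e \<in> {1..Y}. rough p e \<and> ln (real e) \<le> R * lp}"
      have "(\<Sum>e=1..Y. c e / real e) = (\<Sum>e=1..Y. (if rough p e \<and> ln (real e) \<le> R * lp then 1 / real e else 0)) +
           C * (\<Sum>e=1..Y. 1 / (real e * (1 + ln (real e)) ^ 2))"
        unfolding sum_distrib_left sum.distrib[symmetric] by (intro sum.cong refl) (simp add: c_def add_divide_distrib mult.commute)
      also have "(\<Sum>e=1..Y. (if rough p e \<and> ln (real e) \<le> R * lp then 1 / real e else 0)) = (\<Sum>e\<in>?A. 1 / real e)"
        by (intro sum.mono_neutral_cong_right) auto
      also have "\<dots> \<le> exp 6 * R ^ 2"
      proof -
        \<comment> \<open>The sieved range runs from p to p powr R, so the ratio of the logarithms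
          is at most R whatever \<open>p\<close> is.\<close>
        define y where "y = nat \<lfloor>real p powr R\<rfloor>"
        have pR: "real p powr R = exp (R * lp)" using p2 by (simp add: powr_def lp_def)
        have "real p powr 1 \<le> real p powr R" using p2 L by (intro powr_mono) auto
        then have py: "p \<le> y" using p2 unfolding y_def by (simp add: le_nat_floor)
        have "real y \<le> exp (R * lp)" unfolding y_def pR by simp
        then have "ln (real y) \<le> ln (exp (R * lp))" using py p2 by (intro ln_mono) auto
        then have "ln (real y) \<le> R * lp" by simp
        then have "ln (real y) / lp \<le> R" using lp by (simp add: field_simps)
        moreover have "0 \<le> ln (real y) / lp" using py p2 lp by simp
        ultimately have "(ln (real y) / lp) ^ 2 \<le> R ^ 2" by (intro power_mono)
        moreover have "(\<Sum>e\<in>?A. 1 / real e) \<le> exp 6 * (ln (real y) / ln (real p)) ^ 2"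
        proof (rule sum_inverse_rough_le[OF p2 py, of _ Y])
          fix n q assume n: "n \<in> ?A" and q: "q \<in> prime_factors n"
          have "p < q" using n q by (auto simp: rough_def in_prime_factors_iff)
          moreover have "q \<le> n" using n q by (auto simp: in_prime_factors_iff dest: dvd_imp_le)
          moreover have "real n \<le> real p powr R"
          proof -
            have "ln (real n) \<le> R * lp" "real n > 0" using n by auto
            then have "exp (ln (real n)) \<le> exp (R * lp)" by (subst exp_le_cancel_iff)
            then show ?thesis using \<open>real n > 0\<close> by (simp add: pR)
          qed
          then have "n \<le> y" unfolding y_def by (rule le_nat_floor)
          ultimately show "p < q \<and> q \<le> y" by simp
        qed auto
        ultimately show ?thesis unfolding lp_def[symmetric]
          by (meson exp_ge_zero mult_left_mono order_trans)
      qed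
      also have "C * (\<Sum>e=1..Y. 1 / (real e * (1 + ln (real e)) ^ 2)) \<le> C * 2"
        using C(1) by (intro mult_left_mono sum_inverse_ln_square_le) auto
      finally show "(\<Sum>e=1..Y. c e / real e) \<le> exp 6 * R ^ 2 + 2 * C" by simp
    next
      have "(\<Sum>e=1..Y. 1 * real (card (sqf_omega i (Y div e)))) = (\<Sum>d\<in>sqf_omega i Y. \<Sum>e=1..Y div d. 1)"
        by (rule sum_sqf_omega_swap[symmetric])
      also have "\<dots> = (\<Sum>d\<in>sqf_omega i Y. real (Y div d))" by simp
      also have "\<dots> \<le> (\<Sum>d\<in>sqf_omega i Y. (x / real p) * (1 / real d))"
      proof (intro sum_mono)
        fix d
        have "real (Y div d) \<le> real Y / real d" by (rule real_div_le)
        also have "\<dots> \<le> (x / real p) / real d" using Yx by (intro divide_right_mono) auto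
        finally show "real (Y div d) \<le> (x / real p) * (1 / real d)" by simp
      qed
      also have "\<dots> = (x / real p) * (\<Sum>d\<in>sqf_omega i Y. 1 / real d)" by (simp only: sum_distrib_left)
      also have "\<dots> \<le> (x / real p) * (10 * L) ^ i"
      proof (intro mult_left_mono)
        have "(\<Sum>d\<in>sqf_omega i Y. 1 / real d) \<le> (\<Sum>q | prime q \<and> q \<le> Y. 1 / real q) ^ i"
          by (rule sum_inverse_sqf_omega_le)
        also have "\<dots> \<le> (10 * L) ^ i" using P[OF YX] P0[of Y] by (intro power_mono) auto
        finally show "(\<Sum>d\<in>sqf_omega i Y. 1 / real d) \<le> (10 * L) ^ i" .
      qed (use x1 in simp)
      finally show "(\<Sum>e=1..Y. 1 * real (card (sqf_omega i (Y div e)))) \<le> (x / real p) * (10 * L) ^ i" .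
    qed (use x1 L lx C(1) in auto)
    also have "\<dots> = ((x / real p) * (10 * L) ^ i / lx) * (20 * (exp 6 * R ^ 2 + 2 * C) + 4 * C / lx)"
    proof -
      have "20 * a * b / lx * s + 4 * C / lx ^ 2 * (a * b) = (a * b / lx) * (20 * s + 4 * C / lx)" for a b s
        using lx by (simp add: power2_eq_square field_simps)
      then show ?thesis .
    qed
    also have "\<dots> \<le> ((x / real p) * (10 * L) ^ i / lx) * ((20 * (exp 6 * 10000 + 2 * C) + 4 * C) * L ^ 2)"
    proof (intro mult_left_mono)
      have L2: "1 \<le> L ^ 2" using L by simp
      have "4 * C / lx \<le> 4 * C / 1" using lx C(1) by (intro divide_left_mono) auto
      also have "\<dots> \<le> 4 * C * L ^ 2" using mult_left_mono[OF L2, of "4 * C"] C(1) by simp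
      finally have "4 * C / lx \<le> 4 * C * L ^ 2" .
      moreover have "2 * C \<le> 2 * C * L ^ 2" using mult_left_mono[OF L2, of "2 * C"] C(1) by simp
      moreover have "exp 6 * R ^ 2 = exp 6 * 10000 * L ^ 2" by (simp add: R_def power_mult_distrib)
      ultimately show "20 * (exp 6 * R ^ 2 + 2 * C) + 4 * C / lx \<le> (20 * (exp 6 * 10000 + 2 * C) + 4 * C) * L ^ 2"
        unfolding distrib_right distrib_left by linarith
    qed (use x1 L lx in auto)
    also have "\<dots> = K * (x / real p) * L ^ (i + 2) / lx"
      by (simp add: K_def power_mult_distrib power_add power2_eq_square mult_ac)
    finally show ?thesis by (simp only: L_def lx_def Y_def X_def)
  qed
  moreover have "K > 0" unfolding K_def using C(1) by (intro mult_pos_pos add_pos_pos) auto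
  ultimately show ?thesis by blast
qed

text \<open>All prime factors exceed x powr (1 / (400 * L)), so omega n is at most 400 * L and the
  weight at most (400 * L)^i. The number of such n is O(x * L^2 / ln x), by the sieve bound for
  their reciprocals and \<open>card_mult_ln_le\<close>.\<close>

lemma sum_rough_binomial_le:
  "\<exists>K>0. \<forall>x. x > 1 \<longrightarrow> ln (ln x) \<ge> 1 \<longrightarrow> 400 * ln (ln x) * ln 4 \<le> ln x \<longrightarrow>
     (\<Sum>n | n \<in> {2..nat \<lfloor>x\<rfloor>} \<and> squarefree n \<and> (\<forall>q\<in>prime_factors n. ln x < 400 * ln (ln x) * ln (real q)).
        real ((omega n - 1) choose i)) \<le> K * x * ln (ln x) ^ (i + 2) / ln x"
proof -
  define K :: real where "K = 10 * exp 6 * 800 ^ 2 * 400 ^ i"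
  have "(\<Sum>n | n \<in> {2..nat \<lfloor>x\<rfloor>} \<and> squarefree n \<and> (\<forall>q\<in>prime_factors n. ln x < 400 * ln (ln x) * ln (real q)).
        real ((omega n - 1) choose i)) \<le> K * x * ln (ln x) ^ (i + 2) / ln x"
    if x1: "x > 1" and Lx: "ln (ln x) \<ge> 1" and big: "400 * ln (ln x) * ln 4 \<le> ln x" for x :: real
  proof -
    define L where "L = ln (ln x)"
    define lx where "lx = ln x"
    define X where "X = nat \<lfloor>x\<rfloor>"
    have L: "L \<ge> 1" using Lx by (simp add: L_def)
    have b1: "400 * L * ln 4 \<le> lx" using big by (simp add: L_def lx_def)
    have "1 * ln 4 \<le> 400 * L * ln 4" using L by (intro mult_right_mono) auto
    then have lx4: "ln 4 \<le> lx" using b1 by linarith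
    moreover have "0 < ln (4::real)" by simp
    moreover have "ln 4 \<le> lx / (400 * L)" using b1 L by (simp add: pos_le_divide_eq mult_ac)
    ultimately have lx: "lx \<ge> ln 4" "lx > 0" "ln 4 \<le> lx / (400 * L)" by linarith+
    have "exp (ln 4) \<le> exp lx" using lx(1) by (simp only: exp_le_cancel_iff)
    then have x4: "x \<ge> 4" using x1 by (simp add: lx_def)
    have Xx: "real X \<le> x" "x < real X + 1" "X \<ge> 4" using x4 unfolding X_def by linarith+
    define S where "S = {n. squarefree n \<and> (\<forall>q\<in>prime_factors n. lx < 400 * L * ln (real q))}"
    define Z where "Z = exp (lx / (400 * L))"
    define z where "z = nat \<lfloor>Z\<rfloor>"
    have "exp (ln 4) \<le> Z" unfolding Z_def using lx(3) by (simp only: exp_le_cancel_iff)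
    then have Z4: "Z \<ge> 4" by simp
    then have z: "real z \<le> Z" "Z < real z + 1" "z \<ge> 4" unfolding z_def by linarith+
    have "lx * 1 \<le> lx * (400 * L)" using L lx by (intro mult_left_mono) auto
    then have "lx / (400 * L) \<le> lx" using L by (simp add: field_simps)
    then have "Z \<le> exp lx" unfolding Z_def by (simp only: exp_le_cancel_iff)
    then have "Z \<le> x" using x1 by (simp add: lx_def)
    then have zX: "z \<le> X" using z unfolding X_def by (intro le_nat_floor) linarith
    \<comment> \<open>Replacing Z by its integer part costs at most half of the logarithm, hence 800
      instead of 400.\<close>
    have "Z \<le> 2 * real z" using z by linarith
    also have "\<dots> \<le> real z * real z" using z by (intro mult_right_mono) auto
    finally have "ln Z \<le> ln (real z * real z)" using Z4 by (intro ln_mono) auto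
    then have lz: "lx / (800 * L) \<le> ln (real z)" using z L by (simp add: Z_def ln_mult)
    have lX: "ln (real X) \<le> lx" unfolding lx_def using Xx by (intro ln_mono) auto
    have "x \<le> 2 * real X" using Xx by linarith
    also have "\<dots> \<le> real X * real X" using Xx by (intro mult_right_mono) auto
    finally have "ln x \<le> ln (real X * real X)" using x1 by (intro ln_mono) auto
    then have lX2: "lx / 2 \<le> ln (real X)" using Xx by (simp add: ln_mult lx_def)
    have "(\<Sum>n\<in>S \<inter> {1..X}. 1 / real n) \<le> exp 6 * (ln (real X) / ln (real z)) ^ 2"
    proof (rule sum_inverse_rough_le[OF _ zX, of _ X])
      fix n q assume n: "n \<in> S \<inter> {1..X}" and q: "q \<in> prime_factors n"
      have q0: "q > 0" using q by (auto simp: in_prime_factors_iff prime_gt_0_nat)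
      have "lx < 400 * L * ln (real q)" using n q by (auto simp: S_def)
      then have "lx / (400 * L) < ln (real q)" using L by (simp add: field_simps)
      then have "Z < exp (ln (real q))" unfolding Z_def by (simp only: exp_less_cancel_iff)
      then have "real z < real q" using z q0 by simp
      moreover have "q \<le> n" using n q by (auto simp: in_prime_factors_iff dest: dvd_imp_le)
      ultimately show "z < q \<and> q \<le> X" using n by simp
    qed (use z in auto)
    also have "\<dots> \<le> exp 6 * (800 * L) ^ 2"
    proof (intro mult_left_mono power_mono)
      have "ln (real X) / ln (real z) \<le> lx / (lx / (800 * L))"
        using lX lz lx L by (intro frac_le) auto
      then show "ln (real X) / ln (real z) \<le> 800 * L" using lx by simp
    qed (use z Xx in auto)
    finally have sumS: "(\<Sum>n\<in>S \<inter> {1..X}. 1 / real n) \<le> exp 6 * (800 * L) ^ 2" .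
    have "real (card (S \<inter> {1..X})) * (lx / 2) \<le> real (card (S \<inter> {1..X})) * ln (real X)"
      using lX2 by (intro mult_left_mono) auto
    \<comment> \<open>\<open>S\<close> is closed under division by a prime factor, so it takes both
      roles in \<open>card_mult_ln_le\<close>.\<close>
    also have "\<dots> \<le> real X * (4 * (\<Sum>n\<in>S \<inter> {1..X}. 1 / real n) + (\<Sum>n\<in>S \<inter> {1..X}. 1 / real n))"
    proof (rule card_mult_ln_le)
      fix n q assume n: "n \<in> S" and q: "q \<in> prime_factors n"
      have sq: "squarefree n" using n by (simp add: S_def)
      note * = squarefree_div_prime[OF sq q]
      have "prime_factors (n div q) \<subseteq> prime_factors n"
        using *(3,5) sq by (metis dvd_prime_factors dvd_triv_right not_squarefree_0)
      then show "n div q \<in> S" using n *(1) by (auto simp: S_def)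
    qed (use Xx in \<open>auto simp: S_def\<close>)
    also have "\<dots> = real X * (5 * (\<Sum>n\<in>S \<inter> {1..X}. 1 / real n))" by simp
    also have "\<dots> \<le> x * (5 * (exp 6 * (800 * L) ^ 2))"
      using sumS Xx x1 by (intro mult_mono) (auto intro!: sum_nonneg)
    finally have card: "real (card (S \<inter> {1..X})) \<le> 10 * exp 6 * 800 ^ 2 * (x * L ^ 2 / lx)"
      using lx by (simp add: field_simps power_mult_distrib)
    have "(\<Sum>n | n \<in> {2..X} \<and> squarefree n \<and> (\<forall>q\<in>prime_factors n. lx < 400 * L * ln (real q)).
        real ((omega n - 1) choose i)) = (\<Sum>n\<in>S \<inter> {2..X}. real ((omega n - 1) choose i))"
      by (intro sum.cong) (auto simp: S_def)
    also have "\<dots> \<le> (\<Sum>n\<in>S \<inter> {2..X}. (400 * L) ^ i)"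
    proof (intro sum_mono)
      fix n assume n: "n \<in> S \<inter> {2..X}"
      have "real (omega n) * (lx / (400 * L)) = (\<Sum>q\<in>prime_factors n. lx / (400 * L))" by (simp add: omega_def)
      also have "\<dots> \<le> (\<Sum>q\<in>prime_factors n. ln (real q))"
        using n L by (intro sum_mono) (auto simp: S_def field_simps intro: less_imp_le)
      also have "\<dots> = ln (real n)" using n by (intro ln_squarefree[symmetric]) (auto simp: S_def)
      also have "\<dots> \<le> ln (real X)" using n by simp
      also have "\<dots> \<le> lx" by (rule lX)
      finally have w: "real (omega n) \<le> 400 * L" using lx L by (simp add: field_simps)
      have "real ((omega n - 1) choose i) \<le> real (omega n) ^ i"
      proof (cases "i \<le> omega n - 1")
        case True
        then have "(omega n - 1) choose i \<le> (omega n - 1) ^ i" by (rule binomial_le_pow)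
        also have "\<dots> \<le> omega n ^ i" by (intro power_mono) auto
        finally show ?thesis by (metis of_nat_le_iff of_nat_power)
      qed (simp add: binomial_eq_0)
      also have "\<dots> \<le> (400 * L) ^ i" using w by (intro power_mono) auto
      finally show "real ((omega n - 1) choose i) \<le> (400 * L) ^ i" .
    qed
    also have "\<dots> = real (card (S \<inter> {2..X})) * (400 * L) ^ i" by simp
    also have "\<dots> \<le> (10 * exp 6 * 800 ^ 2 * (x * L ^ 2 / lx)) * (400 * L) ^ i"
    proof (intro mult_right_mono)
      have "card (S \<inter> {2..X}) \<le> card (S \<inter> {1..X})" by (intro card_mono) auto
      then show "real (card (S \<inter> {2..X})) \<le> 10 * exp 6 * 800 ^ 2 * (x * L ^ 2 / lx)" using card by linarith
    qed (use L in auto)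
    also have "\<dots> = K * x * L ^ (i + 2) / lx" by (simp add: K_def power_mult_distrib power_add power2_eq_square mult_ac)
    finally show ?thesis by (simp only: L_def lx_def X_def)
  qed
  moreover have "K > 0" by (simp add: K_def)
  ultimately show ?thesis by blast
qed

section \<open>Combining small and large least prime factors\<close>

lemma least_prime_factor_in: "n \<ge> 2 \<Longrightarrow> least_prime_factor n \<in> prime_factors n"
  unfolding least_prime_factor_def by (intro Min_in) (auto simp: prime_factorization_empty_iff)

lemma lpf_class_eq:
  "lpf_class j l x = {n \<in> {2..nat \<lfloor>x\<rfloor>}. [least_prime_factor n = j] (mod l)}"
proof -
  have "real n \<le> x \<longleftrightarrow> n \<le> nat \<lfloor>x\<rfloor>" if "n \<ge> 2" for n
    using that by (auto simp: le_nat_floor) linarith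
  then show ?thesis by (auto simp: lpf_class_def)
qed

text \<open>The exponent i + 3 is the i + 2 available for each single small prime, plus one for
  summing 1 / p over these primes. The integers with a large least prime factor contribute only i +
  2.\<close>

lemma sum_moebius_binomial_bound:
  "\<exists>C>0. \<forall>\<^sub>F x::real in at_top. \<forall>j.
     \<bar>\<Sum>n\<in>lpf_class j l x. real_of_int (moebius_mu n) * real ((omega n - 1) choose i)\<bar>
       \<le> C * (x * ln (ln x) ^ (i + 3) / ln x)"
proof -
  obtain K1 where K1: "K1 > 0" "\<And>x p. x > 1 \<Longrightarrow> ln (ln x) \<ge> 1 \<Longrightarrow> ln x \<ge> 8 \<Longrightarrow> prime p \<Longrightarrow>
     400 * ln (ln x) * ln (real p) \<le> ln x \<Longrightarrow>
     (\<Sum>d\<in>sqf_omega i (nat \<lfloor>x\<rfloor> div p). \<bar>mertens_coprime (avoid p d) (nat \<lfloor>x\<rfloor> div p div d)\<bar>)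
       \<le> K1 * (x / real p) * ln (ln x) ^ (i + 2) / ln x"
    using sum_mertens_coprime_small_prime[of i] by blast
  obtain K2 where K2: "K2 > 0" "\<And>x. x > 1 \<Longrightarrow> ln (ln x) \<ge> 1 \<Longrightarrow> 400 * ln (ln x) * ln 4 \<le> ln x \<Longrightarrow>
     (\<Sum>n | n \<in> {2..nat \<lfloor>x\<rfloor>} \<and> squarefree n \<and> (\<forall>q\<in>prime_factors n. ln x < 400 * ln (ln x) * ln (real q)).
        real ((omega n - 1) choose i)) \<le> K2 * x * ln (ln x) ^ (i + 2) / ln x"
    using sum_rough_binomial_le[of i] by blast
  have ev: "\<forall>\<^sub>F x::real in at_top. x > 1 \<and> ln (ln x) \<ge> 1 \<and> ln x \<ge> 8 \<and> 400 * ln (ln x) * ln 4 \<le> ln x"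
    by (intro eventually_conj) real_asymp+
  have "\<bar>\<Sum>n\<in>lpf_class j l x. real_of_int (moebius_mu n) * real ((omega n - 1) choose i)\<bar>
       \<le> (9 * K1 + K2) * (x * ln (ln x) ^ (i + 3) / ln x)"
    if x1: "x > 1" and Lx: "ln (ln x) \<ge> 1" and x8: "ln x \<ge> 8" and big: "400 * ln (ln x) * ln 4 \<le> ln x" for x j
  proof -
    define L where "L = ln (ln x)"
    define X where "X = nat \<lfloor>x\<rfloor>"
    have L: "L \<ge> 1" using Lx by (simp add: L_def)
    let ?g = "\<lambda>n. real_of_int (moebius_mu n) * real ((omega n - 1) choose i)"
    let ?C = "lpf_class j l x"
    define small where "small = (\<lambda>p. 400 * L * ln (real p) \<le> ln x)"
    define A where "A = {n \<in> ?C. small (least_prime_factor n)}"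
    define B where "B = {n \<in> ?C. \<not> small (least_prime_factor n)}"
    have C: "?C = {n \<in> {2..X}. [least_prime_factor n = j] (mod l)}" by (simp add: lpf_class_eq X_def)
    have fin: "finite A" "finite B" by (auto simp: A_def B_def C)
    have "(\<Sum>n\<in>?C. ?g n) = (\<Sum>n\<in>A \<union> B. ?g n)" by (intro sum.cong) (auto simp: A_def B_def)
    also have "\<dots> = (\<Sum>n\<in>A. ?g n) + (\<Sum>n\<in>B. ?g n)"
      using fin by (intro sum.union_disjoint) (auto simp: A_def B_def)
    finally have split: "\<bar>\<Sum>n\<in>?C. ?g n\<bar> \<le> \<bar>\<Sum>n\<in>A. ?g n\<bar> + \<bar>\<Sum>n\<in>B. ?g n\<bar>" by simp
    have "\<bar>\<Sum>n\<in>B. ?g n\<bar> \<le> (\<Sum>n\<in>B. \<bar>?g n\<bar>)" by (rule sum_abs)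
    also have "\<dots> = (\<Sum>n\<in>{n \<in> B. squarefree n}. \<bar>?g n\<bar>)"
      using fin by (intro sum.mono_neutral_right) (auto simp: moebius_mu_def)
    also have "\<dots> \<le> (\<Sum>n\<in>{n \<in> B. squarefree n}. real ((omega n - 1) choose i))"
    proof (intro sum_mono)
      fix n
      have "\<bar>real_of_int (moebius_mu n)\<bar> \<le> 1" using abs_moebius_mu_le[of n] by linarith
      then show "\<bar>?g n\<bar> \<le> real ((omega n - 1) choose i)" unfolding abs_mult
        by (metis abs_of_nat mult_left_le_one_le abs_ge_zero of_nat_0_le_iff)
    qed
    also have "\<dots> \<le> (\<Sum>n | n \<in> {2..X} \<and> squarefree n \<and> (\<forall>q\<in>prime_factors n. ln x < 400 * L * ln (real q)). real ((omega n - 1) choose i))"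
    proof (rule sum_mono2)
      show "finite {n. n \<in> {2..X} \<and> squarefree n \<and> (\<forall>q\<in>prime_factors n. ln x < 400 * L * ln (real q))}"
        by (rule finite_subset[of _ "{2..X}"]) auto
      show "{n \<in> B. squarefree n} \<subseteq> {n. n \<in> {2..X} \<and> squarefree n \<and> (\<forall>q\<in>prime_factors n. ln x < 400 * L * ln (real q))}"
      proof clarify
        fix n assume n: "n \<in> B" "squarefree n"
        then have n2: "n \<in> {2..X}" by (auto simp: B_def C)
        have "ln x < 400 * L * ln (real q)" if q: "q \<in> prime_factors n" for q
        proof -
          let ?p = "least_prime_factor n"
          have "?p \<le> q" using q by (simp add: least_prime_factor_def)
          moreover have "?p > 0" using least_prime_factor_in[of n] n2 by (auto simp: in_prime_factors_iff prime_gt_0_nat)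
          ultimately have "ln (real ?p) \<le> ln (real q)" by simp
          then have "400 * L * ln (real ?p) \<le> 400 * L * ln (real q)" using L by (intro mult_left_mono) auto
          moreover have "ln x < 400 * L * ln (real ?p)" using n by (simp add: B_def small_def)
          ultimately show ?thesis by linarith
        qed
        then show "n \<in> {2..X} \<and> squarefree n \<and> (\<forall>q\<in>prime_factors n. ln x < 400 * L * ln (real q))" using n n2 by blast
      qed
    qed auto
    also have "\<dots> \<le> K2 * x * L ^ (i + 2) / ln x"
      using K2(2)[OF x1 Lx big] by (simp only: L_def X_def)
    finally have Bb: "\<bar>\<Sum>n\<in>B. ?g n\<bar> \<le> K2 * x * L ^ (i + 2) / ln x" .
    let ?P = "least_prime_factor ` A"
    have P: "prime p \<and> p \<le> X \<and> small p" if "p \<in> ?P" for p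
    proof -
      from that obtain n where n: "n \<in> A" "p = least_prime_factor n" by auto
      then have n2: "n \<in> {2..X}" by (auto simp: A_def C)
      then have pf: "p \<in> prime_factors n" using least_prime_factor_in[of n] n by auto
      then have "prime p" "p \<le> n" using n2 by (auto simp: in_prime_factors_iff dest: dvd_imp_le)
      then show ?thesis using n n2 by (auto simp: A_def)
    qed
    have "(\<Sum>n\<in>A. ?g n) = (\<Sum>p\<in>?P. \<Sum>n\<in>{n \<in> A. least_prime_factor n = p}. ?g n)"
      by (rule sum.image_gen) (rule fin)
    \<comment> \<open>Membership in the class and in \<open>A\<close> depends on n only through its
      least prime factor, so each fibre over ?P consists of all n up to X with that least
      prime.\<close>
    also have "\<dots> = (\<Sum>p\<in>?P. \<Sum>n | n \<in> {2..X} \<and> least_prime_factor n = p. ?g n)"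
      by (intro sum.cong refl) (auto simp: A_def C)
    finally have "\<bar>\<Sum>n\<in>A. ?g n\<bar> \<le> (\<Sum>p\<in>?P. \<bar>\<Sum>n | n \<in> {2..X} \<and> least_prime_factor n = p. ?g n\<bar>)" by simp
    also have "\<dots> \<le> (\<Sum>p\<in>?P. (K1 * x * L ^ (i + 2) / ln x) * (1 / real p))"
    proof (intro sum_mono)
      fix p assume "p \<in> ?P"
      then have p: "prime p" "small p" using P by auto
      have "\<bar>\<Sum>n | n \<in> {2..X} \<and> least_prime_factor n = p. ?g n\<bar> \<le>
         (\<Sum>d\<in>sqf_omega i (X div p). \<bar>mertens_coprime (avoid p d) (X div p div d)\<bar>)"
        by (rule abs_sum_moebius_lpf_le[OF p(1)])
      also have "\<dots> \<le> K1 * (x / real p) * L ^ (i + 2) / ln x"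
        using K1(2)[OF x1 Lx x8 p(1)] p(2) by (simp only: L_def X_def small_def)
      finally show "\<bar>\<Sum>n | n \<in> {2..X} \<and> least_prime_factor n = p. ?g n\<bar> \<le> (K1 * x * L ^ (i + 2) / ln x) * (1 / real p)"
        by (simp add: mult_ac)
    qed
    also have "\<dots> = (K1 * x * L ^ (i + 2) / ln x) * (\<Sum>p\<in>?P. 1 / real p)" by (simp only: sum_distrib_left)
    also have "\<dots> \<le> (K1 * x * L ^ (i + 2) / ln x) * (9 * L)"
    proof (intro mult_left_mono)
      have "(\<Sum>p\<in>?P. 1 / real p) \<le> (\<Sum>q | prime q \<and> q \<le> X. 1 / real q)"
        using P by (intro sum_mono2) auto
      also have "\<dots> \<le> 7 + 2 * L" unfolding L_def using x1 Lx by (intro sum_inverse_primes_upto_le) (auto simp: X_def)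
      finally show "(\<Sum>p\<in>?P. 1 / real p) \<le> 9 * L" using L by linarith
    qed (use K1 x1 L x8 in auto)
    also have "\<dots> = 9 * K1 * (x * L ^ (i + 3) / ln x)" by (simp add: power_add power3_eq_cube power2_eq_square)
    finally have Ab: "\<bar>\<Sum>n\<in>A. ?g n\<bar> \<le> 9 * K1 * (x * L ^ (i + 3) / ln x)" .
    have "L ^ (i + 2) \<le> L ^ (i + 3)" using L by (intro power_increasing) auto
    then have "K2 * x * L ^ (i + 2) / ln x \<le> K2 * x * L ^ (i + 3) / ln x"
      using K2(1) x1 x8 by (intro divide_right_mono mult_left_mono) auto
    then have "\<bar>\<Sum>n\<in>B. ?g n\<bar> \<le> K2 * (x * L ^ (i + 3) / ln x)" using Bb by simp
    with split Ab show ?thesis unfolding L_def[symmetric] distrib_right by linarith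
  qed
  then have "\<forall>\<^sub>F x::real in at_top. \<forall>j.
     \<bar>\<Sum>n\<in>lpf_class j l x. real_of_int (moebius_mu n) * real ((omega n - 1) choose i)\<bar>
       \<le> (9 * K1 + K2) * (x * ln (ln x) ^ (i + 3) / ln x)"
    by (intro eventually_mono[OF ev]) auto
  then show ?thesis using K1(1) K2(1) by (intro exI[of _ "9 * K1 + K2"]) auto
qed

text \<open>The binomials in w span the polynomials in w; the induction rests on (w + 1) * (w choose
  i) = (i + 1) * ((w choose i) + (w choose (i + 1))). The power is taken of \<open>Suc w\<close>
  because w will be omega n - 1.\<close>

lemma power_Suc_binomial_expansion:
  "\<exists>c. \<forall>w::nat. real (Suc w) ^ k = (\<Sum>i\<le>k. c i * real (w choose i))"
proof (induction k)
  case 0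
  show ?case by (rule exI[of _ "\<lambda>_. 1"]) simp
next
  case (Suc k)
  then obtain c where c: "\<And>w::nat. real (Suc w) ^ k = (\<Sum>i\<le>k. c i * real (w choose i))" by blast
  define c' where "c' = (\<lambda>i. (if i \<le> k then c i * real (Suc i) else 0) + (if i = 0 then 0 else c (i - 1) * real i))"
  have "real (Suc w) ^ Suc k = (\<Sum>i\<le>Suc k. c' i * real (w choose i))" for w :: nat
  proof -
    have step: "real (Suc w) * real (w choose i) = real (Suc i) * real (w choose i) + real (Suc i) * real (w choose Suc i)" for i
    proof -
      have "Suc w * (w choose i) = Suc i * (Suc w choose Suc i)" by (metis Suc_times_binomial_eq mult.commute)
      also have "\<dots> = Suc i * (w choose i) + Suc i * (w choose Suc i)" by (simp add: distrib_left)
      finally show ?thesis by (metis of_nat_add of_nat_mult)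
    qed
    have "real (Suc w) ^ Suc k = (\<Sum>i\<le>k. c i * (real (Suc w) * real (w choose i)))"
      using c[of w] by (simp add: sum_distrib_left mult_ac)
    also have "\<dots> = (\<Sum>i\<le>k. c i * real (Suc i) * real (w choose i)) + (\<Sum>i\<le>k. c i * real (Suc i) * real (w choose Suc i))"
      unfolding step sum.distrib[symmetric] by (simp add: algebra_simps)
    also have "(\<Sum>i\<le>k. c i * real (Suc i) * real (w choose i)) = (\<Sum>i\<le>Suc k. (if i \<le> k then c i * real (Suc i) else 0) * real (w choose i))"
      by simp
    also have "(\<Sum>i\<le>k. c i * real (Suc i) * real (w choose Suc i)) = (\<Sum>i\<le>Suc k. (if i = 0 then 0 else c (i - 1) * real i) * real (w choose i))"
      by (subst sum.atMost_Suc_shift) simp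
    finally show ?thesis unfolding c'_def sum.distrib[symmetric] distrib_right .
  qed
  then show ?case by blast
qed

theorem theorem6p1:
  fixes k l :: nat
  assumes "k \<ge> 4"
  shows "(\<exists>C::real. \<forall>\<^sub>F x::real in at_top. \<forall>j. 1 \<le> j \<and> j \<le> l \<and> gcd j l = 1 \<longrightarrow>
           \<bar>\<Sum>n\<in>lpf_class j l x. real_of_int (moebius_mu n) * real (omega n) ^ (k - 1)\<bar>
             \<le> C * (x * ln (ln x) ^ (k + 2) / ln x)) \<and>
         (\<exists>C::real. \<forall>\<^sub>F x::real in at_top. \<forall>j. 1 \<le> j \<and> j \<le> l \<and> gcd j l = 1 \<longrightarrow>
           \<bar>\<Sum>n\<in>lpf_class j l x. real_of_int (moebius_mu n) * real ((omega n - 1) choose (k - 1))\<bar>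
             \<le> C * (x * ln (ln x) ^ (k + 2) / ln x))"
proof -
  have "\<forall>i. \<exists>C>0. \<forall>\<^sub>F x::real in at_top. \<forall>j.
     \<bar>\<Sum>n\<in>lpf_class j l x. real_of_int (moebius_mu n) * real ((omega n - 1) choose i)\<bar>
       \<le> C * (x * ln (ln x) ^ (i + 3) / ln x)"
    by (intro allI sum_moebius_binomial_bound)
  from choice[OF this] obtain C where C: "\<And>i. C i > 0" "\<And>i. \<forall>\<^sub>F x::real in at_top. \<forall>j.
     \<bar>\<Sum>n\<in>lpf_class j l x. real_of_int (moebius_mu n) * real ((omega n - 1) choose i)\<bar>
       \<le> C i * (x * ln (ln x) ^ (i + 3) / ln x)"
    by blast
  \<comment> \<open>The largest index i = k - 1 gives exactly the exponent k + 2; smaller indices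
    give smaller powers of ln (ln x), which is at least 1.\<close>
  have k: "k - 1 + 3 = k + 2" using assms by simp
  obtain c where c: "\<And>w::nat. real (Suc w) ^ (k - 1) = (\<Sum>i\<le>k - 1. c i * real (w choose i))"
    using power_Suc_binomial_expansion[of "k - 1"] by blast
  define F where "F = (\<Sum>i\<le>k - 1. \<bar>c i\<bar> * C i)"
  have ev: "\<forall>\<^sub>F x::real in at_top. x > 1 \<and> ln (ln x) \<ge> 1"
    by (intro eventually_conj) real_asymp+
  have all: "\<forall>\<^sub>F x::real in at_top. \<forall>i\<in>{..k - 1}. \<forall>j.
     \<bar>\<Sum>n\<in>lpf_class j l x. real_of_int (moebius_mu n) * real ((omega n - 1) choose i)\<bar>
       \<le> C i * (x * ln (ln x) ^ (i + 3) / ln x)"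
    using C(2) by (simp add: eventually_ball_finite_distrib)
  have "\<forall>\<^sub>F x::real in at_top. \<forall>j.
      \<bar>\<Sum>n\<in>lpf_class j l x. real_of_int (moebius_mu n) * real (omega n) ^ (k - 1)\<bar>
             \<le> F * (x * ln (ln x) ^ (k + 2) / ln x)"
    using ev all
  proof eventually_elim
    case (elim x)
    show ?case
    proof
      fix j
      let ?T = "\<lambda>i. \<Sum>n\<in>lpf_class j l x. real_of_int (moebius_mu n) * real ((omega n - 1) choose i)"
      have "(\<Sum>n\<in>lpf_class j l x. real_of_int (moebius_mu n) * real (omega n) ^ (k - 1)) =
            (\<Sum>n\<in>lpf_class j l x. \<Sum>i\<le>k - 1. c i * (real_of_int (moebius_mu n) * real ((omega n - 1) choose i)))"
      proof (intro sum.cong refl)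
        fix n assume "n \<in> lpf_class j l x"
        then have "omega n \<ge> 1" by (intro omega_pos) (simp add: lpf_class_def)
        then have "real (omega n) ^ (k - 1) = (\<Sum>i\<le>k - 1. c i * real ((omega n - 1) choose i))"
          using c[of "omega n - 1"] by simp
        then show "real_of_int (moebius_mu n) * real (omega n) ^ (k - 1) =
            (\<Sum>i\<le>k - 1. c i * (real_of_int (moebius_mu n) * real ((omega n - 1) choose i)))"
          by (simp add: sum_distrib_left mult_ac)
      qed
      also have "\<dots> = (\<Sum>i\<le>k - 1. c i * ?T i)" by (subst sum.swap) (simp only: sum_distrib_left)
      also have "\<bar>\<dots>\<bar> \<le> (\<Sum>i\<le>k - 1. (\<bar>c i\<bar> * C i) * (x * ln (ln x) ^ (k + 2) / ln x))"
      proof (intro sum_abs[THEN order_trans] sum_mono)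
        fix i assume i: "i \<in> {..k - 1}"
        have "ln x > 0" using elim by simp
        have "ln (ln x) ^ (i + 3) \<le> ln (ln x) ^ (k + 2)"
          using elim i k by (intro power_increasing) auto
        then have "C i * (x * ln (ln x) ^ (i + 3) / ln x) \<le> C i * (x * ln (ln x) ^ (k + 2) / ln x)"
          using C(1)[of i] elim \<open>ln x > 0\<close> by (intro mult_left_mono divide_right_mono) auto
        then have "\<bar>?T i\<bar> \<le> C i * (x * ln (ln x) ^ (k + 2) / ln x)" using elim i by (meson order_trans)
        then have "\<bar>c i\<bar> * \<bar>?T i\<bar> \<le> \<bar>c i\<bar> * (C i * (x * ln (ln x) ^ (k + 2) / ln x))" by (intro mult_left_mono) auto
        then show "\<bar>c i * ?T i\<bar> \<le> (\<bar>c i\<bar> * C i) * (x * ln (ln x) ^ (k + 2) / ln x)"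
          by (simp only: abs_mult mult.assoc)
      qed
      also have "\<dots> = F * (x * ln (ln x) ^ (k + 2) / ln x)" by (simp only: F_def sum_distrib_right)
      finally show "\<bar>\<Sum>n\<in>lpf_class j l x. real_of_int (moebius_mu n) * real (omega n) ^ (k - 1)\<bar>
             \<le> F * (x * ln (ln x) ^ (k + 2) / ln x)" .
    qed
  qed
  then have 1: "\<forall>\<^sub>F x::real in at_top. \<forall>j. 1 \<le> j \<and> j \<le> l \<and> gcd j l = 1 \<longrightarrow>
      \<bar>\<Sum>n\<in>lpf_class j l x. real_of_int (moebius_mu n) * real (omega n) ^ (k - 1)\<bar>
             \<le> F * (x * ln (ln x) ^ (k + 2) / ln x)"
    by (rule eventually_mono) blast
  have 2: "\<forall>\<^sub>F x::real in at_top. \<forall>j. 1 \<le> j \<and> j \<le> l \<and> gcd j l = 1 \<longrightarrow>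
           \<bar>\<Sum>n\<in>lpf_class j l x. real_of_int (moebius_mu n) * real ((omega n - 1) choose (k - 1))\<bar>
             \<le> C (k - 1) * (x * ln (ln x) ^ (k + 2) / ln x)"
    using C(2)[of "k - 1"] unfolding k by (rule eventually_mono) blast
  show ?thesis using 1 2 by blast
qed

end
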